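(* Let $a<b$ be real numbers, $n\ge 1$ an integer, $0<d<\pi$, $\alpha>0$, and $\mathbf{r}\in\mathbb{C}^n$. Let $K=[k_{ij}]$ be an $n\times n$ matrix of functions and $\mathbf{g}=[g_1,\ldots,g_n]^{\mathrm T}$ a vector of functions, and put $Q(z)=(z-a)(b-z)$. Assume that $k_{ij}Q\in \mathbf{L}_{\alpha}(\psi^{\mathrm{SE}}(\mathscr{D}_d))$ for all $i,j=1,\ldots,n$ and $g_iQ\in \mathbf{L}_{\alpha}(\psi^{\mathrm{SE}}(\mathscr{D}_d))$ for all $i=1,\ldots,n$. Let $\mathbf{y}=[y_1,\ldots,y_n]^{\mathrm T}$ be the solution of $\mathbf{y}'(t)=K(t)\mathbf{y}(t)+\mathbf{g}(t)$ $(a\le t\le b)$, $\mathbf{y}(a)=\mathbf{r}$, and for each positive integer $N$ let $h=\sqrt{\pi d/(\alpha N)}$. Then there exist $N_0$ and a constant $C$ independent of $N$ such that for all $N\ge N_0$ the SE-Sinc linear system (defined in the context) is uniquely solvable, and the SE-Sinc-Nystr\"om solution $\mathbf{y}^{(N)}=[y_1^{(N)},\ldots,y_n^{(N)}]^{\mathrm T}$ (defined in the context) satisfies $$\max_{i=1,\ldots,n}\Bigl\{\max_{a\le t\le b}|y_i(t)-y_i^{(N)}(t)|\Bigr\}\le C\exp\left(-\sqrt{\pi d\alpha N}\right).$$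
   Context: $\mathscr{D}_d=\{\zeta\in\mathbb{C}:|\operatorname{Im}\zeta|<d\}$, $\psi^{\mathrm{SE}}(\zeta)=\frac{b-a}{2}\tanh(\zeta/2)+\frac{b+a}{2}$, with inverse $\phi^{\mathrm{SE}}(t)=\log\frac{t-a}{b-t}$ on $(a,b)$, and $\psi^{\mathrm{SE}}(\mathscr{D}_d)$ is the image of $\mathscr{D}_d$ under $\psi^{\mathrm{SE}}$, a bounded simply connected domain containing $(a,b)$. For $\mathscr{D}=\psi^{\mathrm{SE}}(\mathscr{D}_d)$ and $\alpha>0$, $\mathbf{L}_{\alpha}(\mathscr{D})$ is the set of bounded analytic functions $f$ on $\mathscr{D}$ for which there is a constant $L$ with $|f(z)|\le L|Q(z)|^{\alpha}$ for all $z\in\mathscr{D}$, where $Q(z)=(z-a)(b-z)$. The initial value problem is understood in the equivalent integrated form $\mathbf{y}(t)=\mathbf{r}+\int_a^t\{\mathbf{g}(s)+K(s)\mathbf{y}(s)\}\,ds$, $a\le t\le b$, with $\mathbf{y}$ continuous on $[a,b]$ ($k_{ij},g_i$ may have integrable singularities at $a,b$); under the stated assumptions it has a unique solution. Sampling points: $t_j^{\mathrm{SE}}=\psi^{\mathrm{SE}}(jh)$, $j=-N,\ldots,N$. Sine integral: $\operatorname{Si}(x)=\int_0^x\frac{\sin u}{u}\,du$. Put $J(j,h)(x)=h\left\{\frac12+\frac1\pi\operatorname{Si}[\pi(x/h-j)]\right\}$, with limiting values $J(j,h)(-\infty)=0$, $J(j,h)(+\infty)=h$ used for $x=\phi^{\mathrm{SE}}(t)$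 at $t=a,b$. SE-Sinc linear system: let $\sigma_k=\frac12+\frac1\pi\operatorname{Si}(\pi k)$, $I_N^{(-1)}=[\sigma_{i-j}]_{i,j=-N}^{N}$ (a $(2N+1)\times(2N+1)$ matrix), $D_N^{\mathrm{SE}}=\operatorname{diag}[(\psi^{\mathrm{SE}})'(-Nh),\ldots,(\psi^{\mathrm{SE}})'(Nh)]$, $K_{ij}^{\mathrm{SE}}=\operatorname{diag}[k_{ij}(t_{-N}^{\mathrm{SE}}),\ldots,k_{ij}(t_N^{\mathrm{SE}})]$, and $[K_{ij}^{\mathrm{SE}}]$ the $n\times n$ block matrix with blocks $K_{ij}^{\mathrm{SE}}$. Let $I_N$, $I_n$ be the identity matrices of order $2N+1$ and $n$, respectively. Let $\mathbf{R}=[r_1,\ldots,r_1,r_2,\ldots,r_2,\ldots,r_n]^{\mathrm T}$ (each $r_i$ repeated $2N+1$ times) and $\mathbf{G}^{\mathrm{SE}}=[g_1(t_{-N}^{\mathrm{SE}}),\ldots,g_1(t_N^{\mathrm{SE}}),\ldots,g_n(t_{-N}^{\mathrm{SE}}),\ldots,g_n(t_N^{\mathrm{SE}})]^{\mathrm T}$. The system for the unknown vector $\mathbf{Y}^{\mathrm{SE}}=[y_1^{(N)}(t_{-N}^{\mathrm{SE}}),\ldots,y_1^{(N)}(t_N^{\mathrm{SE}}),\ldots,y_n^{(N)}(t_{-N}^{\mathrm{SE}}),\ldots,y_n^{(N)}(t_N^{\mathrm{SE}})]^{\mathrm T}$ is $$\bigl(I_n\otimes I_N-\bigl(I_n\otimes\{hI_N^{(-1)}D_N^{\mathrm{SE}}\}\bigr)[K_{ij}^{\mathrm{SE}}]\bigr)\mathbf{Y}^{\mathrm{SE}}=\bigl(I_n\otimes\{hI_N^{(-1)}D_N^{\mathrm{SE}}\}\bigr)\mathbf{G}^{\mathrm{SE}}+\mathbf{R},$$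 where $\otimes$ is the Kronecker product. SE-Sinc-Nystr\"om solution: with the values $\mathbf{y}^{(N)}(t_j^{\mathrm{SE}})$ obtained from this system, $$\mathbf{y}^{(N)}(t)=\mathbf{r}+\sum_{j=-N}^N\left\{\mathbf{g}(t_j^{\mathrm{SE}})+K(t_j^{\mathrm{SE}})\mathbf{y}^{(N)}(t_j^{\mathrm{SE}})\right\}(\psi^{\mathrm{SE}})'(jh)\,J(j,h)(\phi^{\mathrm{SE}}(t)).$$ *)

theory Defs
  imports "HOL-Complex_Analysis.Complex_Analysis" "HOL-Probability.Probability"
    "Jordan_Normal_Form.Matrix"
begin

unbundle no vec_syntax

section \<open>The SE transformation and the function spaces\<close>

definition strip :: "real \<Rightarrow> complex set" where
  "strip d = {\<zeta>. \<bar>Im \<zeta>\<bar> < d}"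

definition psi_SE :: "real \<Rightarrow> real \<Rightarrow> complex \<Rightarrow> complex" where
  "psi_SE a b \<zeta> = of_real ((b - a) / 2) * tanh (\<zeta> / 2) + of_real ((b + a) / 2)"

text \<open>The inverse map is extended-real valued, so that it is also meaningful at the two endpoints
  of \<open>{a..b}\<close>; its values outside \<open>{a..b}\<close> are irrelevant.\<close>

definition phi_SE :: "real \<Rightarrow> real \<Rightarrow> real \<Rightarrow> ereal" where
  "phi_SE a b t =
     (if t \<le> a then -\<infinity> else if b \<le> t then \<infinity> else ereal (ln ((t - a) / (b - t))))"

definition Q_fun :: "real \<Rightarrow> real \<Rightarrow> complex \<Rightarrow> complex" where
  "Q_fun a b z = (z - of_real a) * (of_real b - z)"

definition L_space :: "real \<Rightarrow> real \<Rightarrow> real \<Rightarrow> complex set \<Rightarrow> (complex \<Rightarrow> complex) set" where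
  "L_space a b \<alpha> D =
     {f. f analytic_on D \<and> bounded (f ` D) \<and>
         (\<exists>L. \<forall>z\<in>D. cmod (f z) \<le> L * cmod (Q_fun a b z) powr \<alpha>)}"

section \<open>The initial value problem\<close>

text \<open>Vectors and matrices of functions of order \<open>n\<close> are families indexed by \<open>i, j < n\<close>. The
  problem is posed in integrated form; the case \<open>t = a\<close> contains the initial condition, and
  the values of the coefficients at the endpoints play no role.\<close>

definition ivp_solution ::
  "real \<Rightarrow> real \<Rightarrow> nat \<Rightarrow> (nat \<Rightarrow> nat \<Rightarrow> complex \<Rightarrow> complex) \<Rightarrow> (nat \<Rightarrow> complex \<Rightarrow> complex) \<Rightarrow>
   (nat \<Rightarrow> complex) \<Rightarrow> (nat \<Rightarrow> real \<Rightarrow> complex) \<Rightarrow> bool" where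
  "ivp_solution a b n k g r y \<longleftrightarrow>
     (\<forall>i<n. continuous_on {a..b} (y i) \<and>
        (\<forall>t\<in>{a..b}.
           ((\<lambda>s. g i (of_real s) + (\<Sum>l<n. k i l (of_real s) * y l s)) has_integral
              (y i t - r i)) {a..t}))"

section \<open>Sinc indefinite integration\<close>

text \<open>\<^const>\<open>Si\<close> is the sine integral of the library; its integrand \<open>sin x / x\<close> is \<open>0\<close> at \<open>x = 0\<close>,
  which does not affect the integral.\<close>

definition J_SE :: "int \<Rightarrow> real \<Rightarrow> ereal \<Rightarrow> real" where
  "J_SE j h x =
     (case x of
        ereal u \<Rightarrow> h * (1 / 2 + 1 / pi * Si (pi * (u / h - of_int j)))
      | PInfty \<Rightarrow> h
      | MInfty \<Rightarrow> 0)"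

definition sigma_SE :: "int \<Rightarrow> real" where
  "sigma_SE k = 1 / 2 + 1 / pi * Si (pi * of_int k)"

definition node_SE :: "real \<Rightarrow> real \<Rightarrow> real \<Rightarrow> int \<Rightarrow> complex" where
  "node_SE a b h j = psi_SE a b (of_real (of_int j * h))"

definition weight_SE :: "real \<Rightarrow> real \<Rightarrow> real \<Rightarrow> int \<Rightarrow> complex" where
  "weight_SE a b h j = deriv (psi_SE a b) (of_real (of_int j * h))"

section \<open>The linear system\<close>

definition kronecker :: "'a::times mat \<Rightarrow> 'a mat \<Rightarrow> 'a mat" where
  "kronecker A B =
     Matrix.mat (dim_row A * dim_row B) (dim_col A * dim_col B)
       (\<lambda>(p, q). A $$ (p div dim_row B, q div dim_col B) * B $$ (p mod dim_row B, q mod dim_col B))"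

text \<open>The \<open>n \<times> n\<close> block matrix all of whose blocks \<open>B i j\<close> are \<open>m \<times> m\<close>.\<close>

definition square_blocks :: "nat \<Rightarrow> nat \<Rightarrow> (nat \<Rightarrow> nat \<Rightarrow> 'a mat) \<Rightarrow> 'a mat" where
  "square_blocks n m B =
     Matrix.mat (n * m) (n * m) (\<lambda>(p, q). B (p div m) (q div m) $$ (p mod m, q mod m))"

text \<open>Matrix and vector indices start at \<open>0\<close>: position \<open>p\<close> in a block of length \<open>2 * N + 1\<close>
  belongs to the sampling point with number \<open>ix N p\<close> in \<open>{-N..N}\<close>.\<close>

definition ix :: "nat \<Rightarrow> nat \<Rightarrow> int" where
  "ix N p = int p - int N"

definition I_minus :: "nat \<Rightarrow> complex mat" where
  "I_minus N =
     Matrix.mat (2 * N + 1) (2 * N + 1) (\<lambda>(p, q). of_real (sigma_SE (ix N p - ix N q)))"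

definition D_SE :: "real \<Rightarrow> real \<Rightarrow> real \<Rightarrow> nat \<Rightarrow> complex mat" where
  "D_SE a b h N = mat_diag (2 * N + 1) (\<lambda>p. weight_SE a b h (ix N p))"

definition K_SE ::
  "real \<Rightarrow> real \<Rightarrow> real \<Rightarrow> nat \<Rightarrow> nat \<Rightarrow> (nat \<Rightarrow> nat \<Rightarrow> complex \<Rightarrow> complex) \<Rightarrow> complex mat" where
  "K_SE a b h N n k =
     square_blocks n (2 * N + 1)
       (\<lambda>i j. mat_diag (2 * N + 1) (\<lambda>p. k i j (node_SE a b h (ix N p))))"

definition quad_SE :: "real \<Rightarrow> real \<Rightarrow> real \<Rightarrow> nat \<Rightarrow> nat \<Rightarrow> complex mat" where
  "quad_SE a b h N n = kronecker (1\<^sub>m n) (of_real h \<cdot>\<^sub>m (I_minus N * D_SE a b h N))"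

definition R_vec :: "nat \<Rightarrow> nat \<Rightarrow> (nat \<Rightarrow> complex) \<Rightarrow> complex Matrix.vec" where
  "R_vec N n r = Matrix.vec (n * (2 * N + 1)) (\<lambda>p. r (p div (2 * N + 1)))"

definition G_SE ::
  "real \<Rightarrow> real \<Rightarrow> real \<Rightarrow> nat \<Rightarrow> nat \<Rightarrow> (nat \<Rightarrow> complex \<Rightarrow> complex) \<Rightarrow> complex Matrix.vec" where
  "G_SE a b h N n g =
     Matrix.vec (n * (2 * N + 1))
       (\<lambda>p. g (p div (2 * N + 1)) (node_SE a b h (ix N (p mod (2 * N + 1)))))"

definition SE_Sinc_system ::
  "real \<Rightarrow> real \<Rightarrow> real \<Rightarrow> nat \<Rightarrow> nat \<Rightarrow> (nat \<Rightarrow> nat \<Rightarrow> complex \<Rightarrow> complex) \<Rightarrow>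
   (nat \<Rightarrow> complex \<Rightarrow> complex) \<Rightarrow> (nat \<Rightarrow> complex) \<Rightarrow> complex Matrix.vec \<Rightarrow> bool" where
  "SE_Sinc_system a b h N n k g r Y \<longleftrightarrow>
     Y \<in> carrier_vec (n * (2 * N + 1)) \<and>
     (kronecker (1\<^sub>m n) (1\<^sub>m (2 * N + 1)) - quad_SE a b h N n * K_SE a b h N n k) *\<^sub>v Y =
       quad_SE a b h N n *\<^sub>v G_SE a b h N n g + R_vec N n r"

text \<open>The Sinc-Nystroem solution built from a vector \<open>Y\<close> of nodal values: the entry of \<open>Y\<close> for
  component \<open>l\<close> at the sampling point with number \<open>j\<close> is \<open>Y $ (l * (2 * N + 1) + nat (j + int N))\<close>.\<close>

definition SE_Sinc_Nystroem ::
  "real \<Rightarrow> real \<Rightarrow> real \<Rightarrow> nat \<Rightarrow> nat \<Rightarrow> (nat \<Rightarrow> nat \<Rightarrow> complex \<Rightarrow> complex) \<Rightarrow>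
   (nat \<Rightarrow> complex \<Rightarrow> complex) \<Rightarrow> (nat \<Rightarrow> complex) \<Rightarrow> complex Matrix.vec \<Rightarrow>
   nat \<Rightarrow> real \<Rightarrow> complex" where
  "SE_Sinc_Nystroem a b h N n k g r Y i t =
     r i + (\<Sum>j = - int N..int N.
       (g i (node_SE a b h j) +
        (\<Sum>l<n. k i l (node_SE a b h j) * Y $ (l * (2 * N + 1) + nat (j + int N)))) *
       weight_SE a b h j * of_real (J_SE j h (phi_SE a b t)))"

end

theory Submission
  imports Defs "HOL-Real_Asymp.Real_Asymp" "Jordan_Normal_Form.Determinant"
begin

text \<open>
  In the variable \<open>x = \<phi>(t)\<close> the problem becomes \<open>u' = \<gamma> + \<kappa> u\<close> on the real line, with coefficients that are
  holomorphic on the strip \<open>\<bar>Im z\<bar> < d\<close> and bounded there by a multiple of \<open>exp (- \<alpha> \<bar>Re z\<bar>)\<close>. Picard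
  iteration in the strip shows that \<open>u\<close> extends to a bounded holomorphic function, so the integrand
  \<open>\<gamma> + \<kappa> u\<close> has the same decay.

  For such an integrand the error of Sinc interpolation at \<open>x\<close> is \<open>sin (pi x / h)\<close> times a Cauchy type
  integral over the boundary of the strip with the factor \<open>1 / sin (pi z / h)\<close> (residue theorem on
  rectangles). Integrating in \<open>x\<close> and using that the integrals of \<open>sin (pi x / h) / (z - x)\<close> are bounded by
  a multiple of \<open>h\<close> gives the error \<open>O(exp (- pi d / h))\<close> of Sinc indefinite integration, uniformly in \<open>x\<close>;
  cutting off the sum at \<open>N\<close> costs \<open>O(exp (- \<alpha> h N))\<close>, and the choice of \<open>h\<close> balances the two.

  The linear system is stable: its matrix is a Volterra matrix, up to terms that decay like
  \<open>1 / (1 + \<bar>i - j\<bar>)\<close> away from the diagonal and contribute only \<open>O(sqrt h)\<close>. Hence the discrete Gronwall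
  inequality applies; it yields unique solvability and carries the quadrature error over to the nodal
  values and from there to the Nystroem solution.
\<close>

section \<open>Estimates for the sine kernel\<close>

text \<open>The coefficients are controlled in the open strip, without boundary values. The contour
  therefore runs at height \<open>d - h / pi\<close>, which moves with \<open>h\<close>: the factor
  \<open>exp (- pi * d / h)\<close> loses only \<open>exp 1\<close>, and no power of
  \<open>N\<close> appears.

  A uniform pointwise bound of the interpolation error could not be integrated over the line.
  Integrating in \<open>x\<close> inside the Cauchy integral leaves an oscillatory integral whose
  bound does not see its end points. The rectangle has its own size \<open>M\<close>, which tends to
  infinity while \<open>h\<close> and \<open>N\<close> stay fixed.

  The initial point t = a lies at x = - infinity. Picard iteration starts instead at x = 0, with the
  value of \<open>y\<close> at the midpoint of the interval, and uniqueness on the real line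
  identifies the result with \<open>y\<close>; the initial vector comes back as the limit of
  \<open>u\<close> at - infinity.

  In the system, 1 / (1 + |k|) is not summable but its square is, whence the sqrt h. Stability is
  stated in terms of the residual of a vector: residual 0 gives solvability, the quadrature residual
  gives the error.\<close>

lemma contour_integral_horizontal_bound:
  assumes cont: "continuous_on (closed_segment a b) f"
    and ab: "Im a = Im b" "Re a \<le> Re b"
    and der: "\<And>s. (\<phi> has_real_derivative \<phi>' s) (at s)"
    and bnd: "\<And>z. z \<in> closed_segment a b \<Longrightarrow> cmod (f z) \<le> \<phi>' (Re z)"
  shows "cmod (contour_integral (linepath a b) f) \<le> \<phi> (Re b) - \<phi> (Re a)"
proof -
  define R where "R = Re b - Re a"
  have R: "R \<ge> 0" "b - a = of_real R"
    using ab by (auto simp: R_def complex_eq_iff)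
  have "f contour_integrable_on linepath a b"
    by (rule contour_integrable_continuous_linepath) fact
  then have int: "((\<lambda>t. f (linepath a b t) * (b - a)) has_integral contour_integral (linepath a b) f) {0..1}"
    using has_contour_integral_integral has_contour_integral_linepath by blast
  have "((\<lambda>t. \<phi> (Re a + R * t)) has_vector_derivative \<phi>' (Re a + R * t) * R) (at t within {0..1})" for t
    unfolding has_real_derivative_iff_has_vector_derivative[symmetric]
    by (rule DERIV_chain2[of \<phi>, OF der]) (auto intro!: derivative_eq_intros)
  then have "((\<lambda>t. \<phi>' (Re a + R * t) * R) has_integral (\<phi> (Re a + R * 1) - \<phi> (Re a + R * 0))) {0..1}"
    by (intro fundamental_theorem_of_calculus) auto
  then have int2: "((\<lambda>t. \<phi>' (Re a + R * t) * R) has_integral (\<phi> (Re b) - \<phi> (Re a))) {0..1}"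
    by (simp add: R_def)
  have "cmod (f (linepath a b t) * (b - a)) \<le> \<phi>' (Re a + R * t) * R" if "t \<in> {0..1}" for t
  proof -
    have "linepath a b t \<in> closed_segment a b"
      using that linepath_in_path by blast
    moreover have "Re (linepath a b t) = Re a + R * t"
      by (simp add: linepath_def R_def algebra_simps)
    ultimately show ?thesis
      using bnd[of "linepath a b t"] R by (auto simp: norm_mult intro!: mult_right_mono)
  qed
  then have "norm (integral {0..1} (\<lambda>t. f (linepath a b t) * (b - a))) \<le> integral {0..1} (\<lambda>t. \<phi>' (Re a + R * t) * R)"
    using int int2 by (intro integral_norm_bound_integral) (auto simp: integrable_on_def)
  then show ?thesis
    unfolding integral_unique[OF int] integral_unique[OF int2] .
qed

text \<open>Trades the exponential decay for a multiple of the derivative of \<open>arctan\<close>,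
  a primitive that is smooth at 0 and has total variation pi. Integrals over horizontal sides are
  then bounded independently of their length.\<close>

lemma exp_minus_abs_le: "exp (- \<bar>u\<bar>) \<le> 2 / (1 + u\<^sup>2)" for u :: real
proof -
  have "1 + \<bar>u\<bar> + \<bar>u\<bar>\<^sup>2 / 2 \<le> exp \<bar>u\<bar>"
    by (rule exp_lower_Taylor_quadratic) simp
  then have "1 + u\<^sup>2 \<le> 2 * exp \<bar>u\<bar>" by simp
  moreover have "1 + u\<^sup>2 > 0" by (simp add: add_pos_nonneg)
  ultimately show ?thesis
    by (simp add: exp_minus field_simps)
qed

text \<open>The single identity behind both lower bounds of the denominator: the \<open>sinh\<close>
  term serves the horizontal sides of the rectangle, the \<open>sin\<close> term, equal to 1 there,
  the vertical ones.\<close>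

lemma cmod_sin_squared:
  "(cmod (sin z))\<^sup>2 = (sin (Re z))\<^sup>2 + (sinh (Im z))\<^sup>2"
proof -
  have "(cmod (sin z))\<^sup>2 = (sin (Re z) * cosh (Im z))\<^sup>2 + (cos (Re z) * sinh (Im z))\<^sup>2"
  proof -
    have "Re (sin z) = sin (Re z) * cosh (Im z)" "Im (sin z) = cos (Re z) * sinh (Im z)"
      by (simp_all add: Re_sin Im_sin cosh_def sinh_def)
    then show ?thesis by (simp only: cmod_power2)
  qed
  also have "\<dots> = (sin (Re z))\<^sup>2 + (sinh (Im z))\<^sup>2 * ((sin (Re z))\<^sup>2 + (cos (Re z))\<^sup>2)"
    unfolding power_mult_distrib cosh_square_eq by (simp only: algebra_simps)
  finally show ?thesis by simp
qed

lemma abs_sinh_le_cmod_sin: "\<bar>sinh (Im z)\<bar> \<le> cmod (sin z)"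
  using cmod_sin_squared[of z] abs_le_square_iff[of "sinh (Im z)" "cmod (sin z)"] by simp

lemma cmod_sin_ge_1:
  assumes "cos (Re z) = 0"
  shows "1 \<le> cmod (sin z)"
  using cmod_sin_squared[of z] abs_le_square_iff[of 1 "cmod (sin z)"] sin_cos_squared_add[of "Re z"] assms
  by simp

lemma closed_segment_horizontal:
  assumes "z \<in> closed_segment a b" "Im a = Im b" "Re a \<le> Re b"
  shows "Im z = Im a" "Re a \<le> Re z" "Re z \<le> Re b"
  using assms closed_segment_same_Im[of a b] by (auto simp: closed_segment_eq_real_ivl)

text \<open>The kernel is integrated by parts; what remains is dominated by the Poisson kernel.\<close>

lemma sin_cauchy_kernel_bound:
  fixes z :: complex and p x y e :: real
  assumes p: "p > 0" and e: "e > 0" "e \<le> \<bar>Im z\<bar>" and xy: "x \<le> y"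
  shows "cmod (contour_integral (linepath (of_real x) (of_real y)) (\<lambda>\<xi>. sin (of_real p * \<xi>) / (z - \<xi>)))
    \<le> (2 + pi) / (p * e)"
proof (cases "x = y")
  case True
  then show ?thesis using p e by auto
next
  case False
  with xy have xy: "x < y" by simp
  have z: "z - of_real s \<noteq> 0" for s :: real
    using e by (auto simp: complex_eq_iff)
  define f where "f = (\<lambda>s::real. integral {x..s} (\<lambda>s. sin (of_real p * of_real s) / (z - of_real s)))"
  \<comment> \<open>Integration by parts in differentiated form: the derivative of \<open>g\<close>
    cancels the integrand of \<open>f\<close> and leaves cos / (p (z - s)^2). Its modulus is at most
    the derivative of \<open>P\<close>, which varies by at most pi / (p e); the two boundary values
    of \<open>g\<close> cost 1 / (p e) each, whence 2 + pi.\<close>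
  define g where "g = (\<lambda>s::real. cos (of_real p * of_real s) / (of_real p * (z - of_real s)))"
  define P where "P = (\<lambda>s::real. arctan ((s - Re z) / e) / (p * e))"
  have contk: "continuous_on {x..y} (\<lambda>s::real. sin (of_real p * of_real s) / (z - of_real s))"
    by (intro continuous_intros) (use z in auto)
  have df: "(f has_vector_derivative sin (of_real p * of_real s) / (z - of_real s)) (at s within {x..y})"
    if "s \<in> {x..y}" for s
    unfolding f_def using integral_has_vector_derivative[OF contk that] .
  have dg: "(g has_vector_derivative
      - sin (of_real p * of_real s) / (z - of_real s) + cos (of_real p * of_real s) / (of_real p * (z - of_real s)^2)) (at s within A)" for s A
  proof -
    have "((\<lambda>w. cos (of_real p * w) / (of_real p * (z - w))) has_field_derivative
       - sin (of_real p * of_real s) / (z - of_real s) + cos (of_real p * of_real s) / (of_real p * (z - of_real s)^2)) (at (of_real s))"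
      using z[of s] p
      apply (auto intro!: derivative_eq_intros)
      apply (simp add: divide_simps power2_eq_square)
      apply (simp add: algebra_simps)
      done
    then show ?thesis unfolding g_def
      by (rule has_vector_derivative_real_field)
  qed
  have "norm ((f y + g y) - (f x + g x)) \<le> P y - P x"
  proof (rule differentiable_bound_general[OF xy])
    show "continuous_on {x..y} (\<lambda>s. f s + g s)"
      by (intro continuous_on_add continuous_on_vector_derivative[OF df] continuous_on_vector_derivative[OF dg])
    show "continuous_on {x..y} P" unfolding P_def using p e by (intro continuous_intros) auto
    fix s assume s: "x < s" "s < y"
    then have "at s within {x..y} = at s" by (simp add: at_within_Icc_at)
    with s have "(f has_vector_derivative sin (of_real p * of_real s) / (z - of_real s)) (at s)"
      using df[of s] by simp
    from has_vector_derivative_add[OF this dg[of s UNIV]]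
    show "((\<lambda>s. f s + g s) has_vector_derivative cos (of_real p * of_real s) / (of_real p * (z - of_real s)^2)) (at s)"
      by simp
    have eq: "1 + ((s - Re z) / e)\<^sup>2 = (e\<^sup>2 + (s - Re z)\<^sup>2) / e\<^sup>2"
      using e by (simp add: power_divide add_divide_distrib)
    have "((\<lambda>s. arctan ((s - Re z) / e) / (p * e)) has_real_derivative
        (inverse (1 + ((s - Re z) / e)\<^sup>2) * (1 / e)) / (p * e)) (at s)"
      by (rule DERIV_cdivide, rule DERIV_chain2[OF DERIV_arctan]) (use e in \<open>auto intro!: derivative_eq_intros\<close>)
    also have "(inverse (1 + ((s - Re z) / e)\<^sup>2) * (1 / e)) / (p * e) = 1 / (p * (e\<^sup>2 + (s - Re z)\<^sup>2))"
      unfolding eq using e p by (simp add: power2_eq_square)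
    finally show "(P has_vector_derivative 1 / (p * (e\<^sup>2 + (s - Re z)\<^sup>2))) (at s)"
      unfolding has_real_derivative_iff_has_vector_derivative[symmetric] P_def .
    have "cmod (cos (of_real p * of_real s :: complex)) \<le> 1"
      by (metis abs_cos_le_one cos_of_real norm_of_real of_real_mult)
    moreover have "cmod (of_real p * (z - of_real s)\<^sup>2) \<ge> p * (e\<^sup>2 + (s - Re z)\<^sup>2)"
    proof -
      have "e\<^sup>2 \<le> (Im z)\<^sup>2" using e by (metis abs_le_square_iff abs_of_pos)
      then show ?thesis using p by (simp add: norm_mult norm_power cmod_power2 power2_commute)
    qed
    moreover have "p * (e\<^sup>2 + (s - Re z)\<^sup>2) > 0" using p e by (simp add: add_pos_nonneg)
    ultimately show "cmod (cos (of_real p * of_real s) / (of_real p * (z - of_real s)\<^sup>2)) \<le> 1 / (p * (e\<^sup>2 + (s - Re z)\<^sup>2))"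
      unfolding norm_divide by (intro frac_le) auto
  qed
  also have "\<dots> \<le> (pi/2) / (p * e) + (pi/2) / (p * e)"
    unfolding P_def diff_divide_distrib[symmetric] add_divide_distrib[symmetric]
    using p e arctan_bounded[of "(y - Re z)/e"] arctan_bounded[of "(x - Re z)/e"]
    by (intro divide_right_mono) auto
  finally have 1: "norm ((f y + g y) - (f x + g x)) \<le> pi / (p * e)"
    by (simp add: mult.commute)
  have 2: "norm (g s) \<le> 1 / (p * e)" for s
  proof -
    have "cmod (cos (of_real p * of_real s :: complex)) \<le> 1"
      by (metis abs_cos_le_one cos_of_real norm_of_real of_real_mult)
    moreover have "e \<le> cmod (z - of_real s)"
      using e abs_Im_le_cmod[of "z - of_real s"] by simp
    ultimately show ?thesis unfolding g_def norm_divide norm_mult using p e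
      by (intro frac_le mult_mono) auto
  qed
  have tri: "norm (A - B + C) \<le> norm A + norm B + norm C" for A B C :: complex
    using norm_triangle_ineq[of "A - B" C] norm_triangle_ineq4[of A B] by linarith
  have "f x = 0" by (simp add: f_def)
  then have "f y = ((f y + g y) - (f x + g x)) - g y + g x" by simp
  then have "norm (f y) \<le> norm ((f y + g y) - (f x + g x)) + norm (g y) + norm (g x)"
    using tri[of "(f y + g y) - (f x + g x)" "g y" "g x"] by simp
  also have "\<dots> \<le> pi / (p*e) + 1 / (p*e) + 1/ (p*e)"
    by (intro add_mono 1 2)
  also have "\<dots> = (2 + pi) / (p*e)" by (simp add: add_divide_distrib)
  finally have "norm (f y) \<le> (2 + pi) / (p*e)" .
  moreover have "contour_integral (linepath (of_real x) (of_real y)) (\<lambda>\<xi>. sin (of_real p * \<xi>) / (z - \<xi>)) = f y"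
    unfolding f_def using xy by (subst contour_integral_linepath_Reals_eq) auto
  ultimately show ?thesis by simp
qed

section \<open>Residues of the Sinc interpolation kernel\<close>

lemma residue_simple_quotient_deriv:
  assumes s: "open s" "c \<in> s" and F: "F holomorphic_on s" and g: "g holomorphic_on s"
    and zero: "\<And>w. w \<in> s \<Longrightarrow> g w = 0 \<longleftrightarrow> w = c"
    and g': "(g has_field_derivative g') (at c)" "g' \<noteq> 0"
  shows "residue (\<lambda>w. F w / g w) c = F c / g'"
proof (rule residue_simple'[OF s])
  show "(\<lambda>w. F w / g w) holomorphic_on s - {c}"
    by (intro holomorphic_on_divide holomorphic_on_subset[OF F] holomorphic_on_subset[OF g])
      (use zero in auto)
  have gc: "g c = 0" using zero s by blast
  have "((\<lambda>w. (g w - g c) / (w - c)) \<longlongrightarrow> g') (at c)"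
    using g' by (simp add: has_field_derivative_iff)
  then have 1: "((\<lambda>w. g w / (w - c)) \<longlongrightarrow> g') (at c)"
    using gc by simp
  have "continuous_on s F" using F by (rule holomorphic_on_imp_continuous_on)
  then have "isCont F c" using s by (simp add: continuous_on_eq_continuous_at)
  then have 2: "(F \<longlongrightarrow> F c) (at c)" by (simp add: isCont_def)
  from tendsto_divide[OF 2 1 g'(2)]
  show "((\<lambda>w. F w / g w * (w - c)) \<longlongrightarrow> F c / g') (at c)" by simp
qed

lemma sin_scaled_eq_0_iff:
  fixes h :: real and z :: complex
  assumes "h > 0"
  shows "sin (of_real (pi / h) * z) = 0 \<longleftrightarrow> (\<exists>j::int. z = of_real (of_int j * h))"
proof -
  have "of_real (pi / h) * z = of_real (of_int j * pi) \<longleftrightarrow> z = of_real (of_int j * h)" for j :: int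
    using assms by (auto simp: field_simps)
  then show ?thesis by (simp only: sin_eq_0)
qed

lemma cos_pi_int_squared: "cos (pi * of_int j) * cos (pi * of_int j) = (1::real)"
  using sin_cos_squared_add[of "pi * of_int j"] sin_zero_iff_int2[of "pi * of_int j"]
  by (simp add: power2_eq_square)

text \<open>After multiplication by sin (pi x / h) the residue at \<open>x\<close> becomes F(x) and
  the residues at the nodes become minus the terms of the Sinc interpolant with 2 M + 1 nodes. The
  contour integral is thus a closed form of the interpolation error.\<close>

lemma strip_sinc_residues:
  fixes F :: "complex \<Rightarrow> complex" and x h e d :: real and M :: nat
  assumes F: "F holomorphic_on strip d" and e: "0 < e" "e < d" and h: "h > 0"
    and x: "\<And>j::int. x \<noteq> of_int j * h" "\<bar>x\<bar> \<le> of_nat M * h"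
  defines "R \<equiv> (of_nat M + 1 / 2) * h"
  shows "contour_integral (rectpath (Complex (-R) (-e)) (Complex R e))
      (\<lambda>z. F z / ((z - of_real x) * sin (of_real (pi / h) * z))) =
     2 * pi * \<i> * (F (of_real x) / sin (of_real (pi / h) * of_real x) +
       (\<Sum>j = - int M..int M. F (of_real (of_int j * h)) /
          ((of_real (of_int j * h) - of_real x) * (of_real (pi / h) * cos (of_real (pi * of_int j))))))"
proof -
  \<comment> \<open>Slightly larger than the rectangle, yet its half-width (M + 1) h excludes the
    next nodes, so that \<open>pts\<close> contains all singularities of the integrand in
    \<open>S\<close>.\<close>
  define S where "S = box (Complex (- ((of_nat M + 1) * h)) (-d)) (Complex ((of_nat M + 1) * h) d)"
  define nd where "nd = (\<lambda>j::int. complex_of_real (of_int j * h))"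
  define pts where "pts = insert (complex_of_real x) (nd ` {- int M..int M})"
  define f where "f = (\<lambda>z. F z / ((z - of_real x) * sin (of_real (pi / h) * z)))"
  define gm where "gm = rectpath (Complex (-R) (-e)) (Complex R e)"
  have Rpos: "R > 0" using h by (simp add: R_def add_nonneg_pos)
  have RM: "of_nat M * h < R" "R < (of_nat M + 1) * h" using h by (auto simp: R_def)
  have S: "open S" "convex S" "S \<subseteq> strip d"
    by (auto simp: S_def strip_def in_box_complex_iff)
  have FS: "F holomorphic_on S" using F S(3) by (rule holomorphic_on_subset)
  have inj: "inj_on nd A" for A using h by (auto simp: nd_def inj_on_def)
  have ndS: "nd j \<in> S \<longleftrightarrow> j \<in> {- int M..int M}" for j
  proof -
    have "nd j \<in> S \<longleftrightarrow> \<bar>of_int j * h\<bar> < (of_nat M + 1) * h"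
      using e by (auto simp: S_def nd_def in_box_complex_iff)
    also have "\<dots> \<longleftrightarrow> \<bar>of_int j\<bar> < (of_nat M + 1 :: real)"
      using h by (simp add: abs_mult)
    also have "\<dots> \<longleftrightarrow> j \<in> {- int M..int M}" by auto
    finally show ?thesis .
  qed
  have xS: "of_real x \<in> S"
    using x(2) RM e by (auto simp: S_def in_box_complex_iff)
  have xnd: "of_real x \<noteq> nd j" for j
    using x(1) unfolding nd_def by (metis of_real_eq_iff)
  have sin0: "sin (of_real (pi / h) * z) = 0 \<longleftrightarrow> z \<in> range nd" for z
    unfolding sin_scaled_eq_0_iff[OF h] nd_def by blast
  have ptsS: "pts \<subseteq> S" unfolding pts_def using ndS xS by blast
  have zS: "(z - of_real x) * sin (of_real (pi / h) * z) = 0 \<longleftrightarrow> z \<in> pts" if "z \<in> S" for z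
    unfolding mult_eq_0_iff sin0 pts_def using that ndS by auto
  have fin: "finite pts" by (simp add: pts_def)
  have inbox: "z \<in> box (Complex (-R) (-e)) (Complex R e)" if z: "z \<in> pts" for z
  proof -
    have "\<bar>Re z\<bar> \<le> of_nat M * h \<and> Im z = 0"
    proof (cases "z = of_real x")
      case True then show ?thesis using x by auto
    next
      case False
      then obtain j where j: "z = nd j" "j \<in> {- int M..int M}" using z by (auto simp: pts_def)
      then have "\<bar>real_of_int j\<bar> \<le> of_nat M" by auto
      then have "\<bar>real_of_int j\<bar> * h \<le> of_nat M * h" using h by (intro mult_right_mono) auto
      then show ?thesis using j h by (auto simp: nd_def abs_mult)
    qed
    then show ?thesis using RM e by (auto simp: in_box_complex_iff)
  qed
  have sub: "cbox (Complex (-R) (-e)) (Complex R e) \<subseteq> S"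
    using RM e by (auto simp: S_def in_box_complex_iff in_cbox_complex_iff)
  have "contour_integral gm f = 2 * pi * \<i> * (\<Sum>q\<in>pts. winding_number gm q * residue f q)"
  proof (rule Residue_theorem[of S])
    show "connected S" using S by (simp add: convex_connected)
    show "f holomorphic_on S - pts" unfolding f_def
      by (intro holomorphic_intros holomorphic_on_subset[OF FS]) (use zS in auto)
    show "valid_path gm" "pathfinish gm = pathstart gm" by (auto simp: gm_def)
    have "path_image gm = cbox (Complex (-R) (-e)) (Complex R e) - box (Complex (-R) (-e)) (Complex R e)"
      unfolding gm_def using Rpos e by (intro path_image_rectpath_cbox_minus_box) auto
    then show "path_image gm \<subseteq> S - pts" using sub inbox by auto
    show "\<forall>z. z \<notin> S \<longrightarrow> winding_number gm z = 0"
      unfolding gm_def using sub Rpos e by (auto intro!: winding_number_rectpath_outside)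
  qed (use S fin in auto)
  also have "(\<Sum>q\<in>pts. winding_number gm q * residue f q) = (\<Sum>q\<in>pts. residue f q)"
    unfolding gm_def by (rule sum.cong) (auto simp: winding_number_rectpath inbox)
  also have "\<dots> = residue f (of_real x) + (\<Sum>j = - int M..int M. residue f (nd j))"
    unfolding pts_def using xnd by (subst sum.insert) (auto simp: sum.reindex[OF inj])
  also have "residue f (of_real x) = F (of_real x) / sin (of_real (pi / h) * of_real x)"
  proof -
    define s where "s = S - nd ` {- int M..int M}"
    have s: "open s" "of_real x \<in> s"
      unfolding s_def using S xS xnd by (auto intro!: open_Diff finite_imp_closed)
    have nz: "sin (of_real (pi / h) * z) \<noteq> 0" if "z \<in> s" for z
      using that sin0[of z] ndS by (auto simp: s_def)
    have "residue (\<lambda>z. (F z / sin (of_real (pi / h) * z)) / (z - of_real x)) (of_real x)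
        = F (of_real x) / sin (of_real (pi / h) * of_real x)"
      by (rule residue_simple[OF s], intro holomorphic_intros holomorphic_on_subset[OF FS])
        (use nz in \<open>auto simp: s_def\<close>)
    then show ?thesis by (simp add: f_def mult.commute)
  qed
  also have "(\<Sum>j = - int M..int M. residue f (nd j)) =
      (\<Sum>j = - int M..int M. F (nd j) / ((nd j - of_real x) * (of_real (pi / h) * cos (of_real (pi * of_int j)))))"
  proof (rule sum.cong)
    fix j assume j: "j \<in> {- int M..int M}"
    define s where "s = S - (pts - {nd j})"
    have s: "open s" "nd j \<in> s"
      unfolding s_def using S j ndS fin by (auto intro!: open_Diff finite_imp_closed)
    have arg: "of_real (pi / h) * nd j = of_real (pi * of_int j)"
      using h by (simp add: nd_def)
    have s0: "sin (of_real (pi / h) * nd j) = 0" using sin0 by blast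
    have c0: "cos (complex_of_real (pi * of_int j)) \<noteq> 0"
      using cos_pi_int_squared[of j] unfolding cos_of_real by auto
    show "residue f (nd j) = F (nd j) / ((nd j - of_real x) * (of_real (pi / h) * cos (of_real (pi * of_int j))))"
      unfolding f_def
    proof (rule residue_simple_quotient_deriv[OF s])
      show "F holomorphic_on s" using FS by (rule holomorphic_on_subset) (auto simp: s_def)
      show "(\<lambda>z. (z - of_real x) * sin (of_real (pi / h) * z)) holomorphic_on s"
        by (intro holomorphic_intros)
      show "(w - of_real x) * sin (of_real (pi / h) * w) = 0 \<longleftrightarrow> w = nd j" if "w \<in> s" for w
        using that zS[of w] j by (auto simp: s_def pts_def)
      show "((\<lambda>z. (z - of_real x) * sin (of_real (pi / h) * z)) has_field_derivative
          ((nd j - of_real x) * (of_real (pi / h) * cos (of_real (pi * of_int j))))) (at (nd j))"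
        apply (rule derivative_eq_intros refl)+
        using s0 arg by simp
      show "(nd j - of_real x) * (of_real (pi / h) * cos (of_real (pi * of_int j))) \<noteq> 0"
        using c0 xnd[of j] h by (metis divide_eq_0_iff eq_iff_diff_eq_0 less_irrefl mult_eq_0_iff of_real_eq_0_iff pi_neq_zero)
    qed
  qed simp
  finally show ?thesis unfolding f_def gm_def nd_def .
qed

section \<open>The error of Sinc indefinite integration as a contour integral\<close>

lemma continuous_on_contour_integral_linepath:
  fixes f :: "complex \<Rightarrow> complex \<Rightarrow> complex"
  assumes "continuous_on (S \<times> closed_segment c d) (\<lambda>(x, z). f x z)"
  shows "continuous_on S (\<lambda>x. contour_integral (linepath c d) (f x))"
proof -
  have "continuous_on (S \<times> cbox 0 1) (\<lambda>(x, t). f x (linepath c d t) * (d - c))"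
  proof -
    have "continuous_on (S \<times> {0..1}) ((\<lambda>(x, z). f x z) \<circ> (\<lambda>(x, t). (x, linepath c d t)))"
    proof (rule continuous_on_compose)
      show "continuous_on (S \<times> {0..1}) (\<lambda>(x, t). (x, linepath c d t))"
        unfolding split_def linepath_def by (intro continuous_intros)
      show "continuous_on ((\<lambda>(x, t). (x, linepath c d t)) ` (S \<times> {0..1})) (\<lambda>(x, z). f x z)"
        by (rule continuous_on_subset[OF assms]) (auto simp: linepath_in_path)
    qed
    then show ?thesis
      by (auto simp: split_def o_def intro!: continuous_intros)
  qed
  then have "continuous_on S (\<lambda>x. integral (cbox 0 1) (\<lambda>t. f x (linepath c d t) * (d - c)))"
    by (rule integral_continuous_on_param)
  moreover have "contour_integral (linepath c d) (f x) = integral (cbox 0 1) (\<lambda>t. f x (linepath c d t) * (d - c))" for x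
    by (simp add: contour_integral_integral)
  ultimately show ?thesis by simp
qed

context
  fixes u v c d :: complex and W S :: "complex \<Rightarrow> complex"
  assumes W: "continuous_on (closed_segment c d) W" and S: "continuous_on (closed_segment u v) S"
    and disj: "closed_segment c d \<inter> closed_segment u v = {}"
begin

lemma cauchy_kernel_continuous:
  "continuous_on (closed_segment u v) (\<lambda>\<xi>. S \<xi> * contour_integral (linepath c d) (\<lambda>z. W z / (z - \<xi>)))"
proof (rule continuous_on_mult[OF S continuous_on_contour_integral_linepath])
  show "continuous_on (closed_segment u v \<times> closed_segment c d) (\<lambda>(\<xi>, z). W z / (z - \<xi>))"
    unfolding split_def using disj
    by (intro continuous_intros continuous_on_compose2[OF W]) auto
qed

lemma cauchy_kernel_continuous':
  "continuous_on (closed_segment c d) (\<lambda>z. W z * contour_integral (linepath u v) (\<lambda>\<xi>. S \<xi> / (z - \<xi>)))"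
proof (rule continuous_on_mult[OF W continuous_on_contour_integral_linepath])
  show "continuous_on (closed_segment c d \<times> closed_segment u v) (\<lambda>(z, \<xi>). S \<xi> / (z - \<xi>))"
    unfolding split_def using disj
    by (intro continuous_intros continuous_on_compose2[OF S]) auto
qed

text \<open>The error formula has the Cauchy integral inside. The estimate needs the other order,
  because the oscillation of \<open>S\<close> helps only if the inner integral is the one along the
  real segment. Disjointness of the segments makes the kernel jointly continuous, which justifies
  the exchange.\<close>

lemma cauchy_kernel_swap:
  "contour_integral (linepath u v) (\<lambda>\<xi>. S \<xi> * contour_integral (linepath c d) (\<lambda>z. W z / (z - \<xi>))) =
   contour_integral (linepath c d) (\<lambda>z. W z * contour_integral (linepath u v) (\<lambda>\<xi>. S \<xi> / (z - \<xi>)))"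
proof -
  have "contour_integral (linepath u v) (\<lambda>\<xi>. S \<xi> * contour_integral (linepath c d) (\<lambda>z. W z / (z - \<xi>)))
      = contour_integral (linepath u v) (\<lambda>\<xi>. contour_integral (linepath c d) (\<lambda>z. S \<xi> * (W z / (z - \<xi>))))"
  proof (rule contour_integral_eq)
    fix \<xi> assume "\<xi> \<in> path_image (linepath u v)"
    then have "continuous_on (closed_segment c d) (\<lambda>z. W z / (z - \<xi>))"
      using disj by (intro continuous_intros W) auto
    then show "S \<xi> * contour_integral (linepath c d) (\<lambda>z. W z / (z - \<xi>))
        = contour_integral (linepath c d) (\<lambda>z. S \<xi> * (W z / (z - \<xi>)))"
      by (intro contour_integral_lmul[symmetric] contour_integrable_continuous_linepath)
  qed
  also have "\<dots> = contour_integral (linepath c d) (\<lambda>z. contour_integral (linepath u v) (\<lambda>\<xi>. S \<xi> * (W z / (z - \<xi>))))"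
  proof (rule contour_integral_swap)
    show "continuous_on (path_image (linepath u v) \<times> path_image (linepath c d)) (\<lambda>(\<xi>, z). S \<xi> * (W z / (z - \<xi>)))"
      unfolding split_def using disj
      by (intro continuous_intros continuous_on_compose2[OF W] continuous_on_compose2[OF S]) auto
  qed auto
  also have "\<dots> = contour_integral (linepath c d) (\<lambda>z. W z * contour_integral (linepath u v) (\<lambda>\<xi>. S \<xi> / (z - \<xi>)))"
  proof (rule contour_integral_eq)
    fix z assume "z \<in> path_image (linepath c d)"
    then have "continuous_on (closed_segment u v) (\<lambda>\<xi>. S \<xi> / (z - \<xi>))"
      using disj by (intro continuous_intros S) auto
    then have "contour_integral (linepath u v) (\<lambda>\<xi>. W z * (S \<xi> / (z - \<xi>))) =
        W z * contour_integral (linepath u v) (\<lambda>\<xi>. S \<xi> / (z - \<xi>))"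
      by (intro contour_integral_lmul contour_integrable_continuous_linepath)
    then show "contour_integral (linepath u v) (\<lambda>\<xi>. S \<xi> * (W z / (z - \<xi>))) =
        W z * contour_integral (linepath u v) (\<lambda>\<xi>. S \<xi> / (z - \<xi>))"
      by (simp add: mult.commute)
  qed
  finally show ?thesis .
qed

end

lemma contour_integral_rectpath:
  assumes "continuous_on (path_image (rectpath a1 a3)) f" "Re a1 \<le> Re a3" "Im a1 \<le> Im a3"
  defines "a2 \<equiv> Complex (Re a3) (Im a1)" and "a4 \<equiv> Complex (Re a1) (Im a3)"
  shows "contour_integral (rectpath a1 a3) f =
    contour_integral (linepath a1 a2) f + contour_integral (linepath a2 a3) f +
    contour_integral (linepath a3 a4) f + contour_integral (linepath a4 a1) f"
proof -
  have eq: "rectpath a1 a3 = linepath a1 a2 +++ linepath a2 a3 +++ linepath a3 a4 +++ linepath a4 a1"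
    by (simp add: rectpath_def a2_def a4_def Let_def)
  have "path_image (rectpath a1 a3) = closed_segment a1 a2 \<union> closed_segment a2 a3 \<union>
      closed_segment a3 a4 \<union> closed_segment a4 a1"
    unfolding eq by (auto simp: path_image_join)
  then have "f contour_integrable_on linepath a1 a2" "f contour_integrable_on linepath a2 a3"
    "f contour_integrable_on linepath a3 a4" "f contour_integrable_on linepath a4 a1"
    using assms(1) by (auto intro!: contour_integrable_continuous_linepath elim: continuous_on_subset)
  then show ?thesis unfolding eq
    by (simp add: contour_integral_join valid_path_join contour_integrable_joinI)
qed

lemma J_SE_ereal: "J_SE j h (ereal u) = h * (1 / 2 + 1 / pi * Si (pi * (u / h - of_int j)))"
  by (simp add: J_SE_def)

text \<open>The derivative of \<open>J_SE j h\<close> is the sinc function centred at the node j h,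
  so \<open>U\<close> minus the sum of the \<open>J_SE\<close> terms is a primitive of the
  interpolation error, which \<open>strip_sinc_residues\<close> expresses as a contour
  integral.\<close>

lemma sinc_error_contour_integral:
  fixes F U :: "complex \<Rightarrow> complex" and x h e d :: real and M :: nat
  assumes F: "F holomorphic_on strip d" and e: "0 < e" "e < d" and h: "h > 0"
    and U: "\<And>s::real. (U has_field_derivative F (of_real s)) (at (of_real s))"
    and x: "- (of_nat M * h) < x" "x \<le> of_nat M * h"
  defines "R \<equiv> (of_nat M + 1 / 2) * h" and "X \<equiv> of_nat M * h"
  shows "((\<lambda>\<xi>. sin (of_real (pi / h) * \<xi>) * contour_integral (rectpath (Complex (-R) (-e)) (Complex R e))
            (\<lambda>z. F z / sin (of_real (pi / h) * z) / (z - \<xi>))) has_contour_integral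
      2 * pi * \<i> * (U (of_real x) - U (of_real (- X)) - (\<Sum>j = - int M..int M. F (of_real (of_int j * h)) *
          of_real (J_SE j h (ereal x) - J_SE j h (ereal (- X))))))
    (linepath (of_real (- X)) (of_real x))"
proof -
  define E where "E = (\<lambda>s::real. U (of_real s) - (\<Sum>j = - int M..int M. F (of_real (of_int j * h)) *
      of_real (J_SE j h (ereal s))))"
  define E' where "E' = (\<lambda>s::real. F (of_real s) - (\<Sum>j = - int M..int M. F (of_real (of_int j * h)) *
      of_real (sinc (pi * (s / h - of_int j)))))"
  define G where "G = (\<lambda>\<xi>. sin (of_real (pi / h) * \<xi>) * contour_integral (rectpath (Complex (-R) (-e)) (Complex R e))
            (\<lambda>z. F z / sin (of_real (pi / h) * z) / (z - \<xi>)))"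
  have dJ: "((\<lambda>s. J_SE j h (ereal s)) has_real_derivative sinc (pi * (s / h - of_int j))) (at s)" for j s
  proof -
    have "((\<lambda>s. Si (pi * (s / h - of_int j))) has_real_derivative sinc (pi * (s / h - of_int j)) * (pi / h)) (at s)"
      by (rule DERIV_chain2[OF DERIV_Si]) (use h in \<open>auto intro!: derivative_eq_intros\<close>)
    from DERIV_cmult[OF DERIV_add[OF DERIV_const[of "1/2"] DERIV_cmult[OF this, of "1/pi"]], of h]
    show ?thesis unfolding J_SE_ereal using h by simp
  qed
  have dE: "(E has_vector_derivative E' s) (at s)" for s
    unfolding E_def E'_def
    by (intro has_vector_derivative_diff has_vector_derivative_sum has_vector_derivative_mult_right
        has_vector_derivative_real_field[OF U] has_vector_derivative_of_real dJ)
  have EG: "2 * pi * \<i> * E' s = G (of_real s)" if s: "s \<in> {- X<..<x}" "s \<notin> (\<lambda>j. of_int j * h) ` {- int M..int M}" for s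
  proof -
    have s': "s \<noteq> of_int j * h" for j
    proof
      assume eq: "s = of_int j * h"
      have "(- real M) * h < of_int j * h" "of_int j * h < real M * h"
        using s(1) x eq by (auto simp: X_def)
      then have "- real M < of_int j" "of_int j < real M"
        using h by (auto simp only: mult_less_cancel_right_pos)
      then have "j \<in> {- int M..int M}" by auto
      then show False using s eq by auto
    qed
    have "\<bar>s\<bar> \<le> real M * h" using s(1) x by (auto simp: X_def)
    note res = strip_sinc_residues[OF F e h s' this, folded R_def]
    define a where "a = sin (of_real (pi / h) * complex_of_real s)"
    have a: "a \<noteq> 0"
      unfolding a_def using sin_scaled_eq_0_iff[OF h, of "of_real s"] s' by (metis of_real_eq_iff)
    have "G (of_real s) = a * (2 * pi * \<i> * (F (of_real s) / a +
       (\<Sum>j = - int M..int M. F (of_real (of_int j * h)) /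
          ((of_real (of_int j * h) - of_real s) * (of_real (pi / h) * cos (of_real (pi * of_int j)))))))"
      unfolding G_def a_def res[symmetric] by (simp add: mult.commute)
    also have "\<dots> = 2 * pi * \<i> * (F (of_real s) + (\<Sum>j = - int M..int M. F (of_real (of_int j * h)) *
       (a / ((of_real (of_int j * h) - of_real s) * (of_real (pi / h) * cos (of_real (pi * of_int j)))))))"
      using a by (simp add: algebra_simps sum_distrib_left)
    also have "(\<lambda>j. a / ((of_real (of_int j * h) - of_real s) * (of_real (pi / h) * cos (of_real (pi * of_int j))))) =
       (\<lambda>j. - of_real (sinc (pi * (s / h - of_int j))))"
    proof
      fix j :: int
      \<comment> \<open>\<open>c\<close> is the sign (-1)^j. Since c * c = 1 it can be moved from
        the denominator to the numerator without a distinction by parity.\<close>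
      define c where "c = cos (pi * of_int j)"
      have c: "c * c = 1" using cos_pi_int_squared[of j] by (simp add: c_def)
      then have c0: "c \<noteq> 0" by auto
      have w: "pi * (s / h - of_int j) \<noteq> 0" using s'[of j] h by (auto simp: field_simps)
      have sj: "of_int j * h - s \<noteq> 0" using s'[of j] by simp
      have "sin (pi * (s / h - of_int j)) = sin (pi / h * s - pi * of_int j)"
        by (simp add: algebra_simps)
      also have "\<dots> = sin (pi / h * s) * c"
        unfolding sin_diff c_def using sin_zero_iff_int2[of "pi * of_int j"] by (simp add: mult.commute)
      finally have 1: "sin (pi * (s / h - of_int j)) = sin (pi / h * s) * c" .
      have "sin (pi / h * s) / ((of_int j * h - s) * (pi / h * c)) = - (sin (pi / h * s) * c / (pi * (s / h - of_int j)))"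
      proof -
        have "sin (pi / h * s) / ((of_int j * h - s) * (pi / h * c)) = sin (pi / h * s) * (c * c) / ((of_int j * h - s) * (pi / h * c))"
          by (simp add: c)
        also have "\<dots> = sin (pi / h * s) * c / ((of_int j * h - s) * (pi / h))"
          using c0 by simp
        also have "(of_int j * h - s) * (pi / h) = - (pi * (s / h - of_int j))"
          using h by (simp add: field_simps)
        finally show ?thesis by simp
      qed
      then have "sin (pi / h * s) / ((of_int j * h - s) * (pi / h * c)) = - sinc (pi * (s / h - of_int j))"
        using w 1 by simp
      from arg_cong[OF this, of complex_of_real]
      have 2: "of_real (sin (pi / h * s)) / ((of_real (of_int j * h) - of_real s) * (of_real (pi / h) * of_real c)) =
          - complex_of_real (sinc (pi * (s / h - of_int j)))"
        by (simp only: of_real_divide of_real_mult of_real_diff of_real_minus)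
      have "a = of_real (sin (pi / h * s))"
        unfolding a_def by (simp only: of_real_mult[symmetric] sin_of_real)
      moreover have "cos (complex_of_real (pi * of_int j)) = of_real c"
        by (simp only: cos_of_real c_def)
      ultimately show "a / ((of_real (of_int j * h) - of_real s) * (of_real (pi / h) * cos (of_real (pi * of_int j)))) =
        - of_real (sinc (pi * (s / h - of_int j)))"
        using 2 by (simp only:)
    qed
    finally show ?thesis by (simp add: E'_def sum_negf)
  qed
  have "((\<lambda>s. G (of_real s)) has_integral (2 * pi * \<i> * E x - 2 * pi * \<i> * E (- X))) {- X..x}"
  proof (rule fundamental_theorem_of_calculus_interior_strong[where S = "(\<lambda>j. of_int j * h) ` {- int M..int M}"])
    have "continuous_on {- X..x} E"
      by (rule continuous_on_vector_derivative[OF has_vector_derivative_at_within[OF dE]])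
    then show "continuous_on {- X..x} (\<lambda>s. 2 * pi * \<i> * E s)" by (intro continuous_intros)
    fix s assume s: "s \<in> {- X<..<x} - (\<lambda>j. of_int j * h) ` {- int M..int M}"
    have "((\<lambda>s. 2 * pi * \<i> * E s) has_vector_derivative 2 * pi * \<i> * E' s) (at s)"
      by (intro has_vector_derivative_mult_right dE)
    then show "((\<lambda>s. 2 * pi * \<i> * E s) has_vector_derivative G (of_real s)) (at s)"
      using EG s by auto
  qed (use x in \<open>auto simp: X_def\<close>)
  then have "(G has_contour_integral (2 * pi * \<i> * E x - 2 * pi * \<i> * E (- X))) (linepath (of_real (- X)) (of_real x))"
    by (subst has_contour_integral_linepath_Reals_iff) (use x in \<open>auto simp: X_def\<close>)
  also have "2 * pi * \<i> * E x - 2 * pi * \<i> * E (- X) = 2 * pi * \<i> * (U (of_real x) - U (of_real (- X)) - (\<Sum>j = - int M..int M. F (of_real (of_int j * h)) *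
          of_real (J_SE j h (ereal x) - J_SE j h (ereal (- X)))))"
    by (simp add: E_def algebra_simps sum_subtractf)
  finally show ?thesis unfolding G_def .
qed

text \<open>The first term comes from the horizontal sides, where the sine in the denominator is at
  least \<open>sinh (pi / h * e)\<close> and the inner integral is controlled by oscillation. The
  second comes from the vertical sides, estimated crudely: the factor \<open>M\<close> is harmless,
  since exp (- \<alpha> M h) beats it as M tends to infinity.\<close>

lemma sinc_error_rectangle_bound:
  fixes F U :: "complex \<Rightarrow> complex" and x h e d C \<alpha> :: real and M :: nat
  assumes F: "F holomorphic_on strip d" and e: "0 < e" "e < d" and h: "h > 0"
    and Fb: "\<And>z. z \<in> strip d \<Longrightarrow> cmod (F z) \<le> C * exp (- \<alpha> * \<bar>Re z\<bar>)" and C: "C \<ge> 0" and \<alpha>: "\<alpha> > 0"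
    and U: "\<And>s::real. (U has_field_derivative F (of_real s)) (at (of_real s))"
    and x: "- (of_nat M * h) < x" "x \<le> of_nat M * h"
  shows "cmod (U (of_real x) - U (of_real (- (of_nat M * h))) - (\<Sum>j = - int M..int M. F (of_real (of_int j * h)) *
          of_real (J_SE j h (ereal x) - J_SE j h (ereal (- (of_nat M * h))))))
      \<le> 2 * C * ((2 + pi) / (pi / h * e)) / (\<alpha> * sinh (pi / h * e)) + 8 * of_nat M * C * e * exp (- \<alpha> * (of_nat M * h))"
    (is "cmod ?Err \<le> _")
proof -
  define R where "R = (of_nat M + 1 / 2) * h"
  define X where "X = of_nat M * h"
  define p where "p = pi / h"
  define a1 a2 a3 a4 where "a1 = Complex (-R) (-e)" and "a2 = Complex R (-e)"
    and "a3 = Complex R e" and "a4 = Complex (-R) e"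
  define S where "S = (\<lambda>\<xi>::complex. sin (of_real p * \<xi>))"
  define W where "W = (\<lambda>z. F z / sin (of_real p * z))"
  define u v where "u = complex_of_real (- X)" and "v = complex_of_real x"
  define \<Theta> where "\<Theta> = (\<lambda>z. contour_integral (linepath u v) (\<lambda>\<xi>. S \<xi> / (z - \<xi>)))"
  define B where "B = (2 + pi) / (p * e)"
  have p: "p > 0" using h by (simp add: p_def)
  have Xx: "- X < x" "x \<le> X" using x by (auto simp: X_def)
  have XR: "R = X + h / 2" by (simp add: R_def X_def algebra_simps)
  have X0: "X > 0" using Xx by simp
  have R0: "R > 0" using XR X0 h by simp
  have B0: "B > 0" using p e by (simp add: B_def add_pos_pos)
  have sh: "sinh (p * e) > 0" using p e by simp
  have uv: "z \<in> closed_segment u v \<Longrightarrow> Im z = 0 \<and> - X \<le> Re z \<and> Re z \<le> X" for z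
    using closed_segment_horizontal[of z u v] Xx by (auto simp: u_def v_def)
  have s12: "Im z = - e \<and> \<bar>Re z\<bar> \<le> R" if "z \<in> closed_segment a1 a2" for z
    using closed_segment_horizontal[of z a1 a2] that R0 by (auto simp: a1_def a2_def)
  have s34: "Im z = e \<and> \<bar>Re z\<bar> \<le> R" if "z \<in> closed_segment a4 a3" for z
    using closed_segment_horizontal[of z a4 a3] that R0 by (auto simp: a3_def a4_def)
  have s23: "Re z = R \<and> \<bar>Im z\<bar> \<le> e" if "z \<in> closed_segment a2 a3" for z
    using that e by (auto simp: a2_def a3_def closed_segment_same_Re closed_segment_eq_real_ivl)
  have s41: "Re z = - R \<and> \<bar>Im z\<bar> \<le> e" if "z \<in> closed_segment a4 a1" for z
    using that e by (auto simp: a1_def a4_def closed_segment_same_Re closed_segment_eq_real_ivl)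
  have sinH: "sinh (p * e) \<le> cmod (sin (of_real p * z))" if "\<bar>Im z\<bar> = e" for z
  proof -
    have "\<bar>sinh (Im (of_real p * z))\<bar> = sinh (p * e)"
    proof -
      have "Im z = e \<or> Im z = - e" using that by linarith
      then show ?thesis using sh by auto
    qed
    then show ?thesis using abs_sinh_le_cmod_sin[of "of_real p * z"] by simp
  qed
  \<comment> \<open>The half step in \<open>R\<close> puts the vertical sides midway between zeros
    of the sine: \<open>p * R\<close> is an odd multiple of pi / 2.\<close>
  have sinV: "1 \<le> cmod (sin (of_real p * z))" if "\<bar>Re z\<bar> = R" for z
  proof (rule cmod_sin_ge_1)
    have "cos (p * R) = 0"
    proof -
      have "p * R = of_nat M * pi + pi / 2" using h by (simp add: p_def R_def field_simps)
      then show ?thesis by (simp add: cos_add)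
    qed
    moreover have "Re z = R \<or> Re z = - R" using that by auto
    ultimately show "cos (Re (of_real p * z)) = 0" by auto
  qed
  have on_strip: "z \<in> strip d" if "\<bar>Im z\<bar> \<le> e" for z using that e by (simp add: strip_def)
  have contF: "continuous_on (strip d) F" using F by (rule holomorphic_on_imp_continuous_on)
  have contS: "continuous_on A S" for A unfolding S_def by (intro continuous_intros)
  have contW: "continuous_on A W" if "\<And>z. z \<in> A \<Longrightarrow> (\<bar>Im z\<bar> = e \<or> \<bar>Re z\<bar> = R) \<and> \<bar>Im z\<bar> \<le> e" for A
  proof -
    have "sin (of_real p * z) \<noteq> 0" if "z \<in> A" for z
      using \<open>\<And>z. z \<in> A \<Longrightarrow> _\<close>[OF that] sinH[of z] sinV[of z] sh by fastforce
    moreover have "A \<subseteq> strip d" using that on_strip by blast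
    ultimately show ?thesis unfolding W_def
      by (intro continuous_intros continuous_on_subset[OF contF]) auto
  qed
  have cW12: "continuous_on (closed_segment a1 a2) W" by (rule contW) (use s12 e in auto)
  have cW34: "continuous_on (closed_segment a3 a4) W"
    by (rule contW) (use s34 e in \<open>auto simp: closed_segment_commute\<close>)
  have cW23: "continuous_on (closed_segment a2 a3) W" by (rule contW) (use s23 e R0 in auto)
  have cW41: "continuous_on (closed_segment a4 a1) W" by (rule contW) (use s41 e R0 in auto)
  have d12: "closed_segment a1 a2 \<inter> closed_segment u v = {}" using s12 uv e by fastforce
  have d34: "closed_segment a3 a4 \<inter> closed_segment u v = {}"
    using s34 uv e by (subst closed_segment_commute) fastforce
  have d23: "closed_segment a2 a3 \<inter> closed_segment u v = {}" using s23 uv XR h by fastforce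
  have d41: "closed_segment a4 a1 \<inter> closed_segment u v = {}" using s41 uv XR h by fastforce
  define I where "I = (\<lambda>c d \<xi>. contour_integral (linepath c d) (\<lambda>z. W z / (z - \<xi>)))"
  have split: "contour_integral (rectpath a1 a3) (\<lambda>z. W z / (z - \<xi>)) = I a1 a2 \<xi> + I a2 a3 \<xi> + I a3 a4 \<xi> + I a4 a1 \<xi>"
    if \<xi>: "\<xi> \<in> closed_segment u v" for \<xi>
  proof -
    have pth: "path_image (rectpath a1 a3) = closed_segment a1 a2 \<union> closed_segment a2 a3 \<union>
        closed_segment a3 a4 \<union> closed_segment a4 a1"
      by (auto simp: rectpath_def Let_def a1_def a2_def a3_def a4_def path_image_join)
    have "continuous_on (path_image (rectpath a1 a3)) W"
      unfolding pth by (intro continuous_on_closed_Un cW12 cW23 cW34 cW41 closed_Un) auto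
    moreover have "\<xi> \<notin> path_image (rectpath a1 a3)" unfolding pth using \<xi> d12 d23 d34 d41 by blast
    ultimately have "continuous_on (path_image (rectpath a1 a3)) (\<lambda>z. W z / (z - \<xi>))"
      by (intro continuous_intros) auto
    from contour_integral_rectpath[OF this] R0 e show ?thesis
      by (simp add: I_def a1_def a2_def a3_def a4_def)
  qed
  have swap: "contour_integral (linepath u v) (\<lambda>\<xi>. S \<xi> * I c d \<xi>) = contour_integral (linepath c d) (\<lambda>z. W z * \<Theta> z)"
    "(\<lambda>\<xi>. S \<xi> * I c d \<xi>) contour_integrable_on linepath u v"
    "continuous_on (closed_segment c d) (\<lambda>z. W z * \<Theta> z)"
    if "continuous_on (closed_segment c d) W" "closed_segment c d \<inter> closed_segment u v = {}" for c d
    using cauchy_kernel_swap[OF that(1) contS that(2)] cauchy_kernel_continuous[OF that(1) contS that(2)]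
      cauchy_kernel_continuous'[OF that(1) contS that(2)]
    by (auto simp: I_def \<Theta>_def intro: contour_integrable_continuous_linepath)
  have "2 * pi * \<i> * ?Err = contour_integral (linepath u v) (\<lambda>\<xi>. S \<xi> * contour_integral (rectpath a1 a3) (\<lambda>z. W z / (z - \<xi>)))"
    using contour_integral_unique[OF sinc_error_contour_integral[OF F e h U x]]
    by (simp add: S_def W_def u_def v_def a1_def a3_def R_def X_def p_def)
  also have "\<dots> = contour_integral (linepath u v) (\<lambda>\<xi>. S \<xi> * I a1 a2 \<xi> + S \<xi> * I a2 a3 \<xi> + S \<xi> * I a3 a4 \<xi> + S \<xi> * I a4 a1 \<xi>)"
    by (rule contour_integral_eq) (simp add: split algebra_simps)
  also have "\<dots> = contour_integral (linepath a1 a2) (\<lambda>z. W z * \<Theta> z) + contour_integral (linepath a2 a3) (\<lambda>z. W z * \<Theta> z)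
     + contour_integral (linepath a3 a4) (\<lambda>z. W z * \<Theta> z) + contour_integral (linepath a4 a1) (\<lambda>z. W z * \<Theta> z)"
    using swap[OF cW12 d12] swap[OF cW23 d23] swap[OF cW34 d34] swap[OF cW41 d41]
    by (simp add: contour_integral_add contour_integrable_add)
  finally have eq: "2 * pi * \<i> * ?Err = \<dots>" .
  define H where "H = 2 * C * B / (\<alpha> * sinh (p * e))"
  have H: "cmod (contour_integral (linepath a b) (\<lambda>z. W z * \<Theta> z)) \<le> H * pi"
    if ab: "Im a = Im b" "Re a \<le> Re b" "\<bar>Im a\<bar> = e" and cont: "continuous_on (closed_segment a b) (\<lambda>z. W z * \<Theta> z)" for a b
  proof -
    have "cmod (contour_integral (linepath a b) (\<lambda>z. W z * \<Theta> z)) \<le> H * arctan (\<alpha> * Re b) - H * arctan (\<alpha> * Re a)"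
    \<comment> \<open>The majorant of the integrand is a multiple of 1 / (1 + (\<alpha> Re z)^2).
      Its primitive is an \<open>arctan\<close>, so a side contributes at most H * pi for every
      \<open>R\<close>.\<close>
    proof (rule contour_integral_horizontal_bound[OF cont ab(1,2)])
      show "((\<lambda>s. H * arctan (\<alpha> * s)) has_real_derivative H * (inverse (1 + (\<alpha> * s)\<^sup>2) * \<alpha>)) (at s)" for s
        by (rule DERIV_cmult, rule DERIV_chain2[OF DERIV_arctan]) (auto intro!: derivative_eq_intros)
      fix z assume z: "z \<in> closed_segment a b"
      have Imz: "\<bar>Im z\<bar> = e" using closed_segment_horizontal[OF z ab(1,2)] ab(3) by simp
      have "cmod (F z) \<le> C * exp (- \<bar>\<alpha> * Re z\<bar>)"
        using Fb[OF on_strip[of z]] Imz \<alpha> by (simp add: abs_mult)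
      also have "\<dots> \<le> C * (2 / (1 + (\<alpha> * Re z)\<^sup>2))"
        by (intro mult_left_mono exp_minus_abs_le C)
      finally have F1: "cmod (F z) \<le> C * (2 / (1 + (\<alpha> * Re z)\<^sup>2))" .
      have "cmod (W z) \<le> C * (2 / (1 + (\<alpha> * Re z)\<^sup>2)) / sinh (p * e)"
        unfolding W_def norm_divide using sinH[OF Imz] sh F1 order_trans[OF norm_ge_zero F1] by (intro frac_le) auto
      moreover have "cmod (\<Theta> z) \<le> B"
        unfolding \<Theta>_def S_def u_def v_def B_def
        by (rule sin_cauchy_kernel_bound) (use p e Imz Xx in auto)
      ultimately have "cmod (W z * \<Theta> z) \<le> C * (2 / (1 + (\<alpha> * Re z)\<^sup>2)) / sinh (p * e) * B"
        unfolding norm_mult by (intro mult_mono) (use C sh in auto)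
      also have "\<dots> = H * (inverse (1 + (\<alpha> * Re z)\<^sup>2) * \<alpha>)"
        using \<alpha> by (simp add: H_def divide_inverse)
      finally show "cmod (W z * \<Theta> z) \<le> H * (inverse (1 + (\<alpha> * Re z)\<^sup>2) * \<alpha>)" .
    qed
    also have "\<dots> = H * (arctan (\<alpha> * Re b) - arctan (\<alpha> * Re a))" by (simp add: right_diff_distrib)
    also have "\<dots> \<le> H * pi"
    proof (rule mult_left_mono)
      show "arctan (\<alpha> * Re b) - arctan (\<alpha> * Re a) \<le> pi"
        using arctan_bounded[of "\<alpha> * Re b"] arctan_bounded[of "\<alpha> * Re a"] by linarith
      show "0 \<le> H" using C B0 \<alpha> sh by (simp add: H_def)
    qed
    finally show ?thesis .
  qed
  define V where "V = C * exp (- \<alpha> * X) * (4 * of_nat M)"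
  have V0: "V \<ge> 0" using C by (simp add: V_def)
  have V: "cmod (contour_integral (linepath a b) (\<lambda>z. W z * \<Theta> z)) \<le> V * (2 * e)"
    if ab: "\<And>z. z \<in> closed_segment a b \<Longrightarrow> \<bar>Re z\<bar> = R \<and> \<bar>Im z\<bar> \<le> e" "cmod (b - a) = 2 * e"
      and cont: "continuous_on (closed_segment a b) (\<lambda>z. W z * \<Theta> z)" for a b
  proof -
    have "cmod (contour_integral (linepath a b) (\<lambda>z. W z * \<Theta> z)) \<le> V * cmod (b - a)"
    proof (rule contour_integral_bound_linepath[OF contour_integrable_continuous_linepath[OF cont] V0])
      fix z assume "z \<in> closed_segment a b"
      note z = ab(1)[OF this]
      have "cmod (F z) \<le> C * exp (- \<alpha> * R)" using Fb[OF on_strip[of z]] z by simp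
      also have "\<dots> \<le> C * exp (- \<alpha> * X)" using C \<alpha> XR h by (intro mult_left_mono) auto
      finally have "cmod (F z) / cmod (sin (of_real p * z)) \<le> C * exp (- \<alpha> * X) / 1"
        using sinV[of z] z C by (intro frac_le) auto
      then have 1: "cmod (W z) \<le> C * exp (- \<alpha> * X)" by (simp add: W_def norm_divide)
      have gap: "h / 2 \<le> cmod (z - \<xi>)" if "\<xi> \<in> closed_segment u v" for \<xi>
        using uv[OF that] z XR abs_Re_le_cmod[of "z - \<xi>"] by auto
      \<comment> \<open>Length times maximum: the side is at distance at least h / 2 from the real
        segment, and that segment has length at most 2 X = 2 M h.\<close>
      have "cmod (\<Theta> z) \<le> (2 / h) * cmod (v - u)"
        unfolding \<Theta>_def
      proof (rule contour_integral_bound_linepath[OF contour_integrable_continuous_linepath])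
        show "continuous_on (closed_segment u v) (\<lambda>\<xi>. S \<xi> / (z - \<xi>))"
          using gap h by (intro continuous_intros contS) force
        show "0 \<le> 2 / h" using h by simp
        fix \<xi> assume \<xi>: "\<xi> \<in> closed_segment u v"
        then have "\<xi> = of_real (Re \<xi>)" using uv by (simp add: complex_eq_iff)
        then have "S \<xi> = of_real (sin (p * Re \<xi>))"
          unfolding S_def by (metis of_real_mult sin_of_real)
        then have "cmod (S \<xi>) \<le> 1" by simp
        then have "cmod (S \<xi>) / cmod (z - \<xi>) \<le> 1 / (h / 2)"
          using gap[OF \<xi>] h by (intro frac_le) auto
        then show "cmod (S \<xi> / (z - \<xi>)) \<le> 2 / h" by (simp add: norm_divide)
      qed
      also have "\<dots> \<le> 2 / h * (2 * X)"
      proof (rule mult_left_mono)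
        have "v - u = of_real (x + X)" by (simp add: u_def v_def)
        then show "cmod (v - u) \<le> 2 * X" using Xx X0 by (simp only: norm_of_real)
      qed (use h in auto)
      also have "2 / h * (2 * X) = 4 * of_nat M" using h by (simp add: X_def)
      finally have "cmod (\<Theta> z) \<le> 4 * of_nat M" .
      then show "cmod (W z * \<Theta> z) \<le> V" unfolding norm_mult V_def
        using 1 C by (intro mult_mono) auto
    qed
    then show ?thesis using ab(2) by simp
  qed
  have "a3 - a2 = \<i> * of_real (2 * e)" "a1 - a4 = - (\<i> * of_real (2 * e))"
    by (auto simp: complex_eq_iff a1_def a2_def a3_def a4_def)
  then have n23: "cmod (a3 - a2) = 2 * e" and n41: "cmod (a1 - a4) = 2 * e"
    using e by (simp_all only: norm_minus_cancel norm_mult norm_ii norm_of_real)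
  have "cmod (contour_integral (linepath a1 a2) (\<lambda>z. W z * \<Theta> z)) \<le> H * pi"
    by (rule H[OF _ _ _ swap(3)[OF cW12 d12]]) (use R0 e in \<open>auto simp: a1_def a2_def\<close>)
  moreover have "cmod (contour_integral (linepath a3 a4) (\<lambda>z. W z * \<Theta> z)) \<le> H * pi"
  proof -
    have c: "continuous_on (closed_segment a4 a3) (\<lambda>z. W z * \<Theta> z)"
      using swap(3)[OF cW34 d34] by (simp add: closed_segment_commute)
    have "cmod (contour_integral (linepath a4 a3) (\<lambda>z. W z * \<Theta> z)) \<le> H * pi"
      by (rule H[OF _ _ _ c]) (use R0 e in \<open>auto simp: a3_def a4_def\<close>)
    then show ?thesis
      using contour_integral_reverse_linepath[OF c] by simp
  qed
  moreover have "cmod (contour_integral (linepath a2 a3) (\<lambda>z. W z * \<Theta> z)) \<le> V * (2 * e)"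
    by (rule V[OF _ _ swap(3)[OF cW23 d23]]) (use s23 n23 R0 in auto)
  moreover have "cmod (contour_integral (linepath a4 a1) (\<lambda>z. W z * \<Theta> z)) \<le> V * (2 * e)"
    by (rule V[OF _ _ swap(3)[OF cW41 d41]]) (use s41 n41 R0 in auto)
  moreover have norm4: "cmod (A + B + C' + D) \<le> cmod A + cmod B + cmod C' + cmod D" for A B C' D
    using norm_triangle_ineq[of "A + B + C'" D] norm_triangle_ineq[of "A + B" C'] norm_triangle_ineq[of A B] by linarith
  note norm4[of "contour_integral (linepath a1 a2) (\<lambda>z. W z * \<Theta> z)" "contour_integral (linepath a2 a3) (\<lambda>z. W z * \<Theta> z)"
      "contour_integral (linepath a3 a4) (\<lambda>z. W z * \<Theta> z)" "contour_integral (linepath a4 a1) (\<lambda>z. W z * \<Theta> z)"]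
  ultimately have "cmod (2 * pi * \<i> * ?Err) \<le> 2 * (H * pi) + 2 * (V * (2 * e))"
    unfolding eq by linarith
  moreover have "cmod (2 * pi * \<i> * ?Err) = 2 * (pi * cmod ?Err)" by (simp add: norm_mult)
  ultimately have "2 * (pi * cmod ?Err) \<le> 2 * (H * pi) + 2 * (V * (2 * e))" by (simp only:)
  also have "\<dots> = 2 * (pi * H + 2 * V * e)" by (simp add: algebra_simps)
  finally have "pi * cmod ?Err \<le> pi * H + 2 * V * e" by (rule mult_left_le_imp_le) simp
  \<comment> \<open>The vertical contribution carries no factor pi; one is inserted so that pi
    cancels on both sides.\<close>
  also have "2 * V * e \<le> pi * (2 * V * e)"
    using V0 e pi_gt3 by (intro mult_right_mono[of 1 pi, simplified]) auto
  finally have "pi * cmod ?Err \<le> pi * (H + 2 * V * e)" by (simp add: distrib_left)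
  then have "cmod ?Err \<le> H + 2 * V * e" by (simp only: mult_le_cancel_left_pos[OF pi_gt_zero])
  then show ?thesis by (simp add: H_def V_def B_def p_def X_def algebra_simps)
qed

section \<open>Asymptotics of the sine integral\<close>

text \<open>\<open>Si x + cos x / x + 1 / x\<close> decreases and \<open>Si x + cos x / x - 1 / x\<close> increases to \<open>pi / 2\<close>.\<close>

lemma Si_asymptotic:
  assumes "x > 0"
  shows "\<bar>Si x - pi / 2\<bar> \<le> 2 / x"
proof -
  \<comment> \<open>Adding cos t / t removes sin t / t from the derivative; what is left has
    constant sign for c = 1 and for c = -1.\<close>
  have der: "((\<lambda>t. Si t + cos t / t + c / t) has_real_derivative (- (cos t + c) / t\<^sup>2)) (at t)" if "t > 0" for t c
  proof -
    have "((\<lambda>t. Si t + cos t / t + c / t) has_real_derivative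
        (sinc t + ((- sin t) * t - cos t * 1) / (t * t) + (0 * t - c * 1) / (t * t))) (at t)"
      using that by (intro DERIV_add DERIV_Si DERIV_divide DERIV_cos DERIV_ident DERIV_const) auto
    moreover have "sinc t + ((- sin t) * t - cos t * 1) / (t * t) + (0 * t - c * 1) / (t * t) = - (cos t + c) / t\<^sup>2"
      using that by (simp add: power2_eq_square field_simps)
    ultimately show ?thesis by simp
  qed
  have lim: "((\<lambda>t. Si t + cos t / t + c / t) \<longlongrightarrow> pi / 2) at_top" for c :: real
  proof -
    have "((\<lambda>t::real. cos t / t) \<longlongrightarrow> 0) at_top"
    proof (rule Lim_null_comparison)
      show "\<forall>\<^sub>F t::real in at_top. norm (cos t / t) \<le> 1 / t"
        using eventually_gt_at_top[of 0] by eventually_elim (auto simp: divide_right_mono)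
      show "((\<lambda>t::real. 1 / t) \<longlongrightarrow> 0) at_top" by real_asymp
    qed
    moreover have "((\<lambda>t. c / t) \<longlongrightarrow> 0) at_top" by real_asymp
    ultimately have "((\<lambda>t. Si t + cos t / t + c / t) \<longlongrightarrow> pi / 2 + 0 + 0) at_top"
      by (intro tendsto_add Si_at_top)
    then show ?thesis by simp
  qed
  have "pi / 2 \<le> Si x + cos x / x + 1 / x"
  proof (rule tendsto_upperbound[OF lim[of 1]])
    show "\<forall>\<^sub>F t in at_top. Si t + cos t / t + 1 / t \<le> Si x + cos x / x + 1 / x"
      using eventually_gt_at_top[of x]
    proof eventually_elim
      case (elim t)
      show ?case
      proof (rule DERIV_nonpos_imp_nonincreasing[OF less_imp_le[OF elim]])
        fix s assume s: "x \<le> s" "s \<le> t"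
        have "- (cos s + 1) / s\<^sup>2 \<le> 0"
          using cos_ge_minus_one[of s] by (intro divide_nonpos_nonneg) auto
        then show "\<exists>y. ((\<lambda>t. Si t + cos t / t + 1 / t) has_real_derivative y) (at s) \<and> y \<le> 0"
          using der[of s 1] s assms by auto
      qed
    qed
  qed auto
  moreover have "Si x + cos x / x + (- 1) / x \<le> pi / 2"
  proof (rule tendsto_lowerbound[OF lim[of "- 1"]])
    show "\<forall>\<^sub>F t in at_top. Si x + cos x / x + (- 1) / x \<le> Si t + cos t / t + (- 1) / t"
      using eventually_gt_at_top[of x]
    proof eventually_elim
      case (elim t)
      show ?case
      proof (rule DERIV_nonneg_imp_nondecreasing[OF less_imp_le[OF elim]])
        fix s assume s: "x \<le> s" "s \<le> t"
        have "- (cos s + (- 1)) / s\<^sup>2 \<ge> 0" by simp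
        then show "\<exists>y. ((\<lambda>t. Si t + cos t / t + (- 1) / t) has_real_derivative y) (at s) \<and> 0 \<le> y"
          using der[of s "- 1"] s assms by (intro exI conjI) auto
      qed
    qed
  qed auto
  moreover have "\<bar>cos x / x\<bar> \<le> 1 / x"
    using assms by (simp add: abs_divide divide_right_mono)
  moreover have "(- 1) / x = - (1 / x)" by simp
  ultimately have "\<bar>Si x - pi / 2\<bar> \<le> 1 / x + 1 / x" by linarith
  then show ?thesis by simp
qed

text \<open>The comparison step is 0 at k = 0, so the diagonal entry 1/2 counts as remainder and the
  leading part is strictly triangular, as the discrete Gronwall inequality requires. For k > 0 the
  bound is the asymptotics of \<open>Si\<close>; negative k follow from \<sigma>(-k) = 1 -
  \<sigma>(k).\<close>

lemma sigma_SE_bound: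
  obtains B where "B \<ge> 1" "\<And>k. \<bar>sigma_SE k - (if k > 0 then 1 else 0)\<bar> \<le> B / (1 + \<bar>of_int k\<bar>)"
proof -
  have pos: "\<bar>sigma_SE k - 1\<bar> \<le> 4 / (1 + of_int k)" if "k > 0" for k
  proof -
    have k: "real_of_int k \<ge> 1" using that by simp
    have "sigma_SE k - 1 = 1 / pi * (Si (pi * of_int k) - pi / 2)"
      by (simp add: sigma_SE_def algebra_simps)
    then have "\<bar>sigma_SE k - 1\<bar> = 1 / pi * \<bar>Si (pi * of_int k) - pi / 2\<bar>"
      by (simp add: abs_mult)
    also have "\<dots> \<le> 1 / pi * (2 / (pi * of_int k))"
      using Si_asymptotic[of "pi * of_int k"] that by (intro mult_left_mono) auto
    also have "\<dots> = 2 / (pi * pi * of_int k)" by simp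
    also have "\<dots> \<le> 4 / (1 + of_int k)"
    proof -
      have "1 \<le> pi * pi" using pi_gt3 mult_mono[of 1 pi 1 pi] by simp
      then have "1 * of_int k \<le> pi * pi * real_of_int k" using k by (intro mult_right_mono) auto
      then have "2 / (pi * pi * of_int k) \<le> 2 / of_int k" using k by (intro frac_le) auto
      also have "\<dots> \<le> 4 / (1 + of_int k)" using that by (simp add: field_simps)
      finally show ?thesis .
    qed
    finally show ?thesis .
  qed
  have neg: "sigma_SE (- k) = 1 - sigma_SE k" if "k > 0" for k
    using Si_neg[of "pi * of_int k"] that by (simp add: sigma_SE_def)
  show ?thesis
  proof (rule that[of 4])
    fix k :: int
    have "\<bar>sigma_SE 0\<bar> \<le> 4" using Si_neg[of 0] by (simp add: sigma_SE_def)
    moreover have "\<bar>sigma_SE k\<bar> \<le> 4 / (1 + \<bar>of_int k\<bar>)" if "k < 0"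
      using neg[of "- k"] pos[of "- k"] that by (simp add: abs_minus_commute)
    ultimately show "\<bar>sigma_SE k - (if k > 0 then 1 else 0)\<bar> \<le> 4 / (1 + \<bar>of_int k\<bar>)"
      using pos[of k] by (cases k "0::int" rule: linorder_cases) auto
  qed simp
qed

lemma J_SE_bound:
  obtains B where "B \<ge> 0" "\<And>j h u. h \<ge> 0 \<Longrightarrow> \<bar>J_SE j h u\<bar> \<le> B * h"
proof -
  obtain B where B: "\<And>T. \<bar>Si T\<bar> \<le> B" using bounded_Si by auto
  have B0: "B \<ge> 0" using B[of 0] by linarith
  show ?thesis
  proof (rule that[of "1 + B"])
    fix j h u assume h: "(h::real) \<ge> 0"
    show "\<bar>J_SE j h u\<bar> \<le> (1 + B) * h"
    proof (cases u)
      case (real r)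
      define T where "T = Si (pi * (r / h - of_int j))"
      have "\<bar>1 / pi * T\<bar> = 1 / pi * \<bar>T\<bar>" by (simp add: abs_mult)
      also have "\<dots> \<le> 1 * B" unfolding T_def using B pi_gt3 by (intro mult_mono) auto
      finally have "\<bar>1 / 2 + 1 / pi * T\<bar> \<le> 1 + B" by linarith
      then have "h * \<bar>1 / 2 + 1 / pi * T\<bar> \<le> h * (1 + B)" using h by (rule mult_left_mono)
      then show ?thesis using real h by (simp add: J_SE_def T_def abs_mult mult.commute)
    qed (use h B0 in \<open>auto simp: J_SE_def algebra_simps\<close>)
  qed (use B0 in auto)
qed

section \<open>Stability of the Volterra part\<close>

lemma sum_int_symmetric:
  fixes f :: "int \<Rightarrow> 'a::comm_monoid_add"
  shows "(\<Sum>j = - int N..int N. f j) = f 0 + (\<Sum>j = 1..N. f (int j) + f (- int j))"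
proof (induction N)
  case (Suc N)
  have "{- int (Suc N)..int (Suc N)} = insert (int (Suc N)) (insert (- int (Suc N)) {- int N..int N})"
    by auto
  then show ?case by (simp add: Suc ac_simps)
qed simp

text \<open>A right-end Riemann sum of a decreasing function lies below the integral. By exp x \<ge>
  1 + x each term is at most a difference of neighbouring exponentials, and these telescope; the
  constant 1 / \<alpha> is free of h.\<close>

lemma sum_exp_tail:
  fixes h \<alpha> :: real
  assumes h: "h > 0" and \<alpha>: "\<alpha> > 0" and "n \<le> m"
  shows "(\<Sum>j = Suc n..m. h * exp (- \<alpha> * (h * of_nat j))) \<le> (exp (- \<alpha> * (h * of_nat n)) - exp (- \<alpha> * (h * of_nat m))) / \<alpha>"
  using \<open>n \<le> m\<close>
proof (induction m rule: dec_induct)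
  case (step m)
  have "\<alpha> * h * exp (- \<alpha> * (h * of_nat (Suc m))) \<le> exp (- \<alpha> * (h * of_nat m)) - exp (- \<alpha> * (h * of_nat (Suc m)))"
  proof -
    have "exp (- \<alpha> * (h * of_nat m)) = exp (- \<alpha> * (h * of_nat (Suc m))) * exp (\<alpha> * h)"
      by (simp add: exp_add[symmetric] algebra_simps)
    moreover have "exp (- \<alpha> * (h * of_nat (Suc m))) * (1 + \<alpha> * h) \<le> exp (- \<alpha> * (h * of_nat (Suc m))) * exp (\<alpha> * h)"
      by (intro mult_left_mono exp_ge_add_one_self) auto
    ultimately show ?thesis by (simp add: algebra_simps)
  qed
  then have "h * exp (- \<alpha> * (h * of_nat (Suc m))) \<le> (exp (- \<alpha> * (h * of_nat m)) - exp (- \<alpha> * (h * of_nat (Suc m)))) / \<alpha>"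
    using \<alpha> by (simp add: field_simps)
  with step show ?case by (simp add: diff_divide_distrib)
qed simp

lemma sum_exp_tail_le:
  fixes h \<alpha> :: real
  assumes "h > 0" and "\<alpha> > 0"
  shows "(\<Sum>j = Suc n..m. h * exp (- \<alpha> * (h * of_nat j))) \<le> exp (- \<alpha> * (h * of_nat n)) / \<alpha>"
proof (cases "n \<le> m")
  case True
  have "(exp (- \<alpha> * (h * of_nat n)) - exp (- \<alpha> * (h * of_nat m))) / \<alpha> \<le> exp (- \<alpha> * (h * of_nat n)) / \<alpha>"
    using assms by (intro divide_right_mono) auto
  with sum_exp_tail[OF assms True] show ?thesis by linarith
qed (use assms in auto)

lemma sum_exp_int_le:
  fixes h \<alpha> :: real
  assumes "h > 0" and "\<alpha> > 0"
  shows "(\<Sum>j = - int N..int N. h * exp (- \<alpha> * (h * \<bar>of_int j\<bar>))) \<le> h + 2 / \<alpha>"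
proof -
  have "(\<Sum>j = - int N..int N. h * exp (- \<alpha> * (h * \<bar>of_int j\<bar>))) = h + 2 * (\<Sum>j = Suc 0..N. h * exp (- \<alpha> * (h * of_nat j)))"
    unfolding sum_int_symmetric by (simp add: sum_distrib_left)
  then show ?thesis using sum_exp_tail_le[OF assms, of 0 N] by simp
qed

text \<open>Bounds the squared remainder of the \<sigma> matrix along a row; first powers would grow
  logarithmically with \<open>N\<close>. The term k = 0 gives 1, and each side telescopes to at most
  1.\<close>

lemma sum_inverse_square_int_le:
  "(\<Sum>k = - int N..int N. 1 / (1 + \<bar>of_int k\<bar>)\<^sup>2) \<le> (3::real)"
proof -
  have "(\<Sum>j = 1..N. 1 / (1 + real j)\<^sup>2) \<le> 1 - 1 / (1 + of_nat N)"
  proof (induction N)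
    case (Suc N)
    have "1 / (1 + real (Suc N))\<^sup>2 \<le> 1 / (1 + of_nat N) - 1 / (1 + of_nat (Suc N))"
    proof -
      have "1 / (1 + real (Suc N))\<^sup>2 \<le> 1 / ((1 + of_nat N) * (1 + of_nat (Suc N)))"
        unfolding power2_eq_square by (intro frac_le mult_right_mono) auto
      also have "\<dots> = 1 / (1 + of_nat N) - 1 / (1 + of_nat (Suc N))"
        by (simp add: divide_simps)
      finally show ?thesis .
    qed
    with Suc show ?case by simp
  qed simp
  also have "\<dots> \<le> 1" by simp
  finally have "(\<Sum>j = 1..N. 1 / (1 + real j)\<^sup>2) \<le> 1" .
  moreover have "(\<Sum>k = - int N..int N. 1 / (1 + \<bar>of_int k\<bar>)\<^sup>2) = 1 + 2 * (\<Sum>j = 1..N. 1 / (1 + real j)\<^sup>2)"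
    unfolding sum_int_symmetric by (simp add: sum_distrib_left)
  ultimately show ?thesis by simp
qed

lemma bij_betw_ix: "bij_betw (ix N) {..<2 * N + 1} {- int N..int N}"
  by (rule bij_betwI[where g = "\<lambda>j. nat (j + int N)"]) (auto simp: ix_def)

lemma sum_ix: "(\<Sum>q<2 * N + 1. f (ix N q)) = (\<Sum>j = - int N..int N. f j)"
  by (rule sum.reindex_bij_betw[OF bij_betw_ix])

lemma discrete_gronwall:
  fixes V w :: "nat \<Rightarrow> real"
  assumes V: "\<And>p. p < m \<Longrightarrow> V p \<le> A + (\<Sum>q<p. w q * V q)"
    and w: "\<And>q. w q \<ge> 0" and A: "A \<ge> 0" and "p < m"
  shows "V p \<le> A * exp (\<Sum>q<p. w q)"
proof -
  \<comment> \<open>\<open>B\<close> solves the recursion with equality, so strong induction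
    compares \<open>V\<close> with it; 1 + w \<le> exp w turns the product into the exponential of a
    sum.\<close>
  define B where "B = (\<lambda>p. A * (\<Prod>q<p. 1 + w q))"
  have B: "A + (\<Sum>q<p. w q * B q) = B p" for p
    by (induction p) (auto simp: B_def algebra_simps)
  have "V p \<le> B p" using \<open>p < m\<close>
  proof (induction p rule: less_induct)
    case (less p)
    have "V p \<le> A + (\<Sum>q<p. w q * V q)" using V less.prems .
    also have "\<dots> \<le> A + (\<Sum>q<p. w q * B q)"
      using less w by (intro add_left_mono sum_mono mult_left_mono) auto
    finally show ?case by (simp only: B)
  qed
  also have "B p \<le> A * (\<Prod>q<p. exp (w q))"
    unfolding B_def by (intro mult_left_mono prod_mono A) (use w in \<open>auto intro: exp_ge_add_one_self\<close>)
  finally show ?thesis by (simp add: exp_sum)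
qed

text \<open>The matrix of the \<open>\<sigma>\<close> is strictly lower triangular up to entries of size \<open>O(1 / (1 + \<bar>k\<bar>))\<close>;
  by the arithmetic-geometric mean inequality the latter contribute only \<open>O(sqrt h)\<close>, and the
  triangular part is handled by the discrete Gronwall inequality.\<close>

lemma sinc_matrix_stability:
  fixes h \<alpha> c B A :: real and V :: "nat \<Rightarrow> real" and N :: nat
  assumes h: "0 < h" "h \<le> 1" and \<alpha>: "\<alpha> > 0" and c: "c \<ge> 0" and A: "A \<ge> 0" and B: "B \<ge> 0"
    and sigma: "\<And>k. \<bar>sigma_SE k - (if k > 0 then 1 else 0)\<bar> \<le> B / (1 + \<bar>of_int k\<bar>)"
    and small: "c * B * (4 + 2 / \<alpha>) * sqrt h * exp (c * (1 + 2 / \<alpha>)) \<le> 1"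
    and V0: "\<And>p. V p \<ge> 0"
    and V: "\<And>p. p < 2 * N + 1 \<Longrightarrow> V p \<le> A + (\<Sum>q<2 * N + 1. c * (h * exp (- \<alpha> * (h * \<bar>of_int (ix N q)\<bar>)))
        * \<bar>sigma_SE (ix N p - ix N q)\<bar> * V q)"
    and "p < 2 * N + 1"
  shows "V p \<le> 2 * A * exp (c * (1 + 2 / \<alpha>))"
proof -
  define m where "m = 2 * N + 1"
  define E where "E = (\<lambda>j::int. exp (- \<alpha> * (h * \<bar>of_int j\<bar>)))"
  define w where "w = (\<lambda>q. c * (h * E (ix N q)))"
  define r where "r = (\<lambda>k::int. 1 / (1 + \<bar>real_of_int k\<bar>))"
  define W where "W = exp (c * (1 + 2 / \<alpha>))"
  define Vm where "Vm = Max (V ` {..<m})"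
  \<comment> \<open>The factor (2 + 1 / \<alpha>) sqrt h is sqrt h / 2 times the two bounds 1 + 2 /
    \<alpha> and 3 of the row sums below. The assumption \<open>small\<close> says exactly 2 \<eta>
    W \<le> 1.\<close>
  define \<eta> where "\<eta> = c * B * (2 + 1 / \<alpha>) * sqrt h"
  have m: "m > 0" by (simp add: m_def)
  have Vm: "V q \<le> Vm" if "q < m" for q unfolding Vm_def using that by (intro Max_ge) auto
  have Vm0: "Vm \<ge> 0" using Vm[OF m] V0[of 0] by linarith
  have E: "0 < E j" "E j \<le> 1" for j using h \<alpha> by (auto simp: E_def)
  have w0: "w q \<ge> 0" for q using c h E[of "ix N q"] by (simp add: w_def)
  have \<eta>0: "\<eta> \<ge> 0" using c B h \<alpha> by (simp add: \<eta>_def)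
  have W0: "W > 0" by (simp add: W_def)
  have sE: "(\<Sum>j = - int N..int N. h * E j) \<le> 1 + 2 / \<alpha>"
    using sum_exp_int_le[of h \<alpha> N] h \<alpha> unfolding E_def by linarith
  have sw: "(\<Sum>q<m. w q) \<le> c * (1 + 2 / \<alpha>)"
  proof -
    have "(\<Sum>q<m. w q) = c * (\<Sum>j = - int N..int N. h * E j)"
      unfolding w_def m_def sum_ix[of "\<lambda>j. c * (h * E j)"] by (simp only: sum_distrib_left)
    then show ?thesis using sE c by (simp add: mult_left_mono)
  qed
  have rem: "(\<Sum>q<m. w q * (B * r (ix N p - ix N q)) * V q) \<le> \<eta> * Vm" if p: "p < m" for p
  proof -
    define P where "P = ix N p"
    have P: "P \<in> {- int N..int N}" using p by (auto simp: P_def ix_def m_def)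
    have "(\<Sum>q<m. h * E (ix N q) * r (P - ix N q)) = (\<Sum>j = - int N..int N. h * E j * r (P - j))"
      unfolding m_def by (rule sum_ix)
    also have "\<dots> \<le> (\<Sum>j = - int N..int N. sqrt h / 2 * (h * E j) + sqrt h / 2 * (r (P - j))\<^sup>2)"
    proof (rule sum_mono)
      fix j
      define s where "s = sqrt h"
      have s: "s > 0" "h = s * s" using h by (auto simp: s_def)
      \<comment> \<open>The mean inequality is balanced by s = sqrt h, and \<open>E\<close> \<le> 1
        lets \<open>E\<close> replace its square. Both resulting sums are bounded independently of
        \<open>N\<close>, and a factor sqrt h is left over.\<close>
      have "0 \<le> (s * E j - r (P - j))\<^sup>2" by simp
      then have "2 * (s * E j * r (P - j)) \<le> s * s * (E j * E j) + (r (P - j))\<^sup>2"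
        by (simp add: power2_eq_square algebra_simps)
      also have "\<dots> \<le> s * s * E j + (r (P - j))\<^sup>2"
        using E[of j] by (intro add_right_mono mult_left_mono) (auto simp: mult_left_le)
      finally have "s / 2 * (2 * (s * E j * r (P - j))) \<le> s / 2 * (s * s * E j + (r (P - j))\<^sup>2)"
        using s by (intro mult_left_mono) auto
      then show "h * E j * r (P - j) \<le> sqrt h / 2 * (h * E j) + sqrt h / 2 * (r (P - j))\<^sup>2"
        unfolding s_def[symmetric] unfolding s(2) using s(1) by (simp add: algebra_simps)
    qed
    also have "\<dots> = sqrt h / 2 * (\<Sum>j = - int N..int N. h * E j) + sqrt h / 2 * (\<Sum>j = - int N..int N. (r (P - j))\<^sup>2)"
      by (simp add: sum.distrib sum_distrib_left)
    also have "\<dots> \<le> sqrt h / 2 * (1 + 2 / \<alpha>) + sqrt h / 2 * 3"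
    proof (intro add_mono mult_left_mono sE)
      have inj: "inj_on (\<lambda>j. P - j) {- int N..int N}" by (auto simp: inj_on_def)
      have "(\<Sum>j = - int N..int N. (r (P - j))\<^sup>2) = (\<Sum>k\<in>(\<lambda>j. P - j) ` {- int N..int N}. (r k)\<^sup>2)"
        unfolding sum.reindex[OF inj] o_def ..
      also have "\<dots> \<le> (\<Sum>k = - int (2 * N)..int (2 * N). (r k)\<^sup>2)"
        using P by (intro sum_mono2) auto
      also have "\<dots> \<le> 3" using sum_inverse_square_int_le[of "2 * N"] by (simp add: r_def power_divide)
      finally show "(\<Sum>j = - int N..int N. (r (P - j))\<^sup>2) \<le> 3" .
    qed (use h in auto)
    also have "\<dots> = (2 + 1 / \<alpha>) * sqrt h" by (simp add: algebra_simps)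
    finally have le: "(\<Sum>q<m. h * E (ix N q) * r (P - ix N q)) \<le> (2 + 1 / \<alpha>) * sqrt h" .
    have "(\<Sum>q<m. w q * (B * r (ix N p - ix N q)) * V q) \<le> (\<Sum>q<m. w q * (B * r (ix N p - ix N q)) * Vm)"
      using w0 B Vm by (intro sum_mono mult_left_mono) (auto simp: r_def)
    also have "\<dots> = c * B * Vm * (\<Sum>q<m. h * E (ix N q) * r (P - ix N q))"
      by (simp add: w_def P_def sum_distrib_left sum_distrib_right ac_simps)
    also have "\<dots> \<le> c * B * Vm * ((2 + 1 / \<alpha>) * sqrt h)"
      using c B Vm0 by (intro mult_left_mono le) auto
    also have "\<dots> = \<eta> * Vm" by (simp add: \<eta>_def)
    finally show ?thesis .
  qed
  have main: "V p \<le> (A + \<eta> * Vm) + (\<Sum>q<p. w q * V q)" if p: "p < m" for p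
  proof -
    have "V p \<le> A + (\<Sum>q<m. w q * \<bar>sigma_SE (ix N p - ix N q)\<bar> * V q)"
      using V[of p] p by (simp add: m_def w_def E_def)
    also have "(\<Sum>q<m. w q * \<bar>sigma_SE (ix N p - ix N q)\<bar> * V q)
        \<le> (\<Sum>q<m. w q * (B * r (ix N p - ix N q)) * V q + (if q < p then w q * V q else 0))"
    proof (rule sum_mono)
      fix q
      have "(0 < ix N p - ix N q) = (q < p)" by (auto simp: ix_def)
      then have "\<bar>sigma_SE (ix N p - ix N q)\<bar> \<le> B * r (ix N p - ix N q) + (if q < p then 1 else 0)"
        using sigma[of "ix N p - ix N q"] by (auto simp: r_def)
      then have "w q * \<bar>sigma_SE (ix N p - ix N q)\<bar> * V q \<le> w q * (B * r (ix N p - ix N q) + (if q < p then 1 else 0)) * V q"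
        using w0 V0 by (intro mult_right_mono mult_left_mono) auto
      then show "w q * \<bar>sigma_SE (ix N p - ix N q)\<bar> * V q \<le> w q * (B * r (ix N p - ix N q)) * V q + (if q < p then w q * V q else 0)"
        by (simp add: algebra_simps split: if_splits)
    qed
    also have "\<dots> = (\<Sum>q<m. w q * (B * r (ix N p - ix N q)) * V q) + (\<Sum>q<p. w q * V q)"
    proof -
      have "(\<Sum>q<m. if q < p then w q * V q else 0) = (\<Sum>q<p. w q * V q)"
        using p by (subst sum.inter_filter[symmetric]) (auto intro!: sum.cong)
      then show ?thesis by (simp add: sum.distrib)
    qed
    finally show ?thesis using rem[OF p] by simp
  qed
  have bnd: "V p \<le> (A + \<eta> * Vm) * W" if p: "p < m" for p
  proof -
    have "V p \<le> (A + \<eta> * Vm) * exp (\<Sum>q<p. w q)"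
      using discrete_gronwall[of m V "A + \<eta> * Vm" w p] main w0 A \<eta>0 Vm0 p by auto
    moreover
    have "(\<Sum>q<p. w q) \<le> c * (1 + 2 / \<alpha>)"
      using p w0 by (intro order_trans[OF sum_mono2 sw]) auto
    then have "(A + \<eta> * Vm) * exp (\<Sum>q<p. w q) \<le> (A + \<eta> * Vm) * W"
      using A \<eta>0 Vm0 by (intro mult_left_mono) (auto simp: W_def)
    ultimately show ?thesis by linarith
  qed
  have "Vm \<in> V ` {..<m}" unfolding Vm_def using m by (intro Max_in) auto
  \<comment> \<open>At an index where the maximum is attained, the term with \<open>Vm\<close> on
    the right is at most half of the left side and is absorbed; this costs the factor 2 in the
    conclusion.\<close>
  then have "Vm \<le> (A + \<eta> * Vm) * W" using bnd by auto
  also have "\<dots> = A * W + (\<eta> * W) * Vm" by (simp add: algebra_simps)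
  also have "(\<eta> * W) * Vm \<le> 1 / 2 * Vm"
  proof (rule mult_right_mono[OF _ Vm0])
    have "2 * (\<eta> * W) = c * B * (4 + 2 / \<alpha>) * sqrt h * exp (c * (1 + 2 / \<alpha>))"
      by (simp add: \<eta>_def W_def algebra_simps)
    then show "\<eta> * W \<le> 1 / 2" using small by simp
  qed
  finally have "Vm \<le> 2 * A * W" by simp
  then show ?thesis using Vm[of p] \<open>p < 2 * N + 1\<close> by (simp add: m_def W_def)
qed

section \<open>Linear differential equations in a strip\<close>

lemma strip_open_convex: "open (strip d)" "convex (strip d)"
proof -
  have "strip d = {z. Im z < d} \<inter> {z. Im z > - d}" by (auto simp: strip_def)
  then show "open (strip d)" "convex (strip d)"
    by (auto intro!: open_Int convex_Int open_halfspace_Im_lt open_halfspace_Im_gt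
        convex_halfspace_Im_lt convex_halfspace_Im_gt)
qed

text \<open>One Picard step: A L^(m+1) / (m+1)! is a primitive of L' A L^m / m!. Measuring by
  \<open>L\<close> instead of by the length \<open>T\<close> keeps the majorant bounded when L' is
  integrable over an unbounded line.\<close>

lemma taylor_majorant_step:
  fixes g :: "real \<Rightarrow> complex" and A T :: real
  assumes T: "T \<ge> 0"
    and g: "\<And>s. 0 \<le> s \<Longrightarrow> s \<le> T \<Longrightarrow> (g has_vector_derivative g' s) (at s)"
    and L: "\<And>s. (L has_real_derivative L' s) (at s)"
    and bnd: "\<And>s. 0 \<le> s \<Longrightarrow> s \<le> T \<Longrightarrow> cmod (g' s) \<le> L' s * (A * L s ^ m / fact m)"
    and init: "cmod (g 0) \<le> A * L 0 ^ Suc m / fact (Suc m)"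
  shows "cmod (g T) \<le> A * L T ^ Suc m / fact (Suc m)"
proof (cases "T = 0")
  case False
  with T have T: "0 < T" by simp
  define \<phi> where "\<phi> = (\<lambda>s. A * L s ^ Suc m / fact (Suc m))"
  have d\<phi>: "(\<phi> has_vector_derivative L' s * (A * L s ^ m / fact m)) (at s)" for s
  proof -
    have "(\<phi> has_real_derivative (A * (of_nat (Suc m) * (L' s * L s ^ (Suc m - Suc 0))) / fact (Suc m))) (at s)"
      unfolding \<phi>_def by (intro DERIV_cdivide DERIV_cmult DERIV_power L)
    moreover have "A * (of_nat (Suc m) * (L' s * L s ^ (Suc m - Suc 0))) / fact (Suc m) = L' s * (A * L s ^ m / fact m)"
      by (simp add: field_simps del: of_nat_Suc)
    ultimately show ?thesis by (simp only: has_real_derivative_iff_has_vector_derivative)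
  qed
  have "norm (g T - g 0) \<le> \<phi> T - \<phi> 0"
  proof (rule differentiable_bound_general[OF T, where f' = g' and \<phi>' = "\<lambda>s. L' s * (A * L s ^ m / fact m)"])
    show "continuous_on {0..T} g"
      by (rule continuous_on_vector_derivative[OF has_vector_derivative_at_within[OF g]]) auto
    show "continuous_on {0..T} \<phi>"
      by (rule continuous_on_vector_derivative[OF has_vector_derivative_at_within[OF d\<phi>]])
  qed (use g d\<phi> bnd in auto)
  then show ?thesis
    using init norm_triangle_ineq[of "g T - g 0" "g 0"] unfolding \<phi>_def by simp
qed (use init in simp)

text \<open>The integral of c exp (- \<alpha> |Re w|) along the path from 0 vertically to
  \<open>\<i> * Im z\<close> and then horizontally to \<open>z\<close>. It is bounded on the whole
  strip, which makes the Picard series converge uniformly although the strip is unbounded.\<close>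

definition strip_majorant :: "real \<Rightarrow> real \<Rightarrow> complex \<Rightarrow> real" where
  "strip_majorant c \<alpha> z = c * (1 - exp (- \<alpha> * \<bar>Re z\<bar>)) / \<alpha> + c * \<bar>Im z\<bar>"

lemma strip_majorant_nonneg: "c \<ge> 0 \<Longrightarrow> \<alpha> > 0 \<Longrightarrow> strip_majorant c \<alpha> z \<ge> 0"
  by (simp add: strip_majorant_def)

lemma strip_majorant_le:
  assumes "c \<ge> 0" "\<alpha> > 0" "z \<in> strip d"
  shows "strip_majorant c \<alpha> z \<le> c / \<alpha> + c * d"
proof -
  have "c * (1 - exp (- \<alpha> * \<bar>Re z\<bar>)) / \<alpha> \<le> c * 1 / \<alpha>"
    using assms by (intro divide_right_mono mult_left_mono) auto
  moreover have "c * \<bar>Im z\<bar> \<le> c * d"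
    using assms by (intro mult_left_mono) (auto simp: strip_def)
  ultimately show ?thesis by (simp add: strip_majorant_def)
qed

text \<open>The bound is propagated first along the imaginary axis and then along a horizontal line.\<close>

lemma strip_primitive_bound:
  fixes f f' :: "complex \<Rightarrow> complex"
  assumes c: "c \<ge> 0" and \<alpha>: "\<alpha> > 0"
    and f: "\<And>z. z \<in> strip d \<Longrightarrow> (f has_field_derivative f' z) (at z)" and f0: "f 0 = 0"
    and bnd: "\<And>z. z \<in> strip d \<Longrightarrow>
      cmod (f' z) \<le> c * exp (- \<alpha> * \<bar>Re z\<bar>) * (A * strip_majorant c \<alpha> z ^ m / fact m)"
    and z: "z \<in> strip d"
  shows "cmod (f z) \<le> A * strip_majorant c \<alpha> z ^ Suc m / fact (Suc m)"
proof -
  \<comment> \<open>Unit directions of the two legs of the path. If a component of \<open>z\<close>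
    vanishes, \<open>sgn\<close> makes the direction 0 and the leg degenerates.\<close>
  define p where "p = complex_of_real (sgn (Im z)) * \<i>"
  define q where "q = complex_of_real (sgn (Re z))"
  have line: "((\<lambda>s. f (a + of_real s * b)) has_vector_derivative f' (a + of_real s * b) * b) (at s)"
    if "a + of_real s * b \<in> strip d" for a b s
  proof -
    have "((\<lambda>w. f (a + w * b)) has_field_derivative f' (a + of_real s * b) * b) (at (of_real s))"
      by (rule DERIV_chain2[where g = "\<lambda>w. a + w * b", OF f[OF that]]) (auto intro!: derivative_eq_intros)
    then show ?thesis by (rule has_vector_derivative_real_field)
  qed
  have z1: "\<i> * of_real (Im z) = 0 + of_real \<bar>Im z\<bar> * p"
    by (simp add: p_def sgn_if complex_eq_iff)
  have z2: "z = \<i> * of_real (Im z) + of_real \<bar>Re z\<bar> * q"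
    by (simp add: q_def sgn_if complex_eq_iff)
  have 1: "cmod (f (0 + of_real \<bar>Im z\<bar> * p)) \<le> A * (c * \<bar>Im z\<bar>) ^ Suc m / fact (Suc m)"
  proof (rule taylor_majorant_step[where g = "\<lambda>s. f (0 + of_real s * p)" and L = "\<lambda>s. c * s" and L' = "\<lambda>s. c"])
    fix s assume s: "0 \<le> s" "s \<le> \<bar>Im z\<bar>"
    have ReIm: "Re (of_real s * p) = 0" "\<bar>Im (of_real s * p)\<bar> = s \<or> Im z = 0 \<and> s = 0"
      using s by (auto simp: p_def abs_mult abs_sgn_eq)
    have st: "0 + of_real s * p \<in> strip d"
      using ReIm s z by (auto simp: strip_def)
    from line[OF this] show "((\<lambda>s. f (0 + of_real s * p)) has_vector_derivative f' (0 + of_real s * p) * p) (at s)" .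
    have "cmod (f' (0 + of_real s * p) * p) \<le> cmod (f' (0 + of_real s * p)) * 1"
      unfolding norm_mult by (intro mult_left_mono) (auto simp: p_def norm_mult abs_sgn_eq)
    also have "\<dots> \<le> c * (A * (c * s) ^ m / fact m)"
      using bnd[OF st] ReIm by (auto simp: strip_majorant_def p_def)
    finally show "cmod (f' (0 + of_real s * p) * p) \<le> c * (A * (c * s) ^ m / fact m)" .
  qed (use f0 in \<open>auto intro!: derivative_eq_intros\<close>)
  define l where "l = (\<lambda>s. c * (1 - exp (- \<alpha> * s)) / \<alpha> + c * \<bar>Im z\<bar>)"
  have 2: "cmod (f (\<i> * of_real (Im z) + of_real \<bar>Re z\<bar> * q)) \<le> A * l \<bar>Re z\<bar> ^ Suc m / fact (Suc m)"
  proof (rule taylor_majorant_step[where g = "\<lambda>s. f (\<i> * of_real (Im z) + of_real s * q)" and L = l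
        and L' = "\<lambda>s. c * exp (- \<alpha> * s)"])
    show "(l has_real_derivative c * exp (- \<alpha> * s)) (at s)" for s
      unfolding l_def using \<alpha> by (auto intro!: derivative_eq_intros)
    show "cmod (f (\<i> * of_real (Im z) + of_real 0 * q)) \<le> A * l 0 ^ Suc m / fact (Suc m)"
      using 1 by (simp add: l_def z1)
    fix s assume s: "0 \<le> s" "s \<le> \<bar>Re z\<bar>"
    define w where "w = \<i> * of_real (Im z) + of_real s * q"
    have w: "\<bar>Re w\<bar> = s" "Im w = Im z"
      using s by (auto simp: w_def q_def abs_mult abs_sgn_eq)
    have st: "w \<in> strip d" using w z by (auto simp: strip_def)
    from line[OF this[unfolded w_def]]
    show "((\<lambda>s. f (\<i> * of_real (Im z) + of_real s * q)) has_vector_derivative f' (\<i> * of_real (Im z) + of_real s * q) * q) (at s)" .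
    have "cmod (f' w * q) \<le> cmod (f' w) * 1"
      unfolding norm_mult by (intro mult_left_mono) (auto simp: q_def abs_sgn_eq)
    also have "\<dots> \<le> c * exp (- \<alpha> * s) * (A * l s ^ m / fact m)"
      using bnd[OF st] w by (simp add: strip_majorant_def l_def)
    finally show "cmod (f' (\<i> * of_real (Im z) + of_real s * q) * q) \<le> c * exp (- \<alpha> * s) * (A * l s ^ m / fact m)"
      by (simp add: w_def)
  qed simp
  have "l \<bar>Re z\<bar> = strip_majorant c \<alpha> z" by (simp add: l_def strip_majorant_def)
  with 2 show ?thesis using z2 by simp
qed

lemma strip_primitive:
  assumes "f holomorphic_on strip d"
  obtains g where "\<And>z. z \<in> strip d \<Longrightarrow> (g has_field_derivative f z) (at z)" "g 0 = a"
proof -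
  obtain g where g: "\<And>z. z \<in> strip d \<Longrightarrow> (g has_field_derivative f z) (at z within strip d)"
    using holomorphic_convex_primitive'[OF strip_open_convex(2,1) assms] by blast
  have "((\<lambda>z. g z - g 0 + a) has_field_derivative f z) (at z)" if "z \<in> strip d" for z
    using g[OF that] that at_within_open[OF that strip_open_convex(1)]
    by (auto intro!: derivative_eq_intros)
  then show ?thesis by (rule that) auto
qed

lemma holomorphic_on_stripI:
  "(\<And>z. z \<in> strip d \<Longrightarrow> (f has_field_derivative f' z) (at z)) \<Longrightarrow> f holomorphic_on strip d"
  by (meson DERIV_subset field_differentiable_def holomorphic_on_def subset_UNIV)

text \<open>The \<open>D m\<close> are the increments of the Picard iteration, not its iterates: the
  initial value and \<gamma> enter only \<open>D 0\<close>, and every later increment vanishes at 0.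
  They are therefore dominated by the terms of an exponential series; the factor n in the majorant
  counts the entries of a row.\<close>

lemma picard_iterates:
  fixes \<kappa> :: "nat \<Rightarrow> nat \<Rightarrow> complex \<Rightarrow> complex" and \<gamma> :: "nat \<Rightarrow> complex \<Rightarrow> complex" and w :: "nat \<Rightarrow> complex"
  assumes \<alpha>: "\<alpha> > 0" and c: "c \<ge> 0"
    and \<kappa>: "\<And>i l. i < n \<Longrightarrow> l < n \<Longrightarrow> \<kappa> i l holomorphic_on strip d"
    and \<gamma>: "\<And>i. i < n \<Longrightarrow> \<gamma> i holomorphic_on strip d"
    and \<kappa>b: "\<And>i l z. i < n \<Longrightarrow> l < n \<Longrightarrow> z \<in> strip d \<Longrightarrow> cmod (\<kappa> i l z) \<le> c * exp (- \<alpha> * \<bar>Re z\<bar>)"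
    and \<gamma>b: "\<And>i z. i < n \<Longrightarrow> z \<in> strip d \<Longrightarrow> cmod (\<gamma> i z) \<le> c * exp (- \<alpha> * \<bar>Re z\<bar>)"
  obtains B D where "B \<ge> 0"
    "\<And>i z. i < n \<Longrightarrow> z \<in> strip d \<Longrightarrow> (D 0 i has_field_derivative \<gamma> i z) (at z)"
    "\<And>i. i < n \<Longrightarrow> D 0 i 0 = w i"
    "\<And>m i z. i < n \<Longrightarrow> z \<in> strip d \<Longrightarrow> (D (Suc m) i has_field_derivative (\<Sum>l<n. \<kappa> i l z * D m l z)) (at z)"
    "\<And>m i. i < n \<Longrightarrow> D (Suc m) i 0 = 0"
    "\<And>m i z. i < n \<Longrightarrow> z \<in> strip d \<Longrightarrow> cmod (D m i z) \<le> B * (strip_majorant (of_nat n * c) \<alpha> z ^ m / fact m)"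
proof -
  \<comment> \<open>The bound of \<open>D 0\<close>: the initial values plus the largest value of
    the majorant. Taking |d| keeps \<open>B\<close> nonnegative for either sign of d.\<close>
  define B where "B = (\<Sum>i<n. cmod (w i)) + (c / \<alpha> + c * \<bar>d\<bar>)"
  have B0: "B \<ge> 0" unfolding B_def using c \<alpha> by (intro add_nonneg_nonneg sum_nonneg) auto
  define c' where "c' = of_nat n * c"
  have c': "c' \<ge> 0" using c by (simp add: c'_def)
  \<comment> \<open>Dependent choice hands on only the relation between neighbours, so the
    properties of the starting function are carried inside \<open>P\<close> for m = 0.\<close>
  define P where "P = (\<lambda>m (D :: nat \<Rightarrow> complex \<Rightarrow> complex). (\<forall>i<n. D i holomorphic_on strip d) \<and>
    (\<forall>i<n. \<forall>z\<in>strip d. cmod (D i z) \<le> B * (strip_majorant c' \<alpha> z ^ m / fact m)) \<and>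
    (m = 0 \<longrightarrow> (\<forall>i<n. (\<forall>z\<in>strip d. (D i has_field_derivative \<gamma> i z) (at z)) \<and> D i 0 = w i)))"
  define Q where "Q = (\<lambda>(m::nat) D D'. \<forall>i<n. (\<forall>z\<in>strip d. (D' i has_field_derivative (\<Sum>l<n. \<kappa> i l z * D l z)) (at z)) \<and> D' i 0 = (0::complex))"
  have "\<exists>D. \<forall>m. P m (D m) \<and> Q m (D m) (D (Suc m))"
  proof (rule dependent_nat_choice)
    have "\<exists>g. (\<forall>z\<in>strip d. (g has_field_derivative \<gamma> i z) (at z)) \<and> g 0 = w i" if "i < n" for i
      using strip_primitive[OF \<gamma>[OF that]] by metis
    then obtain D where D: "\<And>i. i < n \<Longrightarrow> (\<forall>z\<in>strip d. (D i has_field_derivative \<gamma> i z) (at z)) \<and> D i 0 = w i"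
      by metis
    have "cmod (D i z) \<le> B" if i: "i < n" and z: "z \<in> strip d" for i z
    proof -
      have "cmod (D i z - w i) \<le> 1 * strip_majorant c \<alpha> z ^ Suc 0 / fact (Suc 0)"
      proof (rule strip_primitive_bound[OF c \<alpha> _ _ _ z])
        show "((\<lambda>z. D i z - w i) has_field_derivative \<gamma> i z) (at z)" if "z \<in> strip d" for z
          using D[OF i] that by (auto intro!: derivative_eq_intros)
      qed (use D[OF i] \<gamma>b[OF i] in auto)
      also have "\<dots> \<le> c / \<alpha> + c * d" using strip_majorant_le[OF c \<alpha> z] by simp
      also have "\<dots> \<le> c / \<alpha> + c * \<bar>d\<bar>" using c by (intro add_left_mono mult_left_mono) auto
      finally have "cmod (D i z - w i) \<le> c / \<alpha> + c * \<bar>d\<bar>" .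
      moreover have "cmod (w i) \<le> (\<Sum>i<n. cmod (w i))" using i by (intro member_le_sum) auto
      ultimately show ?thesis using norm_triangle_ineq[of "D i z - w i" "w i"] by (simp add: B_def)
    qed
    moreover have "D i holomorphic_on strip d" if "i < n" for i
      using D[OF that] by (blast intro: holomorphic_on_stripI)
    ultimately show "\<exists>D. P 0 D" unfolding P_def using D by (intro exI[of _ D]) auto
  next
    fix D m assume D: "P m D"
    have hol: "(\<lambda>z. \<Sum>l<n. \<kappa> i l z * D l z) holomorphic_on strip d" if "i < n" for i
      using D that by (intro holomorphic_intros \<kappa>) (auto simp: P_def)
    have "\<exists>g. (\<forall>z\<in>strip d. (g has_field_derivative (\<Sum>l<n. \<kappa> i l z * D l z)) (at z)) \<and> g 0 = 0" if "i < n" for i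
      using strip_primitive[OF hol[OF that]] by metis
    then obtain D' where D': "\<And>i. i < n \<Longrightarrow> (\<forall>z\<in>strip d. (D' i has_field_derivative (\<Sum>l<n. \<kappa> i l z * D l z)) (at z)) \<and> D' i 0 = 0"
      by metis
    have "cmod (D' i z) \<le> B * strip_majorant c' \<alpha> z ^ Suc m / fact (Suc m)" if i: "i < n" and z: "z \<in> strip d" for i z
    proof (rule strip_primitive_bound[OF c' \<alpha> _ _ _ z])
      fix z assume z: "z \<in> strip d"
      have "cmod (\<Sum>l<n. \<kappa> i l z * D l z) \<le> (\<Sum>l<n. cmod (\<kappa> i l z) * cmod (D l z))"
        by (intro order_trans[OF norm_sum]) (simp add: norm_mult)
      also have "\<dots> \<le> (\<Sum>l<n. c * exp (- \<alpha> * \<bar>Re z\<bar>) * (B * (strip_majorant c' \<alpha> z ^ m / fact m)))"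
        using D z c i by (intro sum_mono mult_mono \<kappa>b) (auto simp: P_def)
      also have "\<dots> = c' * exp (- \<alpha> * \<bar>Re z\<bar>) * (B * strip_majorant c' \<alpha> z ^ m / fact m)"
        by (simp add: c'_def)
      finally show "cmod (\<Sum>l<n. \<kappa> i l z * D l z) \<le> c' * exp (- \<alpha> * \<bar>Re z\<bar>) * (B * strip_majorant c' \<alpha> z ^ m / fact m)" .
    qed (use D'[OF i] in auto)
    moreover have "D' i holomorphic_on strip d" if "i < n" for i
      using D'[OF that] by (intro holomorphic_on_stripI[where f' = "\<lambda>z. \<Sum>l<n. \<kappa> i l z * D l z"]) auto
    ultimately show "\<exists>D'. P (Suc m) D' \<and> Q m D D'" unfolding P_def Q_def using D'
      by (intro exI[of _ D']) auto
  qed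
  then obtain D where D: "\<And>m. P m (D m)" "\<And>m. Q m (D m) (D (Suc m))" by blast
  show ?thesis
    by (rule that[of B D]) (use B0 D[unfolded P_def Q_def] in \<open>auto simp: c'_def\<close>)
qed

text \<open>The solution is the sum of the Picard increments. \<Lambda> bounds the majorant on the
  strip, so the series is dominated by an exponential series there. The differentiated series
  converges uniformly as well, because the differential equation expresses its partial sums by those
  of \<open>u\<close>.\<close>

lemma linear_ode_strip:
  fixes \<kappa> :: "nat \<Rightarrow> nat \<Rightarrow> complex \<Rightarrow> complex" and \<gamma> :: "nat \<Rightarrow> complex \<Rightarrow> complex" and w :: "nat \<Rightarrow> complex"
  assumes d: "d > 0" and \<alpha>: "\<alpha> > 0" and c: "c \<ge> 0"
    and \<kappa>: "\<And>i l. i < n \<Longrightarrow> l < n \<Longrightarrow> \<kappa> i l holomorphic_on strip d"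
    and \<gamma>: "\<And>i. i < n \<Longrightarrow> \<gamma> i holomorphic_on strip d"
    and \<kappa>b: "\<And>i l z. i < n \<Longrightarrow> l < n \<Longrightarrow> z \<in> strip d \<Longrightarrow> cmod (\<kappa> i l z) \<le> c * exp (- \<alpha> * \<bar>Re z\<bar>)"
    and \<gamma>b: "\<And>i z. i < n \<Longrightarrow> z \<in> strip d \<Longrightarrow> cmod (\<gamma> i z) \<le> c * exp (- \<alpha> * \<bar>Re z\<bar>)"
  obtains u B where "B \<ge> 0"
    "\<And>i z. i < n \<Longrightarrow> z \<in> strip d \<Longrightarrow> (u i has_field_derivative (\<gamma> i z + (\<Sum>l<n. \<kappa> i l z * u l z))) (at z)"
    "\<And>i. i < n \<Longrightarrow> u i 0 = w i"
    "\<And>i z. i < n \<Longrightarrow> z \<in> strip d \<Longrightarrow> cmod (u i z) \<le> B"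
proof (rule picard_iterates[where \<kappa> = \<kappa> and \<gamma> = \<gamma> and d = d and n = n and w = w, OF \<alpha> c \<kappa> \<gamma> \<kappa>b \<gamma>b])
  fix B D
  assume B: "B \<ge> 0"
    and D0: "\<And>i z. i < n \<Longrightarrow> z \<in> strip d \<Longrightarrow> (D 0 i has_field_derivative \<gamma> i z) (at z)"
    and D00: "\<And>i. i < n \<Longrightarrow> D 0 i 0 = w i"
    and DS: "\<And>m i z. i < n \<Longrightarrow> z \<in> strip d \<Longrightarrow> (D (Suc m) i has_field_derivative (\<Sum>l<n. \<kappa> i l z * D m l z)) (at z)"
    and DS0: "\<And>m i. i < n \<Longrightarrow> D (Suc m) i 0 = 0"
    and Db: "\<And>m i z. i < n \<Longrightarrow> z \<in> strip d \<Longrightarrow> cmod (D m i z) \<le> B * (strip_majorant (of_nat n * c) \<alpha> z ^ m / fact m)"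
  define \<Lambda> where "\<Lambda> = of_nat n * c / \<alpha> + of_nat n * c * d"
  define M where "M = (\<lambda>m. B * (\<Lambda> ^ m / fact m))"
  define u where "u = (\<lambda>i z. \<Sum>m. D m i z)"
  have c': "of_nat n * c \<ge> 0" using c by simp
  have DM: "cmod (D m i z) \<le> M m" if "i < n" "z \<in> strip d" for m i z
  proof -
    have "strip_majorant (of_nat n * c) \<alpha> z ^ m \<le> \<Lambda> ^ m"
      unfolding \<Lambda>_def by (intro power_mono strip_majorant_le strip_majorant_nonneg c' \<alpha> that)
    then have "B * (strip_majorant (of_nat n * c) \<alpha> z ^ m / fact m) \<le> M m"
      unfolding M_def using B by (intro mult_left_mono divide_right_mono) auto
    then show ?thesis using Db[OF that, of m] by linarith
  qed
  have sM: "summable M"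
    unfolding M_def using summable_exp[of \<Lambda>] by (intro summable_mult) (simp add: field_simps)
  have sD: "summable (\<lambda>m. D m i z)" if "i < n" "z \<in> strip d" for i z
    using DM[OF that] by (intro summable_comparison_test[OF _ sM]) auto
  have unif: "uniform_limit (strip d) (\<lambda>m z. \<Sum>k<m. D k i z) (u i) sequentially" if "i < n" for i
    unfolding u_def by (rule Weierstrass_m_test[OF DM[OF that] sM])
  define d' where "d' = (\<lambda>i m z. case m of 0 \<Rightarrow> \<gamma> i z | Suc k \<Rightarrow> (\<Sum>l<n. \<kappa> i l z * D k l z))"
  have dd: "(D m i has_field_derivative d' i m z) (at z within strip d)" if "i < n" "z \<in> strip d" for i m z
    unfolding d'_def using D0[OF that] DS[OF that] by (cases m) (auto intro: DERIV_subset)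
  have ss: "0 \<in> strip d" using d by (simp add: strip_def)
  have deriv: "(u i has_field_derivative (\<gamma> i z + (\<Sum>l<n. \<kappa> i l z * u l z))) (at z)" if i: "i < n" and z: "z \<in> strip d" for i z
  proof -
    have "\<exists>g. \<forall>z\<in>strip d. ((\<lambda>m. D m i z) sums g z) \<and>
        (g has_field_derivative (\<gamma> i z + (\<Sum>l<n. \<kappa> i l z * u l z))) (at z within strip d)"
    proof (rule has_complex_derivative_series[OF strip_open_convex(2) dd[OF i]])
      show "\<exists>z l. z \<in> strip d \<and> (\<lambda>m. D m i z) sums l"
        using sD[OF i ss] ss by (blast intro: summable_sums)
      fix e :: real assume e: "e > 0"
      \<comment> \<open>The + 1 keeps the denominator positive when n c = 0.\<close>
      define \<epsilon> where "\<epsilon> = e / (of_nat n * c + 1)"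
      have \<epsilon>: "\<epsilon> > 0" using e c' by (simp add: \<epsilon>_def add_nonneg_pos)
      have "\<forall>\<^sub>F m in sequentially. \<forall>l\<in>{..<n}. \<forall>z\<in>strip d. dist (\<Sum>k<m. D k l z) (u l z) < \<epsilon>"
        using unif \<epsilon> by (intro eventually_ball_finite) (auto simp: uniform_limit_iff)
      then obtain N where N: "\<And>m l z. m \<ge> N \<Longrightarrow> l < n \<Longrightarrow> z \<in> strip d \<Longrightarrow> dist (\<Sum>k<m. D k l z) (u l z) < \<epsilon>"
        by (auto simp: eventually_sequentially)
      have "cmod ((\<Sum>k<m. d' i k z) - (\<gamma> i z + (\<Sum>l<n. \<kappa> i l z * u l z))) \<le> e"
        if m: "m \<ge> Suc N" and z: "z \<in> strip d" for m z
      proof -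
        obtain k where k: "m = Suc k" "k \<ge> N" using m by (cases m) auto
        \<comment> \<open>Differentiation shifts the index: the derivative of the sum of k + 1
          increments is \<gamma> plus \<kappa> applied to the sum of the first k.\<close>
        have "(\<Sum>k<m. d' i k z) = \<gamma> i z + (\<Sum>j<k. \<Sum>l<n. \<kappa> i l z * D j l z)"
          unfolding k sum.lessThan_Suc_shift by (simp add: d'_def)
        also have "(\<Sum>j<k. \<Sum>l<n. \<kappa> i l z * D j l z) = (\<Sum>l<n. \<kappa> i l z * (\<Sum>j<k. D j l z))"
          by (subst sum.swap) (simp add: sum_distrib_left)
        finally have "(\<Sum>k<m. d' i k z) - (\<gamma> i z + (\<Sum>l<n. \<kappa> i l z * u l z))
            = (\<Sum>l<n. \<kappa> i l z * ((\<Sum>j<k. D j l z) - u l z))"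
          by (simp add: sum_subtractf right_diff_distrib)
        also have "cmod \<dots> \<le> (\<Sum>l<n. c * \<epsilon>)"
        proof (rule sum_norm_le)
          fix l assume "l \<in> {..<n}"
          then have l: "l < n" by simp
          have "cmod (\<kappa> i l z) \<le> c * exp (- \<alpha> * \<bar>Re z\<bar>)" using \<kappa>b[OF i l z] .
          also have "\<dots> \<le> c * 1" using c \<alpha> by (intro mult_left_mono) auto
          finally show "cmod (\<kappa> i l z * ((\<Sum>j<k. D j l z) - u l z)) \<le> c * \<epsilon>"
            using N[OF k(2) l z] c unfolding norm_mult by (intro mult_mono) (auto simp: dist_norm)
        qed
        also have "\<dots> \<le> e"
        proof -
          have "(of_nat n * c + 1) * \<epsilon> = e" using c' unfolding \<epsilon>_def by simp
          then show ?thesis using \<epsilon> by (simp add: algebra_simps)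
        qed
        finally show ?thesis .
      qed
      then show "\<exists>N. \<forall>m z. N \<le> m \<longrightarrow> z \<in> strip d \<longrightarrow>
          cmod ((\<Sum>k<m. d' i k z) - (\<gamma> i z + (\<Sum>l<n. \<kappa> i l z * u l z))) \<le> e" by blast
    qed
    then obtain g where g: "\<And>z. z \<in> strip d \<Longrightarrow> (\<lambda>m. D m i z) sums g z"
      "\<And>z. z \<in> strip d \<Longrightarrow> (g has_field_derivative (\<gamma> i z + (\<Sum>l<n. \<kappa> i l z * u l z))) (at z within strip d)"
      by blast
    have gu: "g z = u i z" if "z \<in> strip d" for z
      using sums_unique[OF g(1)[OF that]] by (simp add: u_def)
    have "(g has_field_derivative (\<gamma> i z + (\<Sum>l<n. \<kappa> i l z * u l z))) (at z)"
      using g(2)[OF z] at_within_open[OF z strip_open_convex(1)] by simp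
    then show ?thesis
      by (rule has_field_derivative_transform_within_open[OF _ strip_open_convex(1) z]) (use gu in auto)
  qed
  have u0: "u i 0 = w i" if "i < n" for i
  proof -
    have "D m i 0 = (if m = 0 then w i else 0)" for m
      using D00[OF that] DS0[OF that] by (cases m) simp_all
    then have "(\<lambda>m. D m i 0) sums w i"
      using sums_single[of 0 "\<lambda>_. w i"] by (simp only:)
    then show ?thesis unfolding u_def by (rule sums_unique[symmetric])
  qed
  have M0: "M m \<ge> 0" for m
    using B c c' d \<alpha> unfolding M_def \<Lambda>_def by (intro mult_nonneg_nonneg divide_nonneg_nonneg zero_le_power add_nonneg_nonneg) auto
  have ub: "cmod (u i z) \<le> (\<Sum>m. M m)" if "i < n" "z \<in> strip d" for i z
    unfolding u_def using DM[OF that] by (intro norm_suminf_le sM) auto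
  show ?thesis by (rule that[of "\<Sum>m. M m" u]) (use deriv u0 ub M0 sM in \<open>auto intro: suminf_nonneg\<close>)
qed

text \<open>Feeding the crude bound \<open>B\<close> into the equation m times yields B (C |s|)^m /
  m!, which tends to 0. The sign \<sigma> covers both directions from 0 in one induction.\<close>

lemma linear_ode_real_zero:
  fixes v :: "nat \<Rightarrow> real \<Rightarrow> complex" and k :: "nat \<Rightarrow> nat \<Rightarrow> real \<Rightarrow> complex"
  assumes c: "c \<ge> 0"
    and v: "\<And>i s. i < n \<Longrightarrow> (v i has_vector_derivative (\<Sum>l<n. k i l s * v l s)) (at s)"
    and kb: "\<And>i l s. i < n \<Longrightarrow> l < n \<Longrightarrow> cmod (k i l s) \<le> c"
    and v0: "\<And>i. i < n \<Longrightarrow> v i 0 = 0"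
    and vb: "\<And>i s. i < n \<Longrightarrow> cmod (v i s) \<le> B"
    and i: "i < n"
  shows "v i s = 0"
proof -
  define C where "C = of_nat n * c"
  have C: "C \<ge> 0" using c by (simp add: C_def)
  have B: "B \<ge> 0" using vb[OF i, of 0] norm_ge_zero[of "v i 0"] by linarith
  have bnd: "cmod (v i (\<sigma> * T)) \<le> B * (C * T) ^ m / fact m" if "i < n" "T \<ge> 0" "\<bar>\<sigma>\<bar> = 1" for i T m \<sigma>
    using that
  proof (induction m arbitrary: i T)
    case 0
    then show ?case using vb by simp
  next
    case (Suc m)
    show ?case
    proof (rule taylor_majorant_step[where g = "\<lambda>s. v i (\<sigma> * s)" and L = "\<lambda>s. C * s" and L' = "\<lambda>_. C"])
      fix s assume s: "0 \<le> s" "s \<le> T"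
      show "((\<lambda>s. v i (\<sigma> * s)) has_vector_derivative \<sigma> *\<^sub>R (\<Sum>l<n. k i l (\<sigma> * s) * v l (\<sigma> * s))) (at s)"
        using vector_diff_chain_at[of "\<lambda>s. \<sigma> * s" \<sigma> s "v i" "\<Sum>l<n. k i l (\<sigma> * s) * v l (\<sigma> * s)"] v[OF Suc.prems(1)]
        by (auto simp: o_def has_real_derivative_iff_has_vector_derivative[symmetric] intro!: derivative_eq_intros)
      have "cmod (\<sigma> *\<^sub>R (\<Sum>l<n. k i l (\<sigma> * s) * v l (\<sigma> * s))) = cmod (\<Sum>l<n. k i l (\<sigma> * s) * v l (\<sigma> * s))"
        using Suc.prems(3) by simp
      also have "\<dots> \<le> (\<Sum>l<n. c * (B * (C * s) ^ m / fact m))"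
      proof (rule sum_norm_le)
        fix l assume "l \<in> {..<n}"
        then show "cmod (k i l (\<sigma> * s) * v l (\<sigma> * s)) \<le> c * (B * (C * s) ^ m / fact m)"
          unfolding norm_mult using kb[OF Suc.prems(1)] Suc.IH[of l s] s c Suc.prems(3) by (intro mult_mono) auto
      qed
      also have "\<dots> = C * (B * (C * s) ^ m / fact m)" by (simp add: C_def)
      finally show "cmod (\<sigma> *\<^sub>R (\<Sum>l<n. k i l (\<sigma> * s) * v l (\<sigma> * s))) \<le> C * (B * (C * s) ^ m / fact m)" .
    qed (use Suc.prems v0 in \<open>auto intro!: derivative_eq_intros\<close>)
  qed
  have "(\<lambda>m. inverse (fact m) * (C * \<bar>s\<bar>) ^ m) \<longlonglongrightarrow> 0"
    by (rule summable_LIMSEQ_zero[OF summable_exp])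
  from tendsto_mult_left[OF this, of B] have lim: "(\<lambda>m. B * (C * \<bar>s\<bar>) ^ m / fact m) \<longlonglongrightarrow> 0"
    by (simp add: field_simps)
  have "cmod (v i s) \<le> 0"
  proof (rule LIMSEQ_le_const[OF lim])
    have "\<bar>if s \<ge> 0 then 1 else - 1 :: real\<bar> = 1" "(if s \<ge> 0 then 1 else - 1) * \<bar>s\<bar> = s" by auto
    then have "cmod (v i s) \<le> B * (C * \<bar>s\<bar>) ^ m / fact m" for m
      using bnd[OF i, of "\<bar>s\<bar>" "if s \<ge> 0 then 1 else - 1" m] by simp
    then show "\<exists>N. \<forall>m\<ge>N. cmod (v i s) \<le> B * (C * \<bar>s\<bar>) ^ m / fact m" by blast
  qed
  then show ?thesis by simp
qed

section \<open>Sinc indefinite integration\<close>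

text \<open>The contour formula starts at - M h, where the \<open>J_SE\<close> terms do not vanish;
  this shows that they disappear as M grows. \<open>J_SE j h\<close> at - M h is of order h / (1 + M
  + j), which is not small for j near - M, but there \<open>F\<close> is. Since h is fixed in the
  limit, \<open>K\<close> may depend on it.\<close>

lemma sinc_boundary_sum:
  fixes F :: "complex \<Rightarrow> complex"
  assumes h: "h > 0" and \<alpha>: "\<alpha> > 0" and C: "C \<ge> 0"
    and Fb: "\<And>j::int. cmod (F (of_real (of_int j * h))) \<le> C * exp (- \<alpha> * (h * \<bar>of_int j\<bar>))"
  obtains K where "K \<ge> 0" "\<And>M. cmod (\<Sum>j = - int M..int M. F (of_real (of_int j * h)) * of_real (J_SE j h (ereal (- (of_nat M * h)))))
     \<le> K / (1 + of_nat M)"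
proof -
  obtain B where B: "B \<ge> 1" "\<And>k. \<bar>sigma_SE k - (if k > 0 then 1 else 0)\<bar> \<le> B / (1 + \<bar>of_int k\<bar>)"
    using sigma_SE_bound by blast
  \<comment> \<open>Half of the decay rate pays for the factor 1 + |j|; the other half keeps the sum
    over j bounded.\<close>
  define \<beta> where "\<beta> = \<alpha> / 2"
  have \<beta>: "\<beta> > 0" using \<alpha> by (simp add: \<beta>_def)
  define K1 where "K1 = 1 + 1 / (\<beta> * h)"
  have growth: "(1 + t) * exp (- \<alpha> * (h * t)) \<le> K1 * exp (- \<beta> * (h * t))" if "t \<ge> 0" for t
  proof -
    have bh: "\<beta> * h > 0" using \<beta> h by simp
    have "\<beta> * (h * t) \<le> exp (\<beta> * (h * t))" using exp_ge_add_one_self[of "\<beta> * (h * t)"] by linarith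
    then have "t \<le> 1 / (\<beta> * h) * exp (\<beta> * (h * t))" using bh by (simp add: field_simps)
    moreover have "1 \<le> exp (\<beta> * (h * t))" using that mult_nonneg_nonneg[of "\<beta> * h" t] bh by (simp add: mult.assoc)
    moreover have "K1 * exp (\<beta> * (h * t)) = exp (\<beta> * (h * t)) + 1 / (\<beta> * h) * exp (\<beta> * (h * t))"
      unfolding K1_def by (simp only: distrib_right mult_1_left)
    ultimately have "1 + t \<le> K1 * exp (\<beta> * (h * t))" by linarith
    then have "(1 + t) * exp (- \<alpha> * (h * t)) \<le> (K1 * exp (\<beta> * (h * t))) * exp (- \<alpha> * (h * t))"
      by (intro mult_right_mono) auto
    also have "\<dots> = K1 * exp (\<beta> * (h * t) + - \<alpha> * (h * t))" by (simp only: exp_add mult.assoc)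
    also have "\<beta> * (h * t) + - \<alpha> * (h * t) = - \<beta> * (h * t)" by (simp add: \<beta>_def algebra_simps)
    finally show ?thesis .
  qed
  have K1: "K1 \<ge> 0" using \<beta> h by (simp add: K1_def)
  show ?thesis
  proof (rule that[of "C * B * K1 * (h + 2 / \<beta>)"])
    show "C * B * K1 * (h + 2 / \<beta>) \<ge> 0" using C B h \<beta> K1 by simp
    fix M
    have "cmod (F (of_real (of_int j * h)) * of_real (J_SE j h (ereal (- (of_nat M * h)))))
        \<le> C * B * K1 / (1 + of_nat M) * (h * exp (- \<beta> * (h * \<bar>of_int j\<bar>)))" if j: "j \<in> {- int M..int M}" for j
    proof -
      have "J_SE j h (ereal (- (of_nat M * h))) = h * sigma_SE (- int M - j)"
        using h by (simp add: J_SE_def sigma_SE_def)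
      moreover have "\<bar>sigma_SE (- int M - j)\<bar> \<le> B / (1 + \<bar>of_int (- int M - j)\<bar>)"
        using B(2)[of "- int M - j"] j by (auto split: if_splits)
      moreover have "\<bar>real_of_int (- int M - j)\<bar> = of_nat M + of_int j" using j by auto
      moreover from calculation have "h * \<bar>sigma_SE (- int M - j)\<bar> \<le> h * (B / (1 + of_nat M + of_int j))"
        using h by (intro mult_left_mono) (auto simp: add_ac)
      ultimately have J: "\<bar>J_SE j h (ereal (- (of_nat M * h)))\<bar> \<le> h * (B / (1 + of_nat M + of_int j))"
        using h by (simp add: abs_mult)
      define t where "t = \<bar>real_of_int j\<bar>"
      have t: "0 \<le> t" "t \<le> of_nat M" "- t \<le> of_int j" using j by (auto simp: t_def)
      have pos: "1 + real M + of_int j > 0" using t by linarith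
      \<comment> \<open>Moves the decay from the distance to - M onto \<open>M\<close> itself, at
        the price of 1 + t: (1 + t)(1 + M - t) = 1 + M + t (M - t).\<close>
      have "0 \<le> t * (of_nat M - t)" using t by (intro mult_nonneg_nonneg) auto
      then have "1 + real M \<le> (1 + t) * (1 + of_nat M - t)" by (simp add: algebra_simps)
      also have "\<dots> \<le> (1 + t) * (1 + of_nat M + of_int j)" using t by (intro mult_left_mono) auto
      finally have "1 / (1 + of_nat M + of_int j) \<le> (1 + t) / (1 + of_nat M)"
        using pos by (simp add: field_simps)
      then have "h * (B * (1 / (1 + of_nat M + of_int j))) \<le> h * (B * ((1 + t) / (1 + of_nat M)))"
        using h B by (intro mult_left_mono) auto
      with J have J: "\<bar>J_SE j h (ereal (- (of_nat M * h)))\<bar> \<le> h * (B * ((1 + t) / (1 + of_nat M)))" by simp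
      have "cmod (F (of_real (of_int j * h)) * of_real (J_SE j h (ereal (- (of_nat M * h)))))
          \<le> (C * exp (- \<alpha> * (h * t))) * (h * (B * ((1 + t) / (1 + of_nat M))))"
        unfolding norm_mult t_def using Fb[of j] J C h B by (intro mult_mono) (auto simp: t_def)
      also have "\<dots> = C * B / (1 + of_nat M) * h * ((1 + t) * exp (- \<alpha> * (h * t)))" by simp
      also have "\<dots> \<le> C * B / (1 + of_nat M) * h * (K1 * exp (- \<beta> * (h * t)))"
        using C B h growth[OF t(1)] by (intro mult_left_mono) auto
      also have "\<dots> = C * B * K1 / (1 + of_nat M) * (h * exp (- \<beta> * (h * \<bar>of_int j\<bar>)))" by (simp add: t_def)
      finally show ?thesis .
    qed
    then have "cmod (\<Sum>j = - int M..int M. F (of_real (of_int j * h)) * of_real (J_SE j h (ereal (- (of_nat M * h)))))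
        \<le> (\<Sum>j = - int M..int M. C * B * K1 / (1 + of_nat M) * (h * exp (- \<beta> * (h * \<bar>of_int j\<bar>))))"
      by (rule sum_norm_le)
    also have "\<dots> = C * B * K1 / (1 + of_nat M) * (\<Sum>j = - int M..int M. h * exp (- \<beta> * (h * \<bar>of_int j\<bar>)))"
      by (simp add: sum_distrib_left)
    also have "\<dots> \<le> C * B * K1 / (1 + of_nat M) * (h + 2 / \<beta>)"
      using C B K1 by (intro mult_left_mono sum_exp_int_le h \<beta>) auto
    finally show "cmod (\<Sum>j = - int M..int M. F (of_real (of_int j * h)) * of_real (J_SE j h (ereal (- (of_nat M * h)))))
       \<le> C * B * K1 * (h + 2 / \<beta>) / (1 + of_nat M)" by simp
  qed
qed

text \<open>Since each \<open>J_SE\<close> is of order h, the discarded tail is a Riemann sum; the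
  bound depends on neither \<open>M\<close> nor \<open>x\<close>, so it survives the limit in
  \<open>M\<close>.\<close>

lemma sinc_truncation:
  fixes F :: "complex \<Rightarrow> complex"
  assumes h: "h > 0" and \<alpha>: "\<alpha> > 0" and C: "C \<ge> 0" and B: "B \<ge> 0" "\<And>j. \<bar>J_SE j h x\<bar> \<le> B * h"
    and Fb: "\<And>j::int. cmod (F (of_real (of_int j * h))) \<le> C * exp (- \<alpha> * (h * \<bar>of_int j\<bar>))"
    and NM: "N \<le> M"
  shows "cmod ((\<Sum>j = - int M..int M. F (of_real (of_int j * h)) * of_real (J_SE j h x)) -
      (\<Sum>j = - int N..int N. F (of_real (of_int j * h)) * of_real (J_SE j h x))) \<le> 2 * B * C / \<alpha> * exp (- \<alpha> * (h * of_nat N))"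
proof -
  define f where "f = (\<lambda>j::int. F (of_real (of_int j * h)) * of_real (J_SE j h x))"
  have f: "cmod (f j) \<le> B * C * (h * exp (- \<alpha> * (h * \<bar>of_int j\<bar>)))" for j
  proof -
    have "cmod (f j) \<le> (C * exp (- \<alpha> * (h * \<bar>of_int j\<bar>))) * (B * h)"
      unfolding f_def norm_mult using Fb[of j] B C h by (intro mult_mono) auto
    then show ?thesis by (simp add: ac_simps)
  qed
  have "{1..M} = {1..N} \<union> {Suc N..M}" "{1..N} \<inter> {Suc N..M} = {}" using NM by auto
  then have "(\<Sum>j = 1..M. f (int j) + f (- int j)) = (\<Sum>j = 1..N. f (int j) + f (- int j)) + (\<Sum>j = Suc N..M. f (int j) + f (- int j))"
    by (simp add: sum.union_disjoint)
  then have "(\<Sum>j = - int M..int M. f j) - (\<Sum>j = - int N..int N. f j) = (\<Sum>j = Suc N..M. f (int j) + f (- int j))"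
    unfolding sum_int_symmetric by simp
  also have "cmod \<dots> \<le> (\<Sum>j = Suc N..M. 2 * B * C * (h * exp (- \<alpha> * (h * of_nat j))))"
  proof (rule sum_norm_le)
    fix j
    show "cmod (f (int j) + f (- int j)) \<le> 2 * B * C * (h * exp (- \<alpha> * (h * of_nat j)))"
      using norm_triangle_ineq[of "f (int j)" "f (- int j)"] f[of "int j"] f[of "- int j"] by simp
  qed
  also have "\<dots> = 2 * B * C * (\<Sum>j = Suc N..M. h * exp (- \<alpha> * (h * of_nat j)))"
    by (simp add: sum_distrib_left)
  also have "\<dots> \<le> 2 * B * C * (exp (- \<alpha> * (h * of_nat N)) / \<alpha>)"
    using B C by (intro mult_left_mono sum_exp_tail_le h \<alpha>) auto
  finally show ?thesis by (simp add: f_def)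
qed

lemma sinc_indefinite_integration:
  fixes F U :: "complex \<Rightarrow> complex" and x h d C \<alpha> B :: real and N :: nat
  assumes F: "F holomorphic_on strip d" and d: "d > 0" and h: "0 < h" "h \<le> pi * d / 4"
    and Fb: "\<And>z. z \<in> strip d \<Longrightarrow> cmod (F z) \<le> C * exp (- \<alpha> * \<bar>Re z\<bar>)" and C: "C \<ge> 0" and \<alpha>: "\<alpha> > 0"
    and U: "\<And>s::real. (U has_field_derivative F (of_real s)) (at (of_real s))"
    and lim: "((\<lambda>s::real. U (of_real (- s))) \<longlongrightarrow> r) at_top"
    and B: "B \<ge> 0" "\<And>j u. \<bar>J_SE j h u\<bar> \<le> B * h"
  shows "cmod (U (of_real x) - r - (\<Sum>j = - int N..int N. F (of_real (of_int j * h)) * of_real (J_SE j h (ereal x))))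
    \<le> 48 * C / \<alpha> * exp (- (pi * d / h)) + 2 * B * C / \<alpha> * exp (- \<alpha> * (h * of_nat N))"
    (is "cmod ?lhs \<le> _")
proof -
  define p where "p = pi / h"
  \<comment> \<open>The contour stays h / pi inside the strip, so p e = p d - 1 and
    \<open>exp (p * e)\<close> falls short of \<open>exp (p * d)\<close> only by the factor exp 1.
    The condition on h makes p e at least 3.\<close>
  define e where "e = d - 1 / p"
  have p: "p > 0" using h by (simp add: p_def)
  have pd: "p * d \<ge> 4" using h by (simp add: p_def field_simps)
  have pe: "p * e = p * d - 1" using p by (simp add: e_def field_simps)
  have e: "0 < e" "e < d"
  proof -
    have "0 < p * e" using pe pd by simp
    then show "0 < e" using p by (simp add: zero_less_mult_iff)
    show "e < d" using p by (simp add: e_def)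
  qed
  define H where "H = 2 * C * ((2 + pi) / (p * e)) / (\<alpha> * sinh (p * e))"
  \<comment> \<open>48 = 2 * 2 * 12: the 2 in \<open>H\<close>, then (2 + pi) / (p e) \<le> 6 / 3,
    then 3 * 4 from exp 1 \<le> 3 and exp (p e) \<le> 4 sinh (p e).\<close>
  have H: "H \<le> 48 * C / \<alpha> * exp (- (p * d))"
  proof -
    have pe3: "p * e \<ge> 3" using pe pd by simp
    have "exp (p * d) \<le> 12 * sinh (p * e)"
    proof -
      have "exp (p * d) = exp 1 * exp (p * e)" by (simp add: exp_add[symmetric] pe)
      also have "\<dots> \<le> 3 * exp (p * e)" using exp_le by (intro mult_right_mono) auto
      finally have 1: "exp (p * d) \<le> 3 * exp (p * e)" .
      define E where "E = exp (- (p * e))"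
      have "E \<le> 1" using pe3 by (simp add: E_def)
      moreover define X where "X = exp (p * e)"
      moreover have "X \<ge> 2" using exp_ge_add_one_self[of "p * e"] pe3 unfolding X_def by linarith
      ultimately have "X \<le> 4 * ((X - E) / 2)" by simp
      then have "exp (p * e) \<le> 4 * sinh (p * e)" by (simp add: sinh_def E_def X_def)
      with 1 show ?thesis by linarith
    qed
    then have "1 / sinh (p * e) \<le> 12 * exp (- (p * d))"
      using pe3 by (simp add: exp_minus field_simps)
    moreover have "(2 + pi) / (p * e) \<le> 2"
    proof -
      have "(2 + pi) / (p * e) \<le> 6 / 3" using pe3 pi_less_4 by (intro frac_le) auto
      then show ?thesis by simp
    qed
    ultimately have "(2 + pi) / (p * e) * (1 / sinh (p * e)) \<le> 2 * (12 * exp (- (p * d)))"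
      using pe3 by (intro mult_mono) auto
    then have "2 * C / \<alpha> * ((2 + pi) / (p * e) * (1 / sinh (p * e))) \<le> 2 * C / \<alpha> * (2 * (12 * exp (- (p * d))))"
      using C \<alpha> by (intro mult_left_mono) auto
    then show ?thesis by (simp add: H_def mult_ac)
  qed
  define S where "S = (\<lambda>M u. \<Sum>j = - int M..int M. F (of_real (of_int j * h)) * of_real (J_SE j h (ereal u)))"
  have Fb': "cmod (F (of_real (of_int j * h))) \<le> C * exp (- \<alpha> * (h * \<bar>of_int j\<bar>))" for j :: int
    using Fb[of "of_real (of_int j * h)"] d h by (simp add: strip_def abs_mult mult.commute)
  obtain K where K: "K \<ge> 0" "\<And>M. cmod (S M (- (of_nat M * h))) \<le> K / (1 + of_nat M)"
    using sinc_boundary_sum[OF h(1) \<alpha> C Fb'] unfolding S_def by blast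
  define T where "T = 2 * B * C / \<alpha> * exp (- \<alpha> * (h * of_nat N))"
  \<comment> \<open>Everything that depends on \<open>M\<close>: the vertical sides, the distance of
    \<open>U (- M h)\<close> from its limit, and the boundary sum. All three tend to 0.\<close>
  define rest where "rest = (\<lambda>M::nat. 8 * of_nat M * C * e * exp (- \<alpha> * (of_nat M * h)) + cmod (U (of_real (- (of_nat M * h))) - r) + K / (1 + of_nat M))"
  have "rest \<longlonglongrightarrow> 0 + 0 + 0"
    unfolding rest_def
  proof (intro tendsto_add)
    have "(\<lambda>M::nat. real M * exp (- c * real M)) \<longlonglongrightarrow> 0" if "c > 0" for c
      using that by real_asymp
    from tendsto_mult_left[OF this[of "\<alpha> * h"], of "8 * C * e"] \<alpha> h
    show "(\<lambda>M::nat. 8 * of_nat M * C * e * exp (- \<alpha> * (of_nat M * h))) \<longlonglongrightarrow> 0" by (simp add: ac_simps)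
    have "filterlim (\<lambda>M::nat. of_nat M * h) at_top sequentially" using h by real_asymp
    from filterlim_compose[OF lim this] have "(\<lambda>M::nat. U (of_real (- (of_nat M * h)))) \<longlonglongrightarrow> r" .
    then show "(\<lambda>M::nat. cmod (U (of_real (- (of_nat M * h))) - r)) \<longlonglongrightarrow> 0"
      by (intro tendsto_norm_zero LIM_zero)
    show "(\<lambda>M::nat. K / (1 + of_nat M)) \<longlonglongrightarrow> 0" by real_asymp
  qed
  then have lim: "(\<lambda>M. H + T + rest M) \<longlonglongrightarrow> H + T" using tendsto_add[OF tendsto_const[of "H + T"], of rest 0 sequentially] by simp
  have "cmod ?lhs \<le> H + T"
  proof (rule LIMSEQ_le_const[OF lim])
    obtain M0 where M0: "\<bar>x\<bar> / h < of_nat M0" using reals_Archimedean2 by blast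
    have "cmod ?lhs \<le> H + T + rest M" if M: "M \<ge> max N M0" for M
    proof -
      have "\<bar>x\<bar> < of_nat M0 * h" using M0 h by (simp add: field_simps)
      also have "\<dots> \<le> of_nat M * h" using M h by (intro mult_right_mono) auto
      finally have x: "- (of_nat M * h) < x" "x \<le> of_nat M * h" by auto
      define Err where "Err = U (of_real x) - U (of_real (- (of_nat M * h))) - (\<Sum>j = - int M..int M. F (of_real (of_int j * h)) *
          of_real (J_SE j h (ereal x) - J_SE j h (ereal (- (of_nat M * h)))))"
      have 1: "cmod Err \<le> H + 8 * of_nat M * C * e * exp (- \<alpha> * (of_nat M * h))"
        using sinc_error_rectangle_bound[OF F e h(1) Fb C \<alpha> U x] unfolding Err_def H_def p_def by simp
      have 2: "cmod (S M x - S N x) \<le> T"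
        unfolding S_def T_def using sinc_truncation[OF h(1) \<alpha> C B Fb'] M by auto
      have "?lhs = Err + (U (of_real (- (of_nat M * h))) - r) + (S M x - S N x) - S M (- (of_nat M * h))"
        by (simp add: Err_def S_def algebra_simps sum_subtractf)
      also have "cmod \<dots> \<le> cmod Err + cmod (U (of_real (- (of_nat M * h))) - r) + cmod (S M x - S N x) + cmod (S M (- (of_nat M * h)))"
        by (intro order_trans[OF norm_triangle_ineq4] order_trans[OF norm_triangle_ineq] add_mono order_refl)
      also have "\<dots> \<le> H + T + rest M" using 1 2 K(2)[of M] by (simp add: rest_def)
      finally show ?thesis .
    qed
    then show "\<exists>M. \<forall>m\<ge>M. cmod ?lhs \<le> H + T + rest m" by blast
  qed
  then show ?thesis using H by (simp add: T_def p_def)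
qed

section \<open>The SE transformation\<close>

text \<open>The real part of cosh (z / 2) is cosh (Re z / 2) cos (Im z / 2). The condition d < pi
  keeps the cosine positive, that is, the strip away from the poles of tanh (z / 2) at odd multiples
  of pi i.\<close>

lemma cosh_half_lower_bound:
  assumes d: "0 < d" "d < pi" and z: "z \<in> strip d"
  shows "cos (d / 2) * exp (\<bar>Re z\<bar> / 2) / 2 \<le> cmod (cosh (z / 2))"
proof -
  have Re: "Re (cosh (z / 2)) = cosh (Re z / 2) * cos (Im z / 2)"
    by (simp add: cosh_conv_cos Re_cos cosh_field_def)
  have 1: "cos (d / 2) \<le> cos (Im z / 2)"
  proof -
    have "cos (d / 2) \<le> cos \<bar>Im z / 2\<bar>" using z d by (intro cos_monotone_0_pi_le) (auto simp: strip_def)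
    then show ?thesis by (simp only: cos_abs_real)
  qed
  have 2: "exp (\<bar>Re z\<bar> / 2) / 2 \<le> cosh (Re z / 2)"
    by (cases "Re z \<ge> 0") (auto simp: cosh_field_def)
  have "cos (d / 2) > 0" using d by (intro cos_gt_zero_pi) auto
  then have "exp (\<bar>Re z\<bar> / 2) / 2 * cos (d / 2) \<le> Re (cosh (z / 2))"
    unfolding Re by (intro mult_mono 1 2) auto
  also have "\<dots> \<le> cmod (cosh (z / 2))" by (rule complex_Re_le_cmod)
  finally show ?thesis by (simp add: mult.commute)
qed

lemma cosh_half_nonzero:
  assumes "0 < d" "d < pi" "z \<in> strip d"
  shows "cosh (z / 2) \<noteq> 0"
proof -
  have "cos (d / 2) > 0" using assms by (intro cos_gt_zero_pi) auto
  then have "0 < cos (d / 2) * exp (\<bar>Re z\<bar> / 2) / 2" by simp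
  then show ?thesis using cosh_half_lower_bound[OF assms] by auto
qed

lemma one_minus_tanh_squared:
  fixes w :: complex
  assumes "cosh w \<noteq> 0"
  shows "1 - (tanh w)\<^sup>2 = 1 / (cosh w)\<^sup>2"
proof -
  have "1 - (tanh w)\<^sup>2 = ((cosh w)\<^sup>2 - (sinh w)\<^sup>2) / (cosh w)\<^sup>2"
    using assms by (simp add: tanh_def power_divide diff_divide_distrib)
  then show ?thesis by (simp only: hyperbolic_pythagoras)
qed

lemma psi_SE_derivative:
  assumes "cosh (z / 2) \<noteq> 0"
  shows "(psi_SE a b has_field_derivative (of_real (b - a) / (2 * cosh (z / 2))\<^sup>2)) (at z)"
proof -
  note eq = one_minus_tanh_squared[OF assms]
  have "((\<lambda>z. of_real ((b - a) / 2) * tanh (z / 2) + of_real ((b + a) / 2)) has_field_derivative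
      (of_real ((b - a) / 2) * ((1 - (tanh (z / 2))\<^sup>2) * (1 / 2)))) (at z)"
    using assms by (auto intro!: derivative_eq_intros)
  then show ?thesis
    unfolding eq psi_SE_def[abs_def] by (simp add: power_mult_distrib)
qed

text \<open>\<open>psi_SE\<close> solves the logistic equation (b - a) psi' = Q(psi). Hence f(psi)
  psi' = (f Q)(psi) / (b - a): the change of variables supplies the factor that tames the end point
  singularities of f.\<close>

lemma Q_fun_psi_SE:
  assumes "cosh (z / 2) \<noteq> 0"
  shows "Q_fun a b (psi_SE a b z) = of_real (b - a) * deriv (psi_SE a b) z"
proof -
  note eq = one_minus_tanh_squared[OF assms]
  have "Q_fun a b (psi_SE a b z) = (of_real (b - a))\<^sup>2 / 4 * (1 - (tanh (z / 2))\<^sup>2)"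
    unfolding Q_fun_def psi_SE_def by (simp add: power2_eq_square field_simps)
  also have "\<dots> = of_real (b - a) * (of_real (b - a) / (2 * cosh (z / 2))\<^sup>2)"
    unfolding eq by (simp add: power2_eq_square)
  finally show ?thesis unfolding DERIV_imp_deriv[OF psi_SE_derivative[OF assms]] .
qed

lemma psi_SE_deriv_bound:
  assumes d: "0 < d" "d < pi" and z: "z \<in> strip d" and ab: "a < b"
  shows "cmod (deriv (psi_SE a b) z) \<le> (b - a) / (cos (d / 2))\<^sup>2 * exp (- \<bar>Re z\<bar>)"
proof -
  have c: "cos (d / 2) > 0" using d by (intro cos_gt_zero_pi) auto
  have "(cos (d / 2) * exp (\<bar>Re z\<bar> / 2))\<^sup>2 \<le> (cmod (2 * cosh (z / 2)))\<^sup>2"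
    using cosh_half_lower_bound[OF d z] c by (intro power_mono) (auto simp: norm_mult)
  also have "(cos (d / 2) * exp (\<bar>Re z\<bar> / 2))\<^sup>2 = (cos (d / 2))\<^sup>2 * exp \<bar>Re z\<bar>"
    by (simp add: power_mult_distrib exp_double[symmetric])
  finally have "(b - a) / (cmod (2 * cosh (z / 2)))\<^sup>2 \<le> (b - a) / ((cos (d / 2))\<^sup>2 * exp \<bar>Re z\<bar>)"
    using ab c by (intro divide_left_mono) (auto simp: cosh_half_nonzero[OF d z])
  moreover have "cmod (of_real (b - a) / (2 * cosh (z / 2))\<^sup>2) = (b - a) / (cmod (2 * cosh (z / 2)))\<^sup>2"
    using ab by (simp only: norm_divide norm_power norm_of_real)
  moreover have "(b - a) / ((cos (d / 2))\<^sup>2 * exp \<bar>Re z\<bar>) = (b - a) / (cos (d / 2))\<^sup>2 * exp (- \<bar>Re z\<bar>)"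
    by (simp add: exp_minus inverse_eq_divide)
  ultimately show ?thesis
    unfolding DERIV_imp_deriv[OF psi_SE_derivative[OF cosh_half_nonzero[OF d z]]] by (simp only:)
qed

lemma L_space_transformed:
  assumes ab: "a < b" and d: "0 < d" "d < pi" and \<alpha>: "\<alpha> > 0"
    and f: "(\<lambda>z. f z * Q_fun a b z) \<in> L_space a b \<alpha> (psi_SE a b ` strip d)"
  shows "(\<lambda>z. f (psi_SE a b z) * deriv (psi_SE a b) z) holomorphic_on strip d"
    and "\<exists>c\<ge>0. \<forall>z\<in>strip d. cmod (f (psi_SE a b z) * deriv (psi_SE a b) z) \<le> c * exp (- \<alpha> * \<bar>Re z\<bar>)"
proof -
  define g where "g = (\<lambda>z. f z * Q_fun a b z)"
  have eq: "f (psi_SE a b z) * deriv (psi_SE a b) z = g (psi_SE a b z) / of_real (b - a)" if "z \<in> strip d" for z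
    unfolding g_def Q_fun_psi_SE[OF cosh_half_nonzero[OF d that]] using ab by (simp del: of_real_diff)
  have psi: "psi_SE a b holomorphic_on strip d"
    using psi_SE_derivative[OF cosh_half_nonzero[OF d]] by (rule holomorphic_on_stripI)
  have "g analytic_on psi_SE a b ` strip d" using f by (simp add: g_def L_space_def)
  then have "(g \<circ> psi_SE a b) analytic_on strip d"
    using psi strip_open_convex(1) by (intro analytic_on_compose) (simp_all add: analytic_on_open)
  then have "(\<lambda>z. g (psi_SE a b z) / of_real (b - a)) holomorphic_on strip d"
    using ab by (intro holomorphic_intros) (auto simp: o_def dest: analytic_imp_holomorphic)
  then show "(\<lambda>z. f (psi_SE a b z) * deriv (psi_SE a b) z) holomorphic_on strip d"
    by (rule holomorphic_transform) (simp add: eq)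
  obtain L where L: "\<And>z. z \<in> psi_SE a b ` strip d \<Longrightarrow> cmod (g z) \<le> L * cmod (Q_fun a b z) powr \<alpha>"
    using f by (auto simp: g_def L_space_def)
  have c: "cos (d / 2) > 0" using d by (intro cos_gt_zero_pi) auto
  \<comment> \<open>Bounds |Q(psi(z))| exp |Re z|: one factor b - a is that of
    \<open>Q_fun_psi_SE\<close>, the rest is the bound of psi'. Raising to the power \<alpha>
    produces the decay rate.\<close>
  define K where "K = (b - a) * ((b - a) / (cos (d / 2))\<^sup>2)"
  have K: "K > 0" using ab c by (simp add: K_def)
  have "cmod (f (psi_SE a b z) * deriv (psi_SE a b) z) \<le> \<bar>L\<bar> * K powr \<alpha> / (b - a) * exp (- \<alpha> * \<bar>Re z\<bar>)"
    if z: "z \<in> strip d" for z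
  proof -
    have "cmod (Q_fun a b (psi_SE a b z)) \<le> K * exp (- \<bar>Re z\<bar>)"
      unfolding Q_fun_psi_SE[OF cosh_half_nonzero[OF d z]] norm_mult K_def mult.assoc
      using psi_SE_deriv_bound[OF d z ab] ab by (intro mult_mono) (auto simp del: of_real_diff)
    then have "cmod (Q_fun a b (psi_SE a b z)) powr \<alpha> \<le> (K * exp (- \<bar>Re z\<bar>)) powr \<alpha>"
      using \<alpha> by (intro powr_mono2) auto
    also have "\<dots> = K powr \<alpha> * exp (- \<alpha> * \<bar>Re z\<bar>)"
      using K by (simp add: powr_mult exp_powr_real mult.commute)
    finally have Q: "cmod (Q_fun a b (psi_SE a b z)) powr \<alpha> \<le> K powr \<alpha> * exp (- \<alpha> * \<bar>Re z\<bar>)" .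
    have "cmod (g (psi_SE a b z)) \<le> L * cmod (Q_fun a b (psi_SE a b z)) powr \<alpha>" using L z by blast
    also have "\<dots> \<le> \<bar>L\<bar> * (K powr \<alpha> * exp (- \<alpha> * \<bar>Re z\<bar>))" using Q by (intro mult_mono) auto
    finally have "cmod (g (psi_SE a b z)) / (b - a) \<le> \<bar>L\<bar> * (K powr \<alpha> * exp (- \<alpha> * \<bar>Re z\<bar>)) / (b - a)"
      using ab by (intro divide_right_mono) auto
    then show ?thesis unfolding eq[OF z] using ab by (simp add: norm_divide del: of_real_diff)
  qed
  then show "\<exists>c\<ge>0. \<forall>z\<in>strip d. cmod (f (psi_SE a b z) * deriv (psi_SE a b) z) \<le> c * exp (- \<alpha> * \<bar>Re z\<bar>)"
    using ab by (intro exI[of _ "\<bar>L\<bar> * K powr \<alpha> / (b - a)"]) auto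
qed

lemma psi_SE_real:
  "psi_SE a b (of_real s) = of_real ((b - a) / 2 * tanh (s / 2) + (b + a) / 2)"
proof -
  have "tanh (of_real s / 2 :: complex) = of_real (tanh (s / 2))"
    by (simp add: tanh_def sinh_field_def cosh_field_def exp_of_real[symmetric])
  then show ?thesis by (simp add: psi_SE_def)
qed

lemma psi_SE_phi_SE:
  assumes "a < t" "t < b"
  shows "psi_SE a b (of_real (ln ((t - a) / (b - t)))) = of_real t"
proof -
  define s where "s = ln ((t - a) / (b - t))"
  have e: "exp (- s) = (b - t) / (t - a)" using assms by (simp add: s_def exp_minus)
  have "tanh (s / 2) = (1 - exp (- s)) / (1 + exp (- s))" by (simp add: tanh_real_altdef)
  also have "\<dots> = (2 * t - a - b) / (b - a)"
  proof -
    have "1 - exp (- s) = (2 * t - a - b) / (t - a)" "1 + exp (- s) = (b - a) / (t - a)"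
      unfolding e using assms by (simp_all add: field_simps)
    then show ?thesis using assms by simp
  qed
  finally have th: "tanh (s / 2) = (2 * t - a - b) / (b - a)" .
  have "c / 2 * (w / c) = w / 2" if "c \<noteq> 0" for c w :: real using that by simp
  from this[of "b - a" "2 * t - a - b"] assms
  have "(b - a) / 2 * ((2 * t - a - b) / (b - a)) = (2 * t - a - b) / 2" by linarith
  then have "(b - a) / 2 * tanh (s / 2) + (b + a) / 2 = t" unfolding th by (simp add: field_simps)
  then show ?thesis unfolding s_def[symmetric] psi_SE_real by simp
qed

lemma psi_SE_real_in:
  assumes "a < b"
  shows "Re (psi_SE a b (of_real s)) \<in> {a<..<b}"
proof -
  have "- 1 < tanh (s / 2)" "tanh (s / 2) < 1" using tanh_real_bounds[of "s / 2"] by simp_all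
  then have "(b - a) / 2 * (- 1) < (b - a) / 2 * tanh (s / 2)" "(b - a) / 2 * tanh (s / 2) < (b - a) / 2 * 1"
    using assms by (intro mult_strict_left_mono; simp)+
  moreover have "Re (psi_SE a b (of_real s)) = (b - a) / 2 * tanh (s / 2) + (b + a) / 2"
    unfolding psi_SE_real by simp
  ultimately show ?thesis by (simp add: field_simps)
qed

lemma psi_SE_real_limits:
  "((\<lambda>s. Re (psi_SE a b (of_real s))) \<longlongrightarrow> b) at_top"
  "((\<lambda>s. Re (psi_SE a b (of_real (- s)))) \<longlongrightarrow> a) at_top"
proof -
  have "((\<lambda>s. (b - a) / 2 * tanh (s / 2) + (b + a) / 2) \<longlongrightarrow> (b - a) / 2 * 1 + (b + a) / 2) at_top"
    by (intro tendsto_intros filterlim_compose[OF tanh_real_at_top]) real_asymp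
  moreover have "((\<lambda>s. (b - a) / 2 * tanh (- s / 2) + (b + a) / 2) \<longlongrightarrow> (b - a) / 2 * (- 1) + (b + a) / 2) at_top"
    by (intro tendsto_intros filterlim_compose[OF tanh_real_at_bot]) real_asymp
  ultimately show "((\<lambda>s. Re (psi_SE a b (of_real s))) \<longlongrightarrow> b) at_top"
    "((\<lambda>s. Re (psi_SE a b (of_real (- s)))) \<longlongrightarrow> a) at_top"
    unfolding psi_SE_real by (simp_all add: field_simps)
qed

section \<open>The linear system\<close>

lemma unique_solution_if_kernel_trivial:
  fixes A :: "complex mat"
  assumes A: "A \<in> carrier_mat k k" and b: "b \<in> carrier_vec k"
    and ker: "\<And>v. v \<in> carrier_vec k \<Longrightarrow> A *\<^sub>v v = 0\<^sub>v k \<Longrightarrow> v = 0\<^sub>v k"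
  shows "\<exists>!Y. Y \<in> carrier_vec k \<and> A *\<^sub>v Y = b"
proof -
  have "det A \<noteq> 0" using det_0_iff_vec_prod_zero_field[OF A] ker by blast
  then have "A \<in> Units (ring_mat TYPE(complex) k ())" by (rule det_non_zero_imp_unit[OF A])
  then obtain B where B: "B \<in> carrier_mat k k" "B * A = 1\<^sub>m k" "A * B = 1\<^sub>m k"
    by (auto simp: Units_def ring_mat_simps)
  show ?thesis
  proof (rule ex1I)
    show "B *\<^sub>v b \<in> carrier_vec k \<and> A *\<^sub>v (B *\<^sub>v b) = b"
      using A B b by (simp add: assoc_mult_mat_vec[symmetric])
    fix Y assume "Y \<in> carrier_vec k \<and> A *\<^sub>v Y = b"
    then show "Y = B *\<^sub>v b" using A B assoc_mult_mat_vec[OF B(1) A, of Y] by auto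
  qed
qed

lemma block_index_less:
  assumes "i < n" "p < (m::nat)"
  shows "i * m + p < n * m"
proof -
  have "i * m + p < Suc i * m" using assms by simp
  also have "\<dots> \<le> n * m" using assms by (intro mult_le_mono1) simp
  finally show ?thesis .
qed

lemma sum_blocks: "(\<Sum>P = 0..<n * (m::nat). f P) = (\<Sum>l<n. \<Sum>q<m. f (l * m + q))"
proof (induction n)
  case (Suc n)
  have "(\<Sum>P = 0..<n * m + m. f P) = (\<Sum>P = 0..<n * m. f P) + (\<Sum>P = n * m..<n * m + m. f P)"
    by (rule sum.atLeastLessThan_concat[symmetric]) auto
  also have "(\<Sum>P = n * m..<n * m + m. f P) = (\<Sum>q<m. f (n * m + q))"
    using sum.atLeastLessThan_shift_0[of f "n * m" "n * m + m"] by (simp add: atLeast0LessThan)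
  finally show ?case by (simp add: Suc add.commute)
qed simp

lemma quad_SE_carrier: "quad_SE a b h N n \<in> carrier_mat (n * (2 * N + 1)) (n * (2 * N + 1))"
  by (rule carrier_matI) (simp_all add: quad_SE_def kronecker_def I_minus_def D_SE_def mat_diag_def)

lemma K_SE_carrier: "K_SE a b h N n k \<in> carrier_mat (n * (2 * N + 1)) (n * (2 * N + 1))"
  by (rule carrier_matI) (simp_all add: K_SE_def square_blocks_def)

lemma quad_SE_mult_vec:
  assumes Z: "Z \<in> carrier_vec (n * (2 * N + 1))" and i: "i < n" and p: "p < 2 * N + 1"
  shows "(quad_SE a b h N n *\<^sub>v Z) $ (i * (2 * N + 1) + p) =
    (\<Sum>q<2 * N + 1. of_real (h * sigma_SE (ix N p - ix N q)) * (weight_SE a b h (ix N q) * Z $ (i * (2 * N + 1) + q)))"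
proof -
  define m where "m = 2 * N + 1"
  define T where "T = of_real h \<cdot>\<^sub>m (I_minus N * D_SE a b h N)"
  have m: "m > 0" by (simp add: m_def)
  have p': "p < m" using p by (simp add: m_def)
  have T: "dim_row T = m" "dim_col T = m" by (simp_all add: T_def I_minus_def D_SE_def mat_diag_def m_def)
  have Tpq: "T $$ (p, q) = of_real (h * sigma_SE (ix N p - ix N q)) * weight_SE a b h (ix N q)" if "p < m" "q < m" for p q
  proof -
    have "I_minus N \<in> carrier_mat m m" by (simp add: I_minus_def m_def)
    then have "I_minus N * D_SE a b h N = Matrix.mat m m (\<lambda>(i, j). I_minus N $$ (i, j) * weight_SE a b h (ix N j))"
      unfolding D_SE_def m_def[symmetric] by (rule mat_diag_mult_right)
    then show ?thesis using that by (simp add: T_def I_minus_def m_def)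
  qed
  have quad: "quad_SE a b h N n $$ (i * m + p, l * m + q) = (if l = i then T $$ (p, q) else 0)"
    if "l < n" "q < m" for l q
    using that i p' m block_index_less[OF i p'] block_index_less[OF that]
    by (simp add: quad_SE_def kronecker_def T_def[symmetric] T m_def[symmetric])
  have dr: "dim_row (quad_SE a b h N n) = n * m" "dim_col (quad_SE a b h N n) = n * m"
    using quad_SE_carrier[of a b h N n] by (auto simp: m_def)
  have dz: "dim_vec Z = n * m" using Z by (simp add: m_def)
  have lt: "i * m + p < n * m" using i p' by (rule block_index_less)
  have "(quad_SE a b h N n *\<^sub>v Z) $ (i * m + p) = (\<Sum>P = 0..<n * m. quad_SE a b h N n $$ (i * m + p, P) * Z $ P)"
    using lt by (simp add: dr dz scalar_prod_def)
  also have "\<dots> = (\<Sum>l<n. \<Sum>q<m. (if l = i then T $$ (p, q) * Z $ (l * m + q) else 0))"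
    unfolding sum_blocks by (intro sum.cong refl) (simp add: quad)
  also have "\<dots> = (\<Sum>l<n. if l = i then (\<Sum>q<m. T $$ (p, q) * Z $ (l * m + q)) else 0)"
    by (intro sum.cong refl) simp
  also have "\<dots> = (\<Sum>q<m. T $$ (p, q) * Z $ (i * m + q))" using i by simp
  also have "\<dots> = (\<Sum>q<m. of_real (h * sigma_SE (ix N p - ix N q)) * (weight_SE a b h (ix N q) * Z $ (i * m + q)))"
    using p by (intro sum.cong refl) (simp add: Tpq m_def)
  finally show ?thesis by (simp only: m_def)
qed

lemma K_SE_mult_vec:
  assumes Y: "Y \<in> carrier_vec (n * (2 * N + 1))" and i: "i < n" and p: "p < 2 * N + 1"
  shows "(K_SE a b h N n k *\<^sub>v Y) $ (i * (2 * N + 1) + p) =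
    (\<Sum>l<n. k i l (node_SE a b h (ix N p)) * Y $ (l * (2 * N + 1) + p))"
proof -
  define m where "m = 2 * N + 1"
  have m: "m > 0" by (simp add: m_def)
  have p': "p < m" using p by (simp add: m_def)
  have K: "K_SE a b h N n k $$ (i * m + p, l * m + q) = (if q = p then k i l (node_SE a b h (ix N p)) else 0)"
    if "l < n" "q < m" for l q
    using that i p' m block_index_less[OF i p'] block_index_less[OF that]
    unfolding K_SE_def square_blocks_def m_def[symmetric] by (simp add: mat_diag_def)
  have dr: "dim_row (K_SE a b h N n k) = n * m" "dim_col (K_SE a b h N n k) = n * m"
    using K_SE_carrier[of a b h N n k] by (auto simp: m_def)
  have dz: "dim_vec Y = n * m" using Y by (simp add: m_def)
  have lt: "i * m + p < n * m" using i p' by (rule block_index_less)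
  have "(K_SE a b h N n k *\<^sub>v Y) $ (i * m + p) = (\<Sum>P = 0..<n * m. K_SE a b h N n k $$ (i * m + p, P) * Y $ P)"
    using lt by (simp add: dr dz scalar_prod_def)
  also have "\<dots> = (\<Sum>l<n. \<Sum>q<m. (if q = p then k i l (node_SE a b h (ix N p)) * Y $ (l * m + q) else 0))"
    unfolding sum_blocks by (intro sum.cong refl) (simp add: K)
  also have "\<dots> = (\<Sum>l<n. k i l (node_SE a b h (ix N p)) * Y $ (l * m + p))" using p' by simp
  finally show ?thesis by (simp only: m_def)
qed

lemma kronecker_one: "kronecker (1\<^sub>m n) (1\<^sub>m m) = (1\<^sub>m (n * m) :: complex mat)"
proof (rule eq_matI)
  fix P Q assume "P < dim_row (1\<^sub>m (n * m) :: complex mat)" "Q < dim_col (1\<^sub>m (n * m) :: complex mat)"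
  then have PQ: "P < n * m" "Q < n * m" by simp_all
  then have m: "m > 0" by (cases m) auto
  have "P div m < n" "Q div m < n" using PQ by (simp_all add: less_mult_imp_div_less)
  moreover have "P = Q \<longleftrightarrow> P div m = Q div m \<and> P mod m = Q mod m" by (metis div_mult_mod_eq)
  ultimately show "kronecker (1\<^sub>m n) (1\<^sub>m m) $$ (P, Q) = (1\<^sub>m (n * m) :: complex mat) $$ (P, Q)"
    using PQ m by (auto simp: kronecker_def)
qed (simp_all add: kronecker_def)

definition system_matrix_SE :: "real \<Rightarrow> real \<Rightarrow> real \<Rightarrow> nat \<Rightarrow> nat \<Rightarrow> (nat \<Rightarrow> nat \<Rightarrow> complex \<Rightarrow> complex) \<Rightarrow> complex mat" where
  "system_matrix_SE a b h N n k = kronecker (1\<^sub>m n) (1\<^sub>m (2 * N + 1)) - quad_SE a b h N n * K_SE a b h N n k"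

lemma system_matrix_SE_carrier: "system_matrix_SE a b h N n k \<in> carrier_mat (n * (2 * N + 1)) (n * (2 * N + 1))"
  unfolding system_matrix_SE_def kronecker_one
  using mult_carrier_mat[OF quad_SE_carrier[of a b h N n] K_SE_carrier[of a b h N n k]] by (rule minus_carrier_mat)

text \<open>The weight is paired with the coefficient at the same node. Their product is the
  transformed coefficient, which has the exponential decay used for stability, whereas k itself may
  blow up at the end points.\<close>

lemma system_matrix_SE_mult_vec:
  assumes Y: "Y \<in> carrier_vec (n * (2 * N + 1))" and i: "i < n" and p: "p < 2 * N + 1"
  shows "(system_matrix_SE a b h N n k *\<^sub>v Y) $ (i * (2 * N + 1) + p) = Y $ (i * (2 * N + 1) + p) -
    (\<Sum>q<2 * N + 1. of_real (h * sigma_SE (ix N p - ix N q)) *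
      (\<Sum>l<n. k i l (node_SE a b h (ix N q)) * weight_SE a b h (ix N q) * Y $ (l * (2 * N + 1) + q)))"
proof -
  have KY: "K_SE a b h N n k *\<^sub>v Y \<in> carrier_vec (n * (2 * N + 1))"
    using K_SE_carrier Y by (rule mult_mat_vec_carrier)
  have lt: "i * (2 * N + 1) + p < dim_vec (quad_SE a b h N n *\<^sub>v (K_SE a b h N n k *\<^sub>v Y))"
    using block_index_less[OF i p] carrier_vecD[OF mult_mat_vec_carrier[OF quad_SE_carrier[of a b h N n] KY]] by (simp only:)
  have "system_matrix_SE a b h N n k *\<^sub>v Y = 1\<^sub>m (n * (2 * N + 1)) *\<^sub>v Y - (quad_SE a b h N n * K_SE a b h N n k) *\<^sub>v Y"
    unfolding system_matrix_SE_def kronecker_one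
    by (rule minus_mult_distrib_mat_vec[OF _ mult_carrier_mat[OF quad_SE_carrier K_SE_carrier] Y]) simp
  also have "\<dots> = Y - quad_SE a b h N n *\<^sub>v (K_SE a b h N n k *\<^sub>v Y)"
    using assoc_mult_mat_vec[OF quad_SE_carrier K_SE_carrier Y] Y by simp
  finally have "(system_matrix_SE a b h N n k *\<^sub>v Y) $ (i * (2 * N + 1) + p) =
      Y $ (i * (2 * N + 1) + p) - (quad_SE a b h N n *\<^sub>v (K_SE a b h N n k *\<^sub>v Y)) $ (i * (2 * N + 1) + p)"
    by (simp only: index_minus_vec(1)[OF lt])
  also have "(quad_SE a b h N n *\<^sub>v (K_SE a b h N n k *\<^sub>v Y)) $ (i * (2 * N + 1) + p) =
    (\<Sum>q<2 * N + 1. of_real (h * sigma_SE (ix N p - ix N q)) * (weight_SE a b h (ix N q) *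
      (K_SE a b h N n k *\<^sub>v Y) $ (i * (2 * N + 1) + q)))"
    by (rule quad_SE_mult_vec[OF KY i p])
  also have "\<dots> = (\<Sum>q<2 * N + 1. of_real (h * sigma_SE (ix N p - ix N q)) *
      (\<Sum>l<n. k i l (node_SE a b h (ix N q)) * weight_SE a b h (ix N q) * Y $ (l * (2 * N + 1) + q)))"
  proof (rule sum.cong[OF refl])
    fix q assume "q \<in> {..<2 * N + 1}"
    then have q: "q < 2 * N + 1" by simp
    show "of_real (h * sigma_SE (ix N p - ix N q)) * (weight_SE a b h (ix N q) * (K_SE a b h N n k *\<^sub>v Y) $ (i * (2 * N + 1) + q)) =
      of_real (h * sigma_SE (ix N p - ix N q)) * (\<Sum>l<n. k i l (node_SE a b h (ix N q)) * weight_SE a b h (ix N q) * Y $ (l * (2 * N + 1) + q))"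
      unfolding K_SE_mult_vec[OF Y i q] by (simp add: sum_distrib_left ac_simps)
  qed
  finally show ?thesis .
qed

lemma system_rhs_SE:
  assumes i: "i < n" and p: "p < 2 * N + 1"
  shows "(quad_SE a b h N n *\<^sub>v G_SE a b h N n g + R_vec N n r) $ (i * (2 * N + 1) + p) =
    (\<Sum>q<2 * N + 1. of_real (h * sigma_SE (ix N p - ix N q)) * (g i (node_SE a b h (ix N q)) * weight_SE a b h (ix N q))) + r i"
proof -
  define m where "m = 2 * N + 1"
  have p': "p < m" using p by (simp add: m_def)
  have G: "G_SE a b h N n g \<in> carrier_vec (n * (2 * N + 1))" unfolding G_SE_def by (rule vec_carrier)
  have lt: "i * m + q < n * m" if "q < m" for q using i that by (rule block_index_less)
  have Gq: "G_SE a b h N n g $ (i * m + q) = g i (node_SE a b h (ix N q))" if "q < m" for q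
    using lt[OF that] that unfolding G_SE_def m_def[symmetric] by simp
  have Rp: "R_vec N n r $ (i * m + p) = r i" "dim_vec (R_vec N n r) = n * m"
    using lt[OF p'] p' unfolding R_vec_def m_def[symmetric] by simp_all
  have "(quad_SE a b h N n *\<^sub>v G_SE a b h N n g + R_vec N n r) $ (i * m + p) =
      (quad_SE a b h N n *\<^sub>v G_SE a b h N n g) $ (i * m + p) + r i"
    using lt[OF p'] Rp by simp
  also have "(quad_SE a b h N n *\<^sub>v G_SE a b h N n g) $ (i * m + p) =
      (\<Sum>q<m. of_real (h * sigma_SE (ix N p - ix N q)) * (weight_SE a b h (ix N q) * G_SE a b h N n g $ (i * m + q)))"
    unfolding m_def by (rule quad_SE_mult_vec[OF G i p])
  also have "\<dots> = (\<Sum>q<m. of_real (h * sigma_SE (ix N p - ix N q)) * (g i (node_SE a b h (ix N q)) * weight_SE a b h (ix N q)))"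
    by (intro sum.cong refl) (simp add: Gq)
  finally show ?thesis by (simp only: m_def)
qed

text \<open>Summing the moduli of the components makes the system scalar, with c replaced by n c.
  Here \<open>v\<close> is any vector whose residual is at most \<delta>, so that one estimate
  serves both for null vectors and for nodal errors.\<close>

lemma sinc_system_stability:
  fixes h \<alpha> c B \<delta> :: real and v :: "nat \<Rightarrow> nat \<Rightarrow> complex" and \<kappa> :: "nat \<Rightarrow> nat \<Rightarrow> nat \<Rightarrow> complex"
  assumes h: "0 < h" "h \<le> 1" and \<alpha>: "\<alpha> > 0" and c: "c \<ge> 0" and \<delta>: "\<delta> \<ge> 0" and B: "B \<ge> 0"
    and sigma: "\<And>k. \<bar>sigma_SE k - (if k > 0 then 1 else 0)\<bar> \<le> B / (1 + \<bar>of_int k\<bar>)"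
    and small: "of_nat n * c * B * (4 + 2 / \<alpha>) * sqrt h * exp (of_nat n * c * (1 + 2 / \<alpha>)) \<le> 1"
    and \<kappa>: "\<And>i l q. i < n \<Longrightarrow> l < n \<Longrightarrow> q < 2 * N + 1 \<Longrightarrow> cmod (\<kappa> i l q) \<le> c * exp (- \<alpha> * (h * \<bar>of_int (ix N q)\<bar>))"
    and v: "\<And>i p. i < n \<Longrightarrow> p < 2 * N + 1 \<Longrightarrow>
      cmod (v i p - (\<Sum>q<2 * N + 1. of_real (h * sigma_SE (ix N p - ix N q)) * (\<Sum>l<n. \<kappa> i l q * v l q))) \<le> \<delta>"
    and i: "i < n" and p: "p < 2 * N + 1"
  shows "cmod (v i p) \<le> 2 * (of_nat n * \<delta>) * exp (of_nat n * c * (1 + 2 / \<alpha>))"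
proof -
  define V where "V = (\<lambda>p. \<Sum>i<n. cmod (v i p))"
  define w where "w = (\<lambda>q. c * (h * exp (- \<alpha> * (h * \<bar>of_int (ix N q)\<bar>))))"
  have single: "cmod (v i p) \<le> \<delta> + (\<Sum>q<2 * N + 1. w q * \<bar>sigma_SE (ix N p - ix N q)\<bar> * V q)"
    if i: "i < n" and p: "p < 2 * N + 1" for i p
  proof -
    define S where "S = (\<Sum>q<2 * N + 1. of_real (h * sigma_SE (ix N p - ix N q)) * (\<Sum>l<n. \<kappa> i l q * v l q))"
    have "cmod S \<le> (\<Sum>q<2 * N + 1. w q * \<bar>sigma_SE (ix N p - ix N q)\<bar> * V q)"
      unfolding S_def
    proof (rule sum_norm_le)
      fix q assume "q \<in> {..<2 * N + 1}"
      then have q: "q < 2 * N + 1" by simp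
      have "cmod (\<Sum>l<n. \<kappa> i l q * v l q) \<le> (\<Sum>l<n. c * exp (- \<alpha> * (h * \<bar>of_int (ix N q)\<bar>)) * cmod (v l q))"
        using \<kappa>[OF i _ q] by (intro sum_norm_le) (auto simp: norm_mult intro: mult_right_mono)
      also have "\<dots> = c * exp (- \<alpha> * (h * \<bar>of_int (ix N q)\<bar>)) * V q" by (simp add: V_def sum_distrib_left)
      finally have "(h * \<bar>sigma_SE (ix N p - ix N q)\<bar>) * cmod (\<Sum>l<n. \<kappa> i l q * v l q)
          \<le> (h * \<bar>sigma_SE (ix N p - ix N q)\<bar>) * (c * exp (- \<alpha> * (h * \<bar>of_int (ix N q)\<bar>)) * V q)"
        using h by (intro mult_left_mono) auto
      then show "cmod (of_real (h * sigma_SE (ix N p - ix N q)) * (\<Sum>l<n. \<kappa> i l q * v l q))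
          \<le> w q * \<bar>sigma_SE (ix N p - ix N q)\<bar> * V q"
        unfolding norm_mult norm_of_real abs_mult w_def using h by (simp add: ac_simps)
    qed
    then show ?thesis using v[OF i p] norm_triangle_sub[of "v i p" S] unfolding S_def by linarith
  qed
  have "V p \<le> 2 * (of_nat n * \<delta>) * exp (of_nat n * c * (1 + 2 / \<alpha>))"
  proof (rule sinc_matrix_stability[OF h \<alpha> _ _ B sigma small _ _ p])
    fix p assume p: "p < 2 * N + 1"
    have "V p = (\<Sum>i<n. cmod (v i p))" by (simp only: V_def)
    also have "\<dots> \<le> (\<Sum>i<n. \<delta> + (\<Sum>q<2 * N + 1. w q * \<bar>sigma_SE (ix N p - ix N q)\<bar> * V q))"
      by (rule sum_mono, rule single[OF _ p]) simp
    also have "\<dots> = of_nat n * \<delta> + (\<Sum>q<2 * N + 1. of_nat n * c * (h * exp (- \<alpha> * (h * \<bar>of_int (ix N q)\<bar>)))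
        * \<bar>sigma_SE (ix N p - ix N q)\<bar> * V q)"
      unfolding sum_constant card_lessThan w_def by (simp only: distrib_left sum_distrib_left mult.assoc)
    finally show "V p \<le> of_nat n * \<delta> + (\<Sum>q<2 * N + 1. of_nat n * c * (h * exp (- \<alpha> * (h * \<bar>of_int (ix N q)\<bar>)))
        * \<bar>sigma_SE (ix N p - ix N q)\<bar> * V q)" .
  qed (use c \<delta> in \<open>auto simp: V_def intro: sum_nonneg\<close>)
  moreover have "cmod (v i p) \<le> V p" unfolding V_def using i by (intro member_le_sum) auto
  ultimately show ?thesis by linarith
qed

section \<open>The transformed initial value problem\<close>

lemma finite_common_bound:
  assumes "finite I" and "\<And>i. i \<in> I \<Longrightarrow> \<exists>c\<ge>0::real. P i c"
    and mono: "\<And>i c c'. P i c \<Longrightarrow> c \<le> c' \<Longrightarrow> P i c'"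
  shows "\<exists>c\<ge>0. \<forall>i\<in>I. P i c"
proof -
  obtain C where C: "\<And>i. i \<in> I \<Longrightarrow> C i \<ge> 0 \<and> P i (C i)" using assms(2) by metis
  show ?thesis
  proof (intro exI[of _ "sum C I"] conjI ballI)
    show "0 \<le> sum C I" by (rule sum_nonneg) (use C in blast)
    fix i assume i: "i \<in> I"
    have "C i \<le> sum C I" by (rule member_le_sum[OF i]) (use C assms(1) in blast)+
    then show "P i (sum C I)" by (rule mono[OF conjunct2[OF C[OF i]]])
  qed
qed

text \<open>The hypothesis speaks of f Q; continuity passes to f because Q is nonzero in a whole
  neighbourhood of an interior point.\<close>

lemma L_space_isCont:
  assumes ab: "a < b" and d: "0 < d"
    and f: "(\<lambda>z. f z * Q_fun a b z) \<in> L_space a b \<alpha> (psi_SE a b ` strip d)"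
    and t: "a < t" "t < b"
  shows "isCont f (of_real t)"
proof -
  define g where "g = (\<lambda>z. f z * Q_fun a b z)"
  have "of_real t \<in> psi_SE a b ` strip d"
    using psi_SE_phi_SE[OF t, symmetric] d by (intro image_eqI[of _ _ "of_real (ln ((t - a) / (b - t)))"]) (auto simp: strip_def)
  then have "g analytic_on {of_real t}"
    using f analytic_on_subset[of g "psi_SE a b ` strip d"] by (auto simp: L_space_def g_def)
  then have cg: "isCont g (of_real t)" by (rule analytic_at_imp_isCont)
  have cQ: "isCont (Q_fun a b) (of_real t)" unfolding Q_fun_def[abs_def] by (intro continuous_intros)
  have Q: "Q_fun a b (of_real t) \<noteq> 0" using t by (auto simp: Q_fun_def)
  have "\<forall>\<^sub>F z in nhds (of_real t). Q_fun a b z \<noteq> 0"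
  proof -
    have "(Q_fun a b \<longlongrightarrow> Q_fun a b (of_real t)) (nhds (of_real t))"
      using cQ by (simp add: continuous_at_imp_continuous_within isCont_def tendsto_at_iff_tendsto_nhds)
    then show ?thesis using Q by (rule tendsto_imp_eventually_ne)
  qed
  then have "\<forall>\<^sub>F z in nhds (of_real t). f z = g z / Q_fun a b z"
    by eventually_elim (simp add: g_def)
  moreover have "isCont (\<lambda>z. g z / Q_fun a b z) (of_real t)" using cg cQ Q by (rule isCont_divide)
  ultimately show ?thesis by (subst isCont_cong)
qed

text \<open>The integrated form can be differentiated wherever the integrand is continuous, and psi
  maps the real line into the open interval, so the singular end points are never met. The chain
  rule supplies the factor psi'.\<close>

lemma ivp_solution_transformed:
  fixes y :: "nat \<Rightarrow> real \<Rightarrow> complex"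
  assumes ab: "a < b" and d: "0 < d" "d < pi"
    and k: "\<And>i l. i < n \<Longrightarrow> l < n \<Longrightarrow> (\<lambda>z. k i l z * Q_fun a b z) \<in> L_space a b \<alpha> (psi_SE a b ` strip d)"
    and g: "\<And>i. i < n \<Longrightarrow> (\<lambda>z. g i z * Q_fun a b z) \<in> L_space a b \<alpha> (psi_SE a b ` strip d)"
    and sol: "ivp_solution a b n k g r y" and i: "i < n"
  shows "((\<lambda>s. y i (Re (psi_SE a b (of_real s)))) has_vector_derivative
    (g i (psi_SE a b (of_real s)) * deriv (psi_SE a b) (of_real s) +
     (\<Sum>l<n. k i l (psi_SE a b (of_real s)) * deriv (psi_SE a b) (of_real s) * y l (Re (psi_SE a b (of_real s)))))) (at s)"
proof -
  define T where "T = (\<lambda>s::real. Re (psi_SE a b (of_real s)))"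
  define f where "f = (\<lambda>t::real. g i (of_real t) + (\<Sum>l<n. k i l (of_real t) * y l t))"
  have s0: "of_real s \<in> strip d" for s :: real using d by (simp add: strip_def)
  have Tpsi: "of_real (T s) = psi_SE a b (of_real s)" for s unfolding T_def psi_SE_real by simp
  have T: "a < T s" "T s < b" using psi_SE_real_in[OF ab, of s] by (auto simp: T_def)
  have ycont: "continuous_on {a..b} (y l)" if "l < n" for l using sol that by (simp add: ivp_solution_def)
  have yat: "isCont (y l) (T s)" if "l < n" for l
    using continuous_on_interior[OF ycont[OF that], of "T s"] T by (simp add: interior_atLeastAtMost_real)
  have cf: "isCont f (T s)"
  proof -
    have "isCont (\<lambda>t. g i (of_real t)) (T s)"
      by (rule isCont_o2[where f = of_real, OF _ L_space_isCont[OF ab d(1) g[OF i] T]]) (intro continuous_intros)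
    moreover have "isCont (\<lambda>t. k i l (of_real t)) (T s)" if "l < n" for l
      by (rule isCont_o2[where f = of_real, OF _ L_space_isCont[OF ab d(1) k[OF i that] T]]) (intro continuous_intros)
    ultimately show ?thesis unfolding f_def using yat by (intro continuous_intros) auto
  qed
  have int: "(f has_integral (y i t - r i)) {a..t}" if "t \<in> {a..b}" for t
    using sol i that unfolding ivp_solution_def f_def by blast
  have "((\<lambda>u. integral {a..u} f) has_vector_derivative f (T s)) (at (T s) within {a..b} - {})"
    using T int[of b] ab cf by (intro integral_has_vector_derivative_continuous_at) (auto intro: continuous_at_imp_continuous_within)
  then have "((\<lambda>u. y i u - r i) has_vector_derivative f (T s)) (at (T s) within {a..b})"
    using T by (rule_tac has_vector_derivative_transform[of "T s" "{a..b}" _ "\<lambda>u. integral {a..u} f"])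
      (auto simp: integral_unique[OF int])
  then have "((\<lambda>u. (y i u - r i) + r i) has_vector_derivative f (T s) + 0) (at (T s) within {a..b})"
    by (intro has_vector_derivative_add has_vector_derivative_const)
  then have dy: "(y i has_vector_derivative f (T s)) (at (T s))"
    using T by (simp add: at_within_Icc_at)
  define D where "D = (b - a) / (2 * cosh (s / 2))\<^sup>2"
  have cosh_r: "cosh (of_real s / 2 :: complex) = of_real (cosh (s / 2))"
    by (simp add: cosh_field_def exp_of_real[symmetric])
  have dpsi: "deriv (psi_SE a b) (of_real s) = of_real D"
    unfolding DERIV_imp_deriv[OF psi_SE_derivative[OF cosh_half_nonzero[OF d s0]]] D_def
    by (simp add: cosh_r)
  have "((\<lambda>s. psi_SE a b (of_real s)) has_vector_derivative of_real D) (at s)"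
    using psi_SE_derivative[OF cosh_half_nonzero[OF d s0[of s]], of a b]
    unfolding DERIV_imp_deriv[OF psi_SE_derivative[OF cosh_half_nonzero[OF d s0]], symmetric] dpsi
    by (rule has_vector_derivative_real_field)
  from bounded_linear.has_vector_derivative[OF bounded_linear_Re this]
  have "(T has_vector_derivative D) (at s)" by (simp add: T_def)
  from vector_diff_chain_at[OF this dy]
  have "((\<lambda>s. y i (T s)) has_vector_derivative D *\<^sub>R f (T s)) (at s)" by (simp add: o_def)
  moreover have "D *\<^sub>R f (T s) = g i (psi_SE a b (of_real s)) * deriv (psi_SE a b) (of_real s) +
     (\<Sum>l<n. k i l (psi_SE a b (of_real s)) * deriv (psi_SE a b) (of_real s) * y l (T s))"
    unfolding f_def dpsi Tpsi by (simp add: scaleR_conv_of_real distrib_left sum_distrib_left ac_simps)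
  ultimately show ?thesis by (simp add: T_def)
qed

text \<open>The holomorphic solution is started at x = 0, with the value of \<open>y\<close> at the
  midpoint of the interval. On the real line its difference from \<open>y\<close> solves the
  homogeneous system, is bounded and vanishes at 0, hence is zero.\<close>

lemma ivp_solution_extends:
  fixes y :: "nat \<Rightarrow> real \<Rightarrow> complex"
  defines "\<kappa> \<equiv> \<lambda>k a b z. k (psi_SE a b z) * deriv (psi_SE a b) z"
  assumes ab: "a < b" and d: "0 < d" "d < pi" and \<alpha>: "\<alpha> > 0"
    and k: "\<And>i l. i < n \<Longrightarrow> l < n \<Longrightarrow> (\<lambda>z. k i l z * Q_fun a b z) \<in> L_space a b \<alpha> (psi_SE a b ` strip d)"
    and g: "\<And>i. i < n \<Longrightarrow> (\<lambda>z. g i z * Q_fun a b z) \<in> L_space a b \<alpha> (psi_SE a b ` strip d)"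
    and sol: "ivp_solution a b n k g r y"
    and c: "c \<ge> 0"
    and kb: "\<And>i l z. i < n \<Longrightarrow> l < n \<Longrightarrow> z \<in> strip d \<Longrightarrow> cmod (\<kappa> (k i l) a b z) \<le> c * exp (- \<alpha> * \<bar>Re z\<bar>)"
    and gb: "\<And>i z. i < n \<Longrightarrow> z \<in> strip d \<Longrightarrow> cmod (\<kappa> (g i) a b z) \<le> c * exp (- \<alpha> * \<bar>Re z\<bar>)"
  obtains u B where "B \<ge> 0"
    "\<And>i z. i < n \<Longrightarrow> z \<in> strip d \<Longrightarrow> (u i has_field_derivative (\<kappa> (g i) a b z + (\<Sum>l<n. \<kappa> (k i l) a b z * u l z))) (at z)"
    "\<And>i z. i < n \<Longrightarrow> z \<in> strip d \<Longrightarrow> cmod (u i z) \<le> B"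
    "\<And>i s. i < n \<Longrightarrow> u i (of_real s) = y i (Re (psi_SE a b (of_real s)))"
proof -
  define Y where "Y = (\<lambda>i s. y i (Re (psi_SE a b (of_real s))))"
  have kh: "\<kappa> (k i l) a b holomorphic_on strip d" if "i < n" "l < n" for i l
    unfolding \<kappa>_def by (rule L_space_transformed[OF ab d \<alpha> k[OF that]])
  have gh: "\<kappa> (g i) a b holomorphic_on strip d" if "i < n" for i
    unfolding \<kappa>_def by (rule L_space_transformed[OF ab d \<alpha> g[OF that]])
  have Yd: "(Y i has_vector_derivative (\<kappa> (g i) a b (of_real s) + (\<Sum>l<n. \<kappa> (k i l) a b (of_real s) * Y l s))) (at s)"
    if "i < n" for i s
    using ivp_solution_transformed[OF ab d k g sol that, of s] unfolding Y_def \<kappa>_def by simp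
  have "\<exists>B\<ge>0. \<forall>i\<in>{..<n}. \<forall>t\<in>{a..b}. cmod (y i t) \<le> B"
  proof (rule finite_common_bound)
    fix i assume "i \<in> {..<n}"
    then have "continuous_on {a..b} (y i)" using sol by (simp add: ivp_solution_def)
    then have "bounded (y i ` {a..b})" by (intro compact_imp_bounded compact_continuous_image) auto
    then obtain B where B: "\<And>t. t \<in> {a..b} \<Longrightarrow> cmod (y i t) \<le> B" unfolding bounded_iff by blast
    show "\<exists>B\<ge>0. \<forall>t\<in>{a..b}. cmod (y i t) \<le> B"
      by (intro exI[of _ "\<bar>B\<bar>"]) (auto intro: order_trans[OF B abs_ge_self])
  qed (auto intro: order_trans)
  then obtain By where By: "By \<ge> 0" "\<And>i t. i < n \<Longrightarrow> t \<in> {a..b} \<Longrightarrow> cmod (y i t) \<le> By" by auto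
  have Yb: "cmod (Y i s) \<le> By" if "i < n" for i s
    using By(2)[OF that] psi_SE_real_in[OF ab, of s] by (auto simp: Y_def)
  show ?thesis
  proof (rule linear_ode_strip[where \<kappa> = "\<lambda>i l. \<kappa> (k i l) a b" and \<gamma> = "\<lambda>i. \<kappa> (g i) a b" and n = n and d = d and w = "\<lambda>i. Y i 0",
        OF d(1) \<alpha> c kh gh kb gb])
    fix B u
    assume B: "B \<ge> 0"
      and u: "\<And>i z. i < n \<Longrightarrow> z \<in> strip d \<Longrightarrow> (u i has_field_derivative (\<kappa> (g i) a b z + (\<Sum>l<n. \<kappa> (k i l) a b z * u l z))) (at z)"
      and u0: "\<And>i. i < n \<Longrightarrow> u i 0 = Y i 0"
      and ub: "\<And>i z. i < n \<Longrightarrow> z \<in> strip d \<Longrightarrow> cmod (u i z) \<le> B"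
    have s0: "of_real s \<in> strip d" for s :: real using d by (simp add: strip_def)
    have "Y i s - u i (of_real s) = 0" if i: "i < n" for i s
    proof (rule linear_ode_real_zero[where v = "\<lambda>i s. Y i s - u i (of_real s)" and k = "\<lambda>i l s. \<kappa> (k i l) a b (of_real s)"
          and B = "By + B" and n = n and i = i, OF c])
      fix i s assume i: "i < n"
      have "((\<lambda>s. Y i s - u i (of_real s)) has_vector_derivative
          (\<kappa> (g i) a b (of_real s) + (\<Sum>l<n. \<kappa> (k i l) a b (of_real s) * Y l s)) -
          (\<kappa> (g i) a b (of_real s) + (\<Sum>l<n. \<kappa> (k i l) a b (of_real s) * u l (of_real s)))) (at s)"
        by (intro has_vector_derivative_diff Yd[OF i] has_vector_derivative_real_field[OF u[OF i s0]])
      then show "((\<lambda>s. Y i s - u i (of_real s)) has_vector_derivative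
          (\<Sum>l<n. \<kappa> (k i l) a b (of_real s) * (Y l s - u l (of_real s)))) (at s)"
        by (simp add: right_diff_distrib sum_subtractf)
      show "cmod (Y i s - u i (of_real s)) \<le> By + B"
        by (rule order_trans[OF norm_triangle_ineq4 add_mono[OF Yb[OF i] ub[OF i s0]]])
    next
      fix i l s assume "i < n" "l < n"
      then have "cmod (\<kappa> (k i l) a b (of_real s)) \<le> c * exp (- \<alpha> * \<bar>Re (of_real s)\<bar>)" by (rule kb[OF _ _ s0])
      also have "\<dots> \<le> c * 1" using c \<alpha> by (intro mult_left_mono) auto
      finally show "cmod (\<kappa> (k i l) a b (of_real s)) \<le> c" by simp
    qed (use u0 i in auto)
    then show ?thesis using that[OF B u ub] by (simp add: Y_def)
  qed
qed

section \<open>The error of the SE-Sinc-Nystroem solution\<close>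

lemma exp_sinc_step:
  assumes "d > 0" "\<alpha> > 0" "N > (0::nat)"
  defines "h \<equiv> sqrt (pi * d / (\<alpha> * real N))"
  shows "pi * d / h = sqrt (pi * d * \<alpha> * real N)" and "\<alpha> * (h * real N) = sqrt (pi * d * \<alpha> * real N)"
proof -
  define X Y where "X = sqrt (pi * d)" and "Y = sqrt (\<alpha> * real N)"
  have X: "X > 0" "X * X = pi * d" and Y: "Y > 0" "Y * Y = \<alpha> * real N"
    using assms by (simp_all add: X_def Y_def)
  have h: "h = X / Y" unfolding h_def X_def Y_def by (rule real_sqrt_divide)
  have XY: "sqrt (pi * d * \<alpha> * real N) = X * Y"
    unfolding X_def Y_def real_sqrt_mult[symmetric] by (simp add: mult.assoc)
  show "pi * d / h = sqrt (pi * d * \<alpha> * real N)"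
    unfolding XY unfolding h X(2)[symmetric] using X(1) Y(1) by simp
  have "\<alpha> * (h * real N) = (\<alpha> * real N) * h" by simp
  then show "\<alpha> * (h * real N) = sqrt (pi * d * \<alpha> * real N)"
    unfolding XY unfolding h Y(2)[symmetric] using X(1) Y(1) by simp
qed

text \<open>The three requirements that determine \<open>N0\<close>: room for the contour inside the
  strip, node sums bounded by 1 + 2 / \<alpha>, and absorption of the part of the matrix that is not
  triangular.\<close>

lemma sinc_step_small:
  assumes "d > 0" "\<alpha> > 0"
  shows "\<exists>N0\<ge>1. \<forall>N\<ge>N0. sqrt (pi * d / (\<alpha> * real N)) \<le> pi * d / 4 \<and> sqrt (pi * d / (\<alpha> * real N)) \<le> 1 \<and>
    K * sqrt (sqrt (pi * d / (\<alpha> * real N))) \<le> 1"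
proof -
  define c where "c = pi * d / \<alpha>"
  have c: "c > 0" using assms by (simp add: c_def)
  have lim: "(\<lambda>N. sqrt (c / real N)) \<longlonglongrightarrow> 0" using c by real_asymp
  have lim2: "(\<lambda>N. K * sqrt (sqrt (c / real N))) \<longlonglongrightarrow> K * sqrt 0"
    by (intro tendsto_mult_left tendsto_real_sqrt lim)
  have "pi * d / 4 > 0" using assms by simp
  then have "\<forall>\<^sub>F N in sequentially. sqrt (c / real N) < pi * d / 4" by (rule order_tendstoD(2)[OF lim])
  moreover have "\<forall>\<^sub>F N in sequentially. sqrt (c / real N) < 1" by (rule order_tendstoD(2)[OF lim]) simp
  moreover have "\<forall>\<^sub>F N in sequentially. K * sqrt (sqrt (c / real N)) < 1" by (rule order_tendstoD(2)[OF lim2]) simp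
  ultimately have "\<forall>\<^sub>F N in sequentially. sqrt (c / real N) \<le> pi * d / 4 \<and> sqrt (c / real N) \<le> 1 \<and> K * sqrt (sqrt (c / real N)) \<le> 1"
    by eventually_elim auto
  then obtain N1 where N1: "\<forall>N\<ge>N1. sqrt (c / real N) \<le> pi * d / 4 \<and> sqrt (c / real N) \<le> 1 \<and> K * sqrt (sqrt (c / real N)) \<le> 1"
    by (auto simp: eventually_sequentially)
  have "pi * d / (\<alpha> * real N) = c / real N" for N by (simp add: c_def)
  then show ?thesis using N1 by (intro exI[of _ "max 1 N1"]) auto
qed

lemma J_SE_node:
  assumes "h > 0"
  shows "J_SE j h (ereal (of_int k * h)) = h * sigma_SE (k - j)"
  using assms by (simp add: J_SE_def sigma_SE_def)

lemma J_SE_at_top: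
  assumes "h > 0"
  shows "((\<lambda>x. J_SE j h (ereal x)) \<longlongrightarrow> J_SE j h \<infinity>) at_top"
proof -
  have "filterlim (\<lambda>x. pi * (x / h - of_int j)) at_top at_top" using assms by real_asymp
  from filterlim_compose[OF Si_at_top this]
  have "((\<lambda>x. h * (1 / 2 + 1 / pi * Si (pi * (x / h - of_int j)))) \<longlongrightarrow> h * (1 / 2 + 1 / pi * (pi / 2))) at_top"
    by (intro tendsto_intros)
  then show ?thesis by (simp add: J_SE_def)
qed

lemma SE_Sinc_system_iff:
  "SE_Sinc_system a b h N n k g r Y \<longleftrightarrow> Y \<in> carrier_vec (n * (2 * N + 1)) \<and>
    system_matrix_SE a b h N n k *\<^sub>v Y = quad_SE a b h N n *\<^sub>v G_SE a b h N n g + R_vec N n r"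
  by (simp only: SE_Sinc_system_def system_matrix_SE_def)

text \<open>Here \<open>u\<close> is the solution as a function of \<open>x = \<phi>(t)\<close>, \<open>\<delta>\<close> bounds the quadrature error of its
  indefinite integral, and \<open>B\<close>, \<open>Bs\<close> are the constants in the bounds for \<open>\<sigma>\<close> and \<open>J\<close>.\<close>

locale sinc_nystroem =
  fixes a b \<alpha> c :: real and n :: nat
    and k :: "nat \<Rightarrow> nat \<Rightarrow> complex \<Rightarrow> complex" and g :: "nat \<Rightarrow> complex \<Rightarrow> complex"
    and \<kappa> :: "nat \<Rightarrow> nat \<Rightarrow> complex \<Rightarrow> complex" and \<gamma> :: "nat \<Rightarrow> complex \<Rightarrow> complex"
    and r :: "nat \<Rightarrow> complex" and u :: "nat \<Rightarrow> complex \<Rightarrow> complex"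
    and h B Bs \<delta> :: real and N :: nat
  assumes h: "0 < h" "h \<le> 1" and \<alpha>: "\<alpha> > 0" and c: "c \<ge> 0" and B: "B \<ge> 0" and Bs: "Bs \<ge> 0" and \<delta>: "\<delta> \<ge> 0"
    and \<kappa>_def: "\<kappa> = (\<lambda>i l z. k i l (psi_SE a b z) * deriv (psi_SE a b) z)"
    and \<gamma>_def: "\<gamma> = (\<lambda>i z. g i (psi_SE a b z) * deriv (psi_SE a b) z)"
    and \<kappa>: "\<And>i l j. i < n \<Longrightarrow> l < n \<Longrightarrow> cmod (\<kappa> i l (of_real (of_int j * h))) \<le> c * exp (- \<alpha> * (h * \<bar>of_int j\<bar>))"
    and J: "\<And>j x. \<bar>J_SE j h x\<bar> \<le> Bs * h"
    and sigma: "\<And>k. \<bar>sigma_SE k - (if k > 0 then 1 else 0)\<bar> \<le> B / (1 + \<bar>of_int k\<bar>)"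
    and small: "of_nat n * c * B * (4 + 2 / \<alpha>) * sqrt h * exp (of_nat n * c * (1 + 2 / \<alpha>)) \<le> 1"
    and quad: "\<And>i x. i < n \<Longrightarrow> cmod (u i (of_real x) - r i -
      (\<Sum>j = - int N..int N. (\<gamma> i (of_real (of_int j * h)) + (\<Sum>l<n. \<kappa> i l (of_real (of_int j * h)) * u l (of_real (of_int j * h)))) *
         of_real (J_SE j h (ereal x)))) \<le> \<delta>"
begin

abbreviation "nd q \<equiv> complex_of_real (of_int (ix N q) * h)"

lemma node_weight:
  "k i l (node_SE a b h j) * weight_SE a b h j = \<kappa> i l (of_real (of_int j * h))"
  "g i (node_SE a b h j) * weight_SE a b h j = \<gamma> i (of_real (of_int j * h))"
  by (simp_all add: \<kappa>_def \<gamma>_def node_SE_def weight_SE_def)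

lemma \<kappa>_ix: "i < n \<Longrightarrow> l < n \<Longrightarrow> cmod (\<kappa> i l (nd q)) \<le> c * exp (- \<alpha> * (h * \<bar>of_int (ix N q)\<bar>))"
  by (rule \<kappa>)

text \<open>The matrix is square, so a trivial kernel suffices, and a null vector is a vector with
  residual 0, which stability forces to vanish.\<close>

lemma unique_solvability: "\<exists>!Y. SE_Sinc_system a b h N n k g r Y"
  unfolding SE_Sinc_system_iff
proof (rule unique_solution_if_kernel_trivial[OF system_matrix_SE_carrier])
  show "quad_SE a b h N n *\<^sub>v G_SE a b h N n g + R_vec N n r \<in> carrier_vec (n * (2 * N + 1))"
  proof (rule add_carrier_vec)
    show "quad_SE a b h N n *\<^sub>v G_SE a b h N n g \<in> carrier_vec (n * (2 * N + 1))"
      by (rule mult_mat_vec_carrier[OF quad_SE_carrier]) (simp only: G_SE_def vec_carrier)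
    show "R_vec N n r \<in> carrier_vec (n * (2 * N + 1))" by (simp only: R_vec_def vec_carrier)
  qed
  fix v assume v: "v \<in> carrier_vec (n * (2 * N + 1))" and 0: "system_matrix_SE a b h N n k *\<^sub>v v = 0\<^sub>v (n * (2 * N + 1))"
  define m where "m = 2 * N + 1"
  have zero: "v $ (i * m + p) = 0" if i: "i < n" and p: "p < m" for i p
  proof -
    have "cmod (v $ (i * m + p)) \<le> 2 * (of_nat n * 0) * exp (of_nat n * c * (1 + 2 / \<alpha>))"
    proof (rule sinc_system_stability[where v = "\<lambda>i p. v $ (i * m + p)" and N = N and h = h and \<kappa> = "\<lambda>i l q. \<kappa> i l (nd q)",
          OF h \<alpha> c order_refl B sigma small \<kappa>_ix])
      fix i p assume i: "i < n" and p: "p < 2 * N + 1"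
      have "i * m + p < n * m" using i p unfolding m_def by (rule block_index_less)
      then have "0 = (system_matrix_SE a b h N n k *\<^sub>v v) $ (i * m + p)" unfolding 0 m_def by simp
      also have "\<dots> = v $ (i * m + p) - (\<Sum>q<2 * N + 1. of_real (h * sigma_SE (ix N p - ix N q)) *
          (\<Sum>l<n. \<kappa> i l (nd q) * v $ (l * m + q)))"
        unfolding m_def system_matrix_SE_mult_vec[OF v i p] node_weight ..
      finally show "cmod (v $ (i * m + p) - (\<Sum>q<2 * N + 1. of_real (h * sigma_SE (ix N p - ix N q)) *
          (\<Sum>l<n. \<kappa> i l (nd q) * v $ (l * m + q)))) \<le> 0" by simp
    qed (use i p in \<open>simp_all add: m_def\<close>)
    then show ?thesis by simp
  qed
  show "v = 0\<^sub>v (n * (2 * N + 1))"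
  proof (rule eq_vecI)
    fix P assume "P < dim_vec (0\<^sub>v (n * (2 * N + 1)))"
    then have P: "P < n * m" by (simp add: m_def)
    have "P div m < n" using P by (simp add: less_mult_imp_div_less)
    moreover have "P mod m < m" by (simp add: m_def)
    ultimately have "v $ (P div m * m + P mod m) = 0" by (rule zero)
    then have "v $ P = 0" by (simp only: div_mult_mod_eq)
    then show "v $ P = 0\<^sub>v (n * (2 * N + 1)) $ P" using P unfolding m_def by (simp only: index_zero_vec)
  qed (use v in simp)
qed

text \<open>At the node k h the function \<open>J_SE j h\<close> equals h \<sigma>(k - j), so the
  quadrature formula at the nodes reproduces the rows of the system. The exact values thus solve it
  up to \<delta>, and stability applies to the difference.\<close>

lemma nodal_error:
  fixes Y :: "complex Matrix.vec"
  assumes Y: "SE_Sinc_system a b h N n k g r Y" and i: "i < n" and p: "p < 2 * N + 1"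
  shows "cmod (u i (nd p) - Y $ (i * (2 * N + 1) + p)) \<le> 2 * (of_nat n * \<delta>) * exp (of_nat n * c * (1 + 2 / \<alpha>))"
proof (rule sinc_system_stability[where v = "\<lambda>i p. u i (nd p) - Y $ (i * (2 * N + 1) + p)" and N = N and h = h
      and \<kappa> = "\<lambda>i l q. \<kappa> i l (nd q)", OF h \<alpha> c \<delta> B sigma small \<kappa>_ix _ i p])
  fix i p assume i: "i < n" and p: "p < 2 * N + 1"
  define m where "m = 2 * N + 1"
  define s where "s = (\<lambda>q. complex_of_real (h * sigma_SE (ix N p - ix N q)))"
  have Yc: "Y \<in> carrier_vec (n * (2 * N + 1))" using Y by (simp only: SE_Sinc_system_def)
  have "(system_matrix_SE a b h N n k *\<^sub>v Y) $ (i * m + p) =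
      (quad_SE a b h N n *\<^sub>v G_SE a b h N n g + R_vec N n r) $ (i * m + p)"
    using Y by (simp only: SE_Sinc_system_iff)
  then have Yeq: "Y $ (i * m + p) - (\<Sum>q<m. s q * (\<Sum>l<n. \<kappa> i l (nd q) * Y $ (l * m + q))) = (\<Sum>q<m. s q * \<gamma> i (nd q)) + r i"
    unfolding m_def system_matrix_SE_mult_vec[OF Yc i p] system_rhs_SE[OF i p] node_weight s_def .
  have "(\<Sum>j = - int N..int N. (\<gamma> i (of_real (of_int j * h)) + (\<Sum>l<n. \<kappa> i l (of_real (of_int j * h)) * u l (of_real (of_int j * h)))) *
      of_real (J_SE j h (ereal (of_int (ix N p) * h)))) = (\<Sum>q<m. (\<gamma> i (nd q) + (\<Sum>l<n. \<kappa> i l (nd q) * u l (nd q))) * s q)"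
    unfolding J_SE_node[OF h(1)] s_def m_def by (rule sum_ix[symmetric])
  with quad[OF i, of "of_int (ix N p) * h"]
  have Q: "cmod (u i (nd p) - r i - (\<Sum>q<m. (\<gamma> i (nd q) + (\<Sum>l<n. \<kappa> i l (nd q) * u l (nd q))) * s q)) \<le> \<delta>" by (simp only:)
  have split: "(\<Sum>q<m. (G q + K q) * s q) = (\<Sum>q<m. s q * G q) + (\<Sum>q<m. s q * K q)" for G K
    unfolding sum.distrib[symmetric] by (intro sum.cong refl) (simp add: algebra_simps)
  have "u i (nd p) - Y $ (i * m + p) - (\<Sum>q<m. s q * (\<Sum>l<n. \<kappa> i l (nd q) * (u l (nd q) - Y $ (l * m + q)))) =
      (u i (nd p) - (\<Sum>q<m. s q * (\<Sum>l<n. \<kappa> i l (nd q) * u l (nd q)))) -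
      (Y $ (i * m + p) - (\<Sum>q<m. s q * (\<Sum>l<n. \<kappa> i l (nd q) * Y $ (l * m + q))))"
    by (simp add: right_diff_distrib sum_subtractf)
  also have "\<dots> = u i (nd p) - r i - (\<Sum>q<m. (\<gamma> i (nd q) + (\<Sum>l<n. \<kappa> i l (nd q) * u l (nd q))) * s q)"
    unfolding Yeq split by (simp add: algebra_simps)
  finally show "cmod (u i (nd p) - Y $ (i * (2 * N + 1) + p) - (\<Sum>q<2 * N + 1. complex_of_real (h * sigma_SE (ix N p - ix N q)) *
      (\<Sum>l<n. \<kappa> i l (nd q) * (u l (nd q) - Y $ (l * (2 * N + 1) + q))))) \<le> \<delta>"
    using Q unfolding m_def s_def by (simp only:)
qed

text \<open>The Nystroem formula is the quadrature formula with \<open>Y\<close> in place of the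
  exact nodal values. The error is therefore the quadrature error plus \<open>S\<close>, the
  propagated nodal errors, which stays bounded in \<open>x\<close> because \<open>J_SE\<close> is of
  order h and h exp (- \<alpha> h |j|) has a bounded sum.\<close>

lemma nystroem_error:
  fixes Y :: "complex Matrix.vec"
  assumes Y: "SE_Sinc_system a b h N n k g r Y" and i: "i < n"
  shows "cmod (u i (of_real x) - (r i + (\<Sum>j = - int N..int N. (\<gamma> i (of_real (of_int j * h)) +
      (\<Sum>l<n. \<kappa> i l (of_real (of_int j * h)) * Y $ (l * (2 * N + 1) + nat (j + int N)))) * of_real (J_SE j h (ereal x)))))
    \<le> \<delta> * (1 + 2 * (of_nat n)\<^sup>2 * c * Bs * (1 + 2 / \<alpha>) * exp (of_nat n * c * (1 + 2 / \<alpha>)))"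
proof -
  define W where "W = 2 * (of_nat n * \<delta>) * exp (of_nat n * c * (1 + 2 / \<alpha>))"
  have W: "W \<ge> 0" using \<delta> by (simp add: W_def)
  define z where "z = (\<lambda>j::int. complex_of_real (of_int j * h))"
  define e where "e = (\<lambda>l j. u l (z j) - Y $ (l * (2 * N + 1) + nat (j + int N)))"
  define S where "S = (\<Sum>j = - int N..int N. (\<Sum>l<n. \<kappa> i l (z j) * e l j) * of_real (J_SE j h (ereal x)))"
  have e: "cmod (e l j) \<le> W" if "l < n" "j \<in> {- int N..int N}" for l j
  proof -
    have "ix N (nat (j + int N)) = j" "nat (j + int N) < 2 * N + 1" using that by (auto simp: ix_def)
    then show ?thesis using nodal_error[OF Y that(1), of "nat (j + int N)"] by (simp add: e_def z_def W_def)
  qed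
  have "cmod S \<le> (\<Sum>j = - int N..int N. (of_nat n * c * W * Bs) * (h * exp (- \<alpha> * (h * \<bar>of_int j\<bar>))))"
    unfolding S_def
  proof (rule sum_norm_le)
    fix j assume j: "j \<in> {- int N..int N}"
    have "cmod (\<Sum>l<n. \<kappa> i l (z j) * e l j) \<le> (\<Sum>l<n. c * exp (- \<alpha> * (h * \<bar>of_int j\<bar>)) * W)"
      using \<kappa>[OF i] e[OF _ j] c unfolding z_def by (intro sum_norm_le) (auto simp: norm_mult intro!: mult_mono)
    then have "cmod ((\<Sum>l<n. \<kappa> i l (z j) * e l j) * of_real (J_SE j h (ereal x))) \<le> (of_nat n * (c * exp (- \<alpha> * (h * \<bar>of_int j\<bar>)) * W)) * (Bs * h)"
      unfolding norm_mult using J[of j "ereal x"] c W by (intro mult_mono) auto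
    then show "cmod ((\<Sum>l<n. \<kappa> i l (z j) * e l j) * of_real (J_SE j h (ereal x))) \<le> (of_nat n * c * W * Bs) * (h * exp (- \<alpha> * (h * \<bar>of_int j\<bar>)))"
      by (simp add: ac_simps)
  qed
  also have "\<dots> = (of_nat n * c * W * Bs) * (\<Sum>j = - int N..int N. h * exp (- \<alpha> * (h * \<bar>of_int j\<bar>)))"
    by (simp add: sum_distrib_left)
  also have "\<dots> \<le> (of_nat n * c * W * Bs) * (1 + 2 / \<alpha>)"
    using sum_exp_int_le[OF h(1) \<alpha>, of N] h c W Bs by (intro mult_left_mono) auto
  finally have S: "cmod S \<le> of_nat n * c * W * Bs * (1 + 2 / \<alpha>)" .
  have "u i (of_real x) - (r i + (\<Sum>j = - int N..int N. (\<gamma> i (z j) + (\<Sum>l<n. \<kappa> i l (z j) * Y $ (l * (2 * N + 1) + nat (j + int N)))) * of_real (J_SE j h (ereal x))))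
      = (u i (of_real x) - r i - (\<Sum>j = - int N..int N. (\<gamma> i (z j) + (\<Sum>l<n. \<kappa> i l (z j) * u l (z j))) * of_real (J_SE j h (ereal x)))) + S"
    by (simp add: S_def e_def right_diff_distrib left_diff_distrib distrib_right sum_subtractf sum.distrib)
  also have "cmod \<dots> \<le> \<delta> + of_nat n * c * W * Bs * (1 + 2 / \<alpha>)"
    using quad[OF i, of x] S unfolding z_def by (intro order_trans[OF norm_triangle_ineq] add_mono)
  also have "\<dots> = \<delta> * (1 + 2 * (of_nat n)\<^sup>2 * c * Bs * (1 + 2 / \<alpha>) * exp (of_nat n * c * (1 + 2 / \<alpha>)))"
  proof -
    define w where "w = 1 + 2 / \<alpha>"
    define x where "x = exp (of_nat n * c * w)"
    show ?thesis unfolding W_def w_def[symmetric] x_def[symmetric] by (simp add: power2_eq_square algebra_simps)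
  qed
  finally show ?thesis unfolding z_def .
qed

lemma SE_Sinc_Nystroem_eq:
  fixes Y :: "complex Matrix.vec"
  shows "SE_Sinc_Nystroem a b h N n k g r Y i t = r i + (\<Sum>j = - int N..int N. (\<gamma> i (of_real (of_int j * h)) +
      (\<Sum>l<n. \<kappa> i l (of_real (of_int j * h)) * Y $ (l * (2 * N + 1) + nat (j + int N)))) * of_real (J_SE j h (phi_SE a b t)))"
  unfolding SE_Sinc_Nystroem_def node_weight[symmetric] distrib_right sum_distrib_right
  by (simp only: ac_simps)

end

theorem theorem11:
  fixes a b d \<alpha> :: real and n :: nat
    and k :: "nat \<Rightarrow> nat \<Rightarrow> complex \<Rightarrow> complex"
    and g :: "nat \<Rightarrow> complex \<Rightarrow> complex"
    and r :: "nat \<Rightarrow> complex"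
    and y :: "nat \<Rightarrow> real \<Rightarrow> complex"
  assumes "a < b" and "n \<ge> 1" and "0 < d" and "d < pi" and "\<alpha> > 0"
    and "\<forall>i<n. \<forall>j<n. (\<lambda>z. k i j z * Q_fun a b z) \<in> L_space a b \<alpha> (psi_SE a b ` strip d)"
    and "\<forall>i<n. (\<lambda>z. g i z * Q_fun a b z) \<in> L_space a b \<alpha> (psi_SE a b ` strip d)"
    and "ivp_solution a b n k g r y"
  defines "h \<equiv> \<lambda>N::nat. sqrt (pi * d / (\<alpha> * real N))"
  shows "\<exists>N0::nat. \<exists>C::real. N0 \<ge> 1 \<and> (\<forall>N\<ge>N0.
    (\<exists>!Y. SE_Sinc_system a b (h N) N n k g r Y) \<and>
    (\<forall>Y. SE_Sinc_system a b (h N) N n k g r Y \<longrightarrow>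
      (\<forall>i<n. \<forall>t\<in>{a..b}.
        cmod (y i t - SE_Sinc_Nystroem a b (h N) N n k g r Y i t)
          \<le> C * exp (- sqrt (pi * d * \<alpha> * real N)))))"
proof -
  note ab = assms(1) and d = assms(3,4) and \<alpha> = assms(5) and sol = assms(8)
  have k: "(\<lambda>z. k i l z * Q_fun a b z) \<in> L_space a b \<alpha> (psi_SE a b ` strip d)" if "i < n" "l < n" for i l
    using assms(6) that by blast
  have g: "(\<lambda>z. g i z * Q_fun a b z) \<in> L_space a b \<alpha> (psi_SE a b ` strip d)" if "i < n" for i
    using assms(7) that by blast
  define \<kappa> where "\<kappa> = (\<lambda>i l z. k i l (psi_SE a b z) * deriv (psi_SE a b) z)"
  define \<gamma> where "\<gamma> = (\<lambda>i z. g i (psi_SE a b z) * deriv (psi_SE a b) z)"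
  have s0: "of_real s \<in> strip d" for s :: real using d by (simp add: strip_def)
  have mono: "cmod w \<le> c' * exp (- \<alpha> * \<bar>s\<bar>)" if "cmod w \<le> c * exp (- \<alpha> * \<bar>s\<bar>)" "c \<le> c'" for w c c' s
    by (rule order_trans[OF that(1) mult_right_mono[OF that(2)]]) simp
  have "\<exists>c\<ge>0. \<forall>p\<in>{..<n} \<times> {..<n}. \<forall>z\<in>strip d. cmod (\<kappa> (fst p) (snd p) z) \<le> c * exp (- \<alpha> * \<bar>Re z\<bar>)"
  proof (rule finite_common_bound)
    show "\<exists>c\<ge>0. \<forall>z\<in>strip d. cmod (\<kappa> (fst p) (snd p) z) \<le> c * exp (- \<alpha> * \<bar>Re z\<bar>)"
      if "p \<in> {..<n} \<times> {..<n}" for p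
      unfolding \<kappa>_def by (rule L_space_transformed(2)[OF ab d \<alpha> k]) (use that in auto)
  qed (use mono in \<open>blast | simp\<close>)+
  then obtain c1 where c1: "c1 \<ge> 0" "\<And>i l z. i < n \<Longrightarrow> l < n \<Longrightarrow> z \<in> strip d \<Longrightarrow> cmod (\<kappa> i l z) \<le> c1 * exp (- \<alpha> * \<bar>Re z\<bar>)"
    by force
  have "\<exists>c\<ge>0. \<forall>i\<in>{..<n}. \<forall>z\<in>strip d. cmod (\<gamma> i z) \<le> c * exp (- \<alpha> * \<bar>Re z\<bar>)"
  proof (rule finite_common_bound)
    show "\<exists>c\<ge>0. \<forall>z\<in>strip d. cmod (\<gamma> i z) \<le> c * exp (- \<alpha> * \<bar>Re z\<bar>)" if "i \<in> {..<n}" for i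
      unfolding \<gamma>_def by (rule L_space_transformed(2)[OF ab d \<alpha> g]) (use that in auto)
  qed (use mono in \<open>blast | simp\<close>)+
  then obtain c2 where c2: "c2 \<ge> 0" "\<And>i z. i < n \<Longrightarrow> z \<in> strip d \<Longrightarrow> cmod (\<gamma> i z) \<le> c2 * exp (- \<alpha> * \<bar>Re z\<bar>)"
    by force
  define c where "c = c1 + c2"
  have c: "c \<ge> 0" using c1(1) c2(1) by (simp add: c_def)
  have kb: "cmod (\<kappa> i l z) \<le> c * exp (- \<alpha> * \<bar>Re z\<bar>)" if "i < n" "l < n" "z \<in> strip d" for i l z
    using mono[OF c1(2)[OF that]] c2(1) by (simp add: c_def)
  have gb: "cmod (\<gamma> i z) \<le> c * exp (- \<alpha> * \<bar>Re z\<bar>)" if "i < n" "z \<in> strip d" for i z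
    using mono[OF c2(2)[OF that]] c1(1) by (simp add: c_def)
  have kh: "\<kappa> i l holomorphic_on strip d" if "i < n" "l < n" for i l
    unfolding \<kappa>_def by (rule L_space_transformed(1)[OF ab d \<alpha> k[OF that]])
  have gh: "\<gamma> i holomorphic_on strip d" if "i < n" for i
    unfolding \<gamma>_def by (rule L_space_transformed(1)[OF ab d \<alpha> g[OF that]])
  show ?thesis
  proof (rule ivp_solution_extends[OF ab d \<alpha> k g sol c kb[unfolded \<kappa>_def] gb[unfolded \<gamma>_def]])
    fix Bu u
    assume Bu: "Bu \<ge> 0"
      and u': "\<And>i z. i < n \<Longrightarrow> z \<in> strip d \<Longrightarrow> (u i has_field_derivative (g i (psi_SE a b z) * deriv (psi_SE a b) z +
        (\<Sum>l<n. k i l (psi_SE a b z) * deriv (psi_SE a b) z * u l z))) (at z)"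
      and ub: "\<And>i z. i < n \<Longrightarrow> z \<in> strip d \<Longrightarrow> cmod (u i z) \<le> Bu"
      and uy: "\<And>i s. i < n \<Longrightarrow> u i (of_real s) = y i (Re (psi_SE a b (of_real s)))"
    define F where "F = (\<lambda>i z. \<gamma> i z + (\<Sum>l<n. \<kappa> i l z * u l z))"
    have u: "(u i has_field_derivative F i z) (at z)" if "i < n" "z \<in> strip d" for i z
      using u'[OF that] unfolding F_def \<kappa>_def \<gamma>_def .
    have uh: "u i holomorphic_on strip d" if "i < n" for i
      using u[OF that] by (rule holomorphic_on_stripI)
    have Fh: "F i holomorphic_on strip d" if "i < n" for i
      unfolding F_def using that by (intro holomorphic_intros gh kh uh) auto
    \<comment> \<open>The integrand \<gamma> + \<kappa> u inherits the decay of the coefficients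
      because u is bounded by \<open>Bu\<close>.\<close>
    define C where "C = c + of_nat n * c * Bu"
    have C: "C \<ge> 0" using c Bu by (simp add: C_def)
    have Fb: "cmod (F i z) \<le> C * exp (- \<alpha> * \<bar>Re z\<bar>)" if "i < n" "z \<in> strip d" for i z
    proof -
      have "cmod (\<Sum>l<n. \<kappa> i l z * u l z) \<le> (\<Sum>l<n. c * exp (- \<alpha> * \<bar>Re z\<bar>) * Bu)"
        using that c by (intro sum_norm_le) (auto simp: norm_mult intro!: mult_mono kb[simplified] ub)
      then have "cmod (F i z) \<le> c * exp (- \<alpha> * \<bar>Re z\<bar>) + of_nat n * (c * exp (- \<alpha> * \<bar>Re z\<bar>) * Bu)"
        unfolding F_def using gb[OF that] by (intro order_trans[OF norm_triangle_ineq] add_mono) simp_all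
      also have "\<dots> = C * exp (- \<alpha> * \<bar>Re z\<bar>)" by (simp add: C_def algebra_simps)
      finally show ?thesis .
    qed
    have ycont: "continuous_on {a..b} (y i)" if "i < n" for i using sol that by (simp add: ivp_solution_def)
    have T: "Re (psi_SE a b (of_real s)) \<in> {a..b}" for s using psi_SE_real_in[OF ab, of s] by auto
    have ya: "y i a = r i" if "i < n" for i
    proof -
      have "a \<in> {a..b}" using ab by simp
      then have "((\<lambda>s. g i (of_real s) + (\<Sum>l<n. k i l (of_real s) * y l s)) has_integral (y i a - r i)) {a..a}"
        using sol that unfolding ivp_solution_def by blast
      moreover have "((\<lambda>s. g i (of_real s) + (\<Sum>l<n. k i l (of_real s) * y l s)) has_integral 0) {a..a}"
        using has_integral_refl(2)[of _ a] by simp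
      ultimately have "y i a - r i = 0" by (rule has_integral_unique)
      then show ?thesis by simp
    qed
    \<comment> \<open>Here the initial condition returns: x = - infinity is t = a, so the primitive
      \<open>u i\<close> measured from - infinity is \<open>u i\<close> minus
      \<open>r i\<close>.\<close>
    have lim: "((\<lambda>s. u i (of_real (- s))) \<longlongrightarrow> r i) at_top" if "i < n" for i
    proof -
      have "((\<lambda>s. y i (Re (psi_SE a b (of_real (- s))))) \<longlongrightarrow> y i a) at_top"
        by (rule continuous_on_tendsto_compose[OF ycont[OF that] psi_SE_real_limits(2) _ always_eventually[OF allI[OF T]]]) (use ab in simp)
      then show ?thesis by (simp only: uy[OF that] ya[OF that])
    qed
    have limb: "((\<lambda>s. u i (of_real s)) \<longlongrightarrow> y i b) at_top" if "i < n" for i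
    proof -
      have "((\<lambda>s. y i (Re (psi_SE a b (of_real s)))) \<longlongrightarrow> y i b) at_top"
        by (rule continuous_on_tendsto_compose[OF ycont[OF that] psi_SE_real_limits(1) _ always_eventually[OF allI[OF T]]]) (use ab in simp)
      then show ?thesis by (simp only: uy[OF that])
    qed
    obtain Bs where Bs: "Bs \<ge> 0" "\<And>j h u. h \<ge> 0 \<Longrightarrow> \<bar>J_SE j h u\<bar> \<le> Bs * h" using J_SE_bound by blast
    obtain B where B: "B \<ge> 1" "\<And>k. \<bar>sigma_SE k - (if k > 0 then 1 else 0)\<bar> \<le> B / (1 + \<bar>of_int k\<bar>)"
      using sigma_SE_bound by blast
    \<comment> \<open>The left side of the smallness condition of the locale without its factor sqrt
      h.\<close>
    define K where "K = of_nat n * c * B * (4 + 2 / \<alpha>) * exp (of_nat n * c * (1 + 2 / \<alpha>))"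
    obtain N0 where N0: "N0 \<ge> 1" "\<And>N. N \<ge> N0 \<Longrightarrow> h N \<le> pi * d / 4 \<and> h N \<le> 1 \<and> K * sqrt (h N) \<le> 1"
      unfolding h_def using sinc_step_small[OF d(1) \<alpha>, of K] by blast
    \<comment> \<open>Both exponentials of the quadrature bound coincide for this step size, so
      their coefficients add up.\<close>
    define C1 where "C1 = 48 * C / \<alpha> + 2 * Bs * C / \<alpha>"
    have C1: "C1 \<ge> 0" using C Bs \<alpha> by (simp add: C1_def)
    define C2 where "C2 = 1 + 2 * (of_nat n)\<^sup>2 * c * Bs * (1 + 2 / \<alpha>) * exp (of_nat n * c * (1 + 2 / \<alpha>))"
    have C2: "C2 \<ge> 0" using c Bs \<alpha> by (simp add: C2_def)
    have main: "(\<exists>!Y. SE_Sinc_system a b (h N) N n k g r Y) \<and>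
      (\<forall>Y. SE_Sinc_system a b (h N) N n k g r Y \<longrightarrow>
        (\<forall>i<n. \<forall>t\<in>{a..b}. cmod (y i t - SE_Sinc_Nystroem a b (h N) N n k g r Y i t)
            \<le> C1 * C2 * exp (- sqrt (pi * d * \<alpha> * real N))))" if N: "N \<ge> N0" for N
    proof -
      define H where "H = h N"
      define \<delta> where "\<delta> = C1 * exp (- sqrt (pi * d * \<alpha> * real N))"
      have Npos: "N > 0" using N N0(1) by linarith
      have H: "0 < H" "H \<le> 1" "H \<le> pi * d / 4" "K * sqrt H \<le> 1"
        using N0(2)[OF N] d \<alpha> Npos by (auto simp: H_def h_def)
      have \<delta>: "\<delta> \<ge> 0" using C1 by (simp add: \<delta>_def)
      interpret sinc_nystroem a b \<alpha> c n k g \<kappa> \<gamma> r u H B Bs \<delta> N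
      proof
        show "\<kappa> = (\<lambda>i l z. k i l (psi_SE a b z) * deriv (psi_SE a b) z)" by (fact \<kappa>_def)
        show "\<gamma> = (\<lambda>i z. g i (psi_SE a b z) * deriv (psi_SE a b) z)" by (fact \<gamma>_def)
        show "cmod (\<kappa> i l (of_real (of_int j * H))) \<le> c * exp (- \<alpha> * (H * \<bar>of_int j\<bar>))" if "i < n" "l < n" for i l j
          using kb[OF that s0[of "of_int j * H"]] H by (simp add: abs_mult mult.commute)
        show "of_nat n * c * B * (4 + 2 / \<alpha>) * sqrt H * exp (of_nat n * c * (1 + 2 / \<alpha>)) \<le> 1"
          using H(4) unfolding K_def by (simp only: ac_simps)
        fix i x assume i: "i < n"
        have "cmod (u i (of_real x) - r i - (\<Sum>j = - int N..int N. F i (of_real (of_int j * H)) * of_real (J_SE j H (ereal x))))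
            \<le> 48 * C / \<alpha> * exp (- (pi * d / H)) + 2 * Bs * C / \<alpha> * exp (- \<alpha> * (H * of_nat N))"
          by (rule sinc_indefinite_integration[OF Fh[OF i] d(1) H(1,3) Fb[OF i] C \<alpha> u[OF i s0] lim[OF i] Bs(1)])
            (use Bs(2) H in auto)
        also have "\<dots> = \<delta>"
          using exp_sinc_step[OF d(1) \<alpha> Npos] unfolding \<delta>_def C1_def H_def h_def
          by (simp add: distrib_right)
        finally show "cmod (u i (of_real x) - r i - (\<Sum>j = - int N..int N. (\<gamma> i (of_real (of_int j * H)) +
            (\<Sum>l<n. \<kappa> i l (of_real (of_int j * H)) * u l (of_real (of_int j * H)))) * of_real (J_SE j H (ereal x)))) \<le> \<delta>"
          unfolding F_def .
      qed (use H \<alpha> c B Bs \<delta> in auto)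
      have err: "cmod (y i t - SE_Sinc_Nystroem a b H N n k g r Y i t) \<le> \<delta> * C2"
        if Y: "SE_Sinc_system a b H N n k g r Y" and i: "i < n" and t: "t \<in> {a..b}" for Y i t
      proof -
        define A where "A = (\<lambda>j. \<gamma> i (of_real (of_int j * H)) +
            (\<Sum>l<n. \<kappa> i l (of_real (of_int j * H)) * Y $ (l * (2 * N + 1) + nat (j + int N))))"
        have nys: "SE_Sinc_Nystroem a b H N n k g r Y i t = r i + (\<Sum>j = - int N..int N. A j * of_real (J_SE j H (phi_SE a b t)))"
          unfolding A_def by (rule SE_Sinc_Nystroem_eq)
        have bnd: "cmod (u i (of_real x) - (r i + (\<Sum>j = - int N..int N. A j * of_real (J_SE j H (ereal x))))) \<le> \<delta> * C2" for x
          unfolding A_def C2_def by (rule nystroem_error[OF Y i])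
        consider "t = a" | "a < t" "t < b" | "t = b" using t by fastforce
        then show ?thesis
        proof cases
          \<comment> \<open>At t = a all \<open>J_SE\<close> are 0, hence the Nystroem solution
            takes the exact value \<open>r i\<close>.\<close>
          case 1
          then have "y i t - SE_Sinc_Nystroem a b H N n k g r Y i t = 0"
            unfolding nys using ya[OF i] by (simp add: phi_SE_def J_SE_def)
          then show ?thesis using \<delta> C2 by simp
        next
          case 2
          define x where "x = ln ((t - a) / (b - t))"
          have "u i (of_real x) = y i t" unfolding uy[OF i] x_def psi_SE_phi_SE[OF 2] by simp
          moreover have "phi_SE a b t = ereal x" using 2 by (simp add: phi_SE_def x_def)
          ultimately show ?thesis using bnd[of x] unfolding nys by (simp only:)
        next
          \<comment> \<open>The point t = b is x = infinity, outside the domain of \<open>u\<close>;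
            the bound is uniform in x and passes to the limit.\<close>
          case 3
          have phi: "phi_SE a b t = \<infinity>" using 3 ab by (simp add: phi_SE_def)
          have "((\<lambda>x. cmod (u i (of_real x) - (r i + (\<Sum>j = - int N..int N. A j * of_real (J_SE j H (ereal x)))))) \<longlongrightarrow>
              cmod (y i b - (r i + (\<Sum>j = - int N..int N. A j * of_real (J_SE j H \<infinity>))))) at_top"
            by (intro tendsto_intros limb[OF i] J_SE_at_top H)
          then have "cmod (y i b - (r i + (\<Sum>j = - int N..int N. A j * of_real (J_SE j H \<infinity>)))) \<le> \<delta> * C2"
            by (rule tendsto_upperbound) (use bnd in auto)
          then show ?thesis unfolding nys phi unfolding 3 .
        qed
      qed
      have "\<delta> * C2 = C1 * C2 * exp (- sqrt (pi * d * \<alpha> * real N))" by (simp add: \<delta>_def)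
      then show ?thesis using unique_solvability err unfolding H_def by (simp only:) blast
    qed
    show ?thesis using N0(1) main by blast
  qed
qed

end
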